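(* Let $c>4$ be fixed, let $\bar g(x):=-x-2c\,\dfrac{x}{1+x^2}$ for $x\ge0$ and $\bar g(x):=-(1+2c)x-x^3$ for $x<0$, and let $x_1(c):=\sqrt{c-1-\sqrt{c(c-4)}}$, $x_2(c):=\sqrt{c-1+\sqrt{c(c-4)}}$, $\lambda_1(c):=-\bar g(x_2(c))$, $\lambda_2(c):=-\bar g(x_1(c))$, $\alpha:=\frac{\lambda_1(c)+\lambda_2(c)}{2}$, $\beta:=\frac{\lambda_2(c)-\lambda_1(c)}{2}$. Let $r>0$ be fixed and, for $\varepsilon>0$, let $$y_\varepsilon(t):=\alpha+(\beta+\varepsilon^r)\sin(\varepsilon t),\qquad (E_\varepsilon)\quad x'=y_\varepsilon(t)+\bar g(x).$$ (i) If $r>1$, then $(E_\varepsilon)$ does not have relaxation oscillations. In particular, for sufficiently small $\varepsilon>0$, there are exactly three periodic positive solutions of $(E_\varepsilon)$: the upper and lower ones are hyperbolic attractive, while the middle one is hyperbolic repulsive and separates the basins of attraction of the other two in the positive half-plane. That is, $(E_\varepsilon)$ exhibits bistability. (ii) If $r<1$, then $(E_\varepsilon)$ has a relaxation oscillation. In particular, for sufficiently small $\varepsilon>0$, there exists only one bounded positive solution of $(E_\varepsilon)$, which in addition is periodic, hyperbolic attractive, and attracts all other positive solutions as time increases. That is, $(E_\varepsilon)$ exhibits uniform stability.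
   Context: A bounded solution is a solution defined on all of $\mathbb{R}$ and bounded. Two bounded solutions $b_1,b_2$ are uniformly separated if $\inf_{t\in\mathbb{R}}|b_1(t)-b_2(t)|>0$. A bounded solution $b$ of $(E_\varepsilon)$ is hyperbolic attractive (resp. hyperbolic repulsive) if there exist $k\ge1$ and $\gamma>0$ such that $\exp\left(\int_s^t \bar g'(b(\tau))\,d\tau\right)\le k\,e^{-\gamma(t-s)}$ whenever $t\ge s$ (resp. $\le k\,e^{\gamma(t-s)}$ whenever $t\le s$). $(E_\varepsilon)$ exhibits uniform stability if it has exactly one bounded solution and it is hyperbolic attractive, and it exhibits bistability if it has exactly two attractive hyperbolic solutions and they are uniformly separated and positive. "Positive" means $\ge0$; the positive half-plane is $\{(t,x):x\ge0\}$. A solution $m$ separates the basins of attraction in the positive half-plane of attractive hyperbolic solutions $l<m<u$ if any solution $x$ with $x(s)>m(s)$ for some $s$ satisfies $\lim_{t\to\infty}(u(t)-x(t))=0$ and any solution $x$ with $0\le x(s)<m(s)$ for some $s$ satisfies $\lim_{t\to\infty}(l(t)-x(t))=0$. Limit curve $\Gamma$: for $c>4$, $-\bar g$ on $[0,\infty)$ is strictly increasing on $[0,x_1(c)]$, strictly decreasing on $[x_1(c),x_2(c)]$ and strictly increasing on $[x_2(c),\infty)$. Let $\hat x_1\in(0,x_1(c))$ be defined by $-\bar g(\hat x_1)=\lambda_1(c)$ and $\hat x_2>x_2(c)$ by $-\bar g(\hat x_2)=\lambda_2(c)$. Then $\Gamma\subset\mathbb{R}^2$ is the closed curve formed by the non-repulsive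 fixed points of $x'=\lambda+\bar g(x)$ for $\lambda\in[\lambda_1(c),\lambda_2(c)]$ together with two vertical segments joining each saddle-node bifurcation point with the other stable branch: $$\Gamma:=\{(-\bar g(x),x): x\in[\hat x_1,x_1(c)]\cup[x_2(c),\hat x_2]\}\cup\big(\{\lambda_1(c)\}\times[\hat x_1,x_2(c)]\big)\cup\big(\{\lambda_2(c)\}\times[x_1(c),\hat x_2]\big).$$ An $\varepsilon$-family $x_\varepsilon(t)$ (defined for all sufficiently small $\varepsilon>0$) of $2\pi/\varepsilon$-periodic solutions of $(E_\varepsilon)$ is a relaxation oscillation if the closed curves $\{(y_\varepsilon(t),x_\varepsilon(t)): t\in\mathbb{R}\}$ converge in Hausdorff distance to $\Gamma$ as $\varepsilon\to0^+$. *)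

theory Defs
  imports "HOL-Analysis.Analysis"
begin

definition solves :: "(real \<Rightarrow> real) \<Rightarrow> (real \<Rightarrow> real) \<Rightarrow> (real \<Rightarrow> real) \<Rightarrow> real set \<Rightarrow> bool" where
  "solves y g x J \<longleftrightarrow> open J \<and> is_interval J \<and>
     (\<forall>t\<in>J. (x has_real_derivative y t + g (x t)) (at t))"

text \<open>The values of \<open>x\<close> outside its domain \<open>J\<close> are irrelevant.\<close>

definition maximal_solution ::
    "(real \<Rightarrow> real) \<Rightarrow> (real \<Rightarrow> real) \<Rightarrow> (real \<Rightarrow> real) \<Rightarrow> real set \<Rightarrow> bool" where
  "maximal_solution y g x J \<longleftrightarrow> solves y g x J \<and>
     (\<forall>z K. solves y g z K \<and> J \<subseteq> K \<and> (\<forall>t\<in>J. z t = x t) \<longrightarrow> K = J)"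

definition bounded_solution :: "(real \<Rightarrow> real) \<Rightarrow> (real \<Rightarrow> real) \<Rightarrow> (real \<Rightarrow> real) \<Rightarrow> bool" where
  "bounded_solution y g b \<longleftrightarrow> solves y g b UNIV \<and> bounded (range b)"

definition periodic_with :: "real \<Rightarrow> (real \<Rightarrow> real) \<Rightarrow> bool" where
  "periodic_with T x \<longleftrightarrow> (\<forall>t. x (t + T) = x t)"

definition periodic_solution :: "(real \<Rightarrow> real) \<Rightarrow> (real \<Rightarrow> real) \<Rightarrow> (real \<Rightarrow> real) \<Rightarrow> bool" where
  "periodic_solution y g x \<longleftrightarrow> solves y g x UNIV \<and> (\<exists>T>0. periodic_with T x)"

definition positive_function :: "(real \<Rightarrow> real) \<Rightarrow> bool" where
  "positive_function x \<longleftrightarrow> (\<forall>t. 0 \<le> x t)"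

definition uniformly_separated :: "(real \<Rightarrow> real) \<Rightarrow> (real \<Rightarrow> real) \<Rightarrow> bool" where
  "uniformly_separated b1 b2 \<longleftrightarrow> (INF t. \<bar>b1 t - b2 t\<bar>) > 0"

text \<open>The interval integral is oriented: exchanging its endpoints changes the sign.\<close>

definition hyperbolic_attractive ::
    "(real \<Rightarrow> real) \<Rightarrow> (real \<Rightarrow> real) \<Rightarrow> (real \<Rightarrow> real) \<Rightarrow> bool" where
  "hyperbolic_attractive y g b \<longleftrightarrow> bounded_solution y g b \<and>
     (\<exists>k\<ge>1. \<exists>\<gamma>>0. \<forall>s t. s \<le> t \<longrightarrow>
        exp (LBINT \<tau>=ereal s..ereal t. deriv g (b \<tau>)) \<le> k * exp (- \<gamma> * (t - s)))"

definition hyperbolic_repulsive ::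
    "(real \<Rightarrow> real) \<Rightarrow> (real \<Rightarrow> real) \<Rightarrow> (real \<Rightarrow> real) \<Rightarrow> bool" where
  "hyperbolic_repulsive y g b \<longleftrightarrow> bounded_solution y g b \<and>
     (\<exists>k\<ge>1. \<exists>\<gamma>>0. \<forall>s t. t \<le> s \<longrightarrow>
        exp (LBINT \<tau>=ereal s..ereal t. deriv g (b \<tau>)) \<le> k * exp (\<gamma> * (t - s)))"

definition uniform_stability :: "(real \<Rightarrow> real) \<Rightarrow> (real \<Rightarrow> real) \<Rightarrow> bool" where
  "uniform_stability y g \<longleftrightarrow>
     (\<exists>b. {x. bounded_solution y g x} = {b} \<and> hyperbolic_attractive y g b)"

definition bistability :: "(real \<Rightarrow> real) \<Rightarrow> (real \<Rightarrow> real) \<Rightarrow> bool" where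
  "bistability y g \<longleftrightarrow>
     (\<exists>b1 b2. b1 \<noteq> b2 \<and> {x. hyperbolic_attractive y g x} = {b1, b2} \<and>
        uniformly_separated b1 b2 \<and> positive_function b1 \<and> positive_function b2)"

text \<open>A solution through a point at time \<open>s\<close> is a maximal one; that it exists for all later
  times is part of the claim that it is asymptotic to \<open>b\<close>.\<close>

definition attracts ::
    "(real \<Rightarrow> real) \<Rightarrow> (real \<Rightarrow> real) \<Rightarrow> (real \<Rightarrow> real) \<Rightarrow> real \<Rightarrow> (real \<Rightarrow> bool) \<Rightarrow> bool" where
  "attracts y g b s P \<longleftrightarrow>
     (\<forall>x J. maximal_solution y g x J \<and> s \<in> J \<and> P (x s) \<longrightarrow>
        {s..} \<subseteq> J \<and> ((\<lambda>t. b t - x t) \<longlongrightarrow> 0) at_top)"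

definition separates_basins ::
    "(real \<Rightarrow> real) \<Rightarrow> (real \<Rightarrow> real) \<Rightarrow> (real \<Rightarrow> real) \<Rightarrow> (real \<Rightarrow> real) \<Rightarrow> (real \<Rightarrow> real) \<Rightarrow> bool" where
  "separates_basins y g l m u \<longleftrightarrow>
     (\<forall>s. attracts y g u s (\<lambda>v. m s < v) \<and> attracts y g l s (\<lambda>v. 0 \<le> v \<and> v < m s))"

definition gbar :: "real \<Rightarrow> real \<Rightarrow> real" where
  "gbar c x = (if x \<ge> 0 then - x - 2 * c * (x / (1 + x\<^sup>2)) else - (1 + 2 * c) * x - x ^ 3)"

definition x1 :: "real \<Rightarrow> real" where
  "x1 c = sqrt (c - 1 - sqrt (c * (c - 4)))"

definition x2 :: "real \<Rightarrow> real" where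
  "x2 c = sqrt (c - 1 + sqrt (c * (c - 4)))"

definition lam1 :: "real \<Rightarrow> real" where
  "lam1 c = - gbar c (x2 c)"

definition lam2 :: "real \<Rightarrow> real" where
  "lam2 c = - gbar c (x1 c)"

definition alpha :: "real \<Rightarrow> real" where
  "alpha c = (lam1 c + lam2 c) / 2"

definition beta :: "real \<Rightarrow> real" where
  "beta c = (lam2 c - lam1 c) / 2"

definition forcing :: "real \<Rightarrow> real \<Rightarrow> real \<Rightarrow> real \<Rightarrow> real" where
  "forcing c r \<epsilon> t = alpha c + (beta c + \<epsilon> powr r) * sin (\<epsilon> * t)"

text \<open>Intended for nonempty bounded sets, on which the suprema are finite.\<close>

definition hausdorff_distance :: "'a::metric_space set \<Rightarrow> 'a set \<Rightarrow> real" where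
  "hausdorff_distance A B = max (SUP a\<in>A. infdist a B) (SUP b\<in>B. infdist b A)"

definition xhat1 :: "real \<Rightarrow> real" where
  "xhat1 c = (THE x. x \<in> {0<..<x1 c} \<and> - gbar c x = lam1 c)"

definition xhat2 :: "real \<Rightarrow> real" where
  "xhat2 c = (THE x. x > x2 c \<and> - gbar c x = lam2 c)"

definition limit_curve :: "real \<Rightarrow> (real \<times> real) set" where
  "limit_curve c =
     {(- gbar c x, x) | x. x \<in> {xhat1 c..x1 c} \<union> {x2 c..xhat2 c}} \<union>
     ({lam1 c} \<times> {xhat1 c..x2 c} \<union> {lam2 c} \<times> {x1 c..xhat2 c})"

definition relaxation_oscillation :: "real \<Rightarrow> real \<Rightarrow> (real \<Rightarrow> real \<Rightarrow> real) \<Rightarrow> bool" where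
  "relaxation_oscillation c r x \<longleftrightarrow>
     (\<forall>\<^sub>F \<epsilon> in at_right 0. solves (forcing c r \<epsilon>) (gbar c) (x \<epsilon>) UNIV \<and>
        periodic_with (2 * pi / \<epsilon>) (x \<epsilon>)) \<and>
     ((\<lambda>\<epsilon>. hausdorff_distance (range (\<lambda>t. (forcing c r \<epsilon> t, x \<epsilon> t))) (limit_curve c)) \<longlongrightarrow> 0)
       (at_right 0)"

end

theory Submission
  imports Defs
begin

text \<open>
  On \<open>x \<ge> 0\<close> the equation is \<open>x' = y - f x\<close> with an S-shaped \<open>f\<close>, increasing outside the folds
  \<open>p < q\<close> and decreasing between them, and with the slow forcing \<open>y\<close> that exceeds the fold values by
  \<open>e = \<epsilon> powr r\<close>. Every difference of two solutions, and every linearization, decays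
  at rate \<open>f'\<close> on the outer branches and grows on the middle one.

  If \<open>r > 1\<close>, the constant \<open>p\<close>, corrected by a small cubic in time while \<open>y > f p\<close>, is an
  upper solution, because the excess acts for a time of order \<open>sqrt e / \<epsilon>\<close> only; likewise for \<open>q\<close>. These
  two barriers split the strip into a contracting lower, an expanding middle and a contracting upper
  region, and the time-\<open>T\<close> map has one fixed point in each.

  If \<open>r < 1\<close>, the excess acts long enough to push every solution over the fold, as
  \<open>arctan ((x - p) / sqrt e)\<close> shows. All bounded solutions then follow the stable branches for almost the
  whole period, so the time-\<open>T\<close> map is a contraction, and \<open>x' = y - f x\<close> is small away from the jumps,
  which gives the convergence to the limit curve.

  The reflection \<open>x \<mapsto> - x\<close>, combined with a shift by half a period, exchanges the two folds.
\<close>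

section \<open>Scalar differential inequalities\<close>

text \<open>The exponent 1 separates the two regimes because both mechanisms compare
  \<open>e\<close> with \<open>\<epsilon>\<close>. The excess forcing acts for a time of order
  \<open>sqrt e / \<epsilon>\<close>, so the cubic corrector has height of order
  \<open>e * sqrt e / \<epsilon>\<close>. Since \<open>f\<close> drops at most quadratically at the
  fold, this is harmless as long as the squared height is of order \<open>e\<close>, that is
  \<open>e \<le> const * \<epsilon>\<close>. In the passage through the fold, \<open>arctan\<close>
  advances by order \<open>sqrt e\<close> times \<open>sqrt e / \<epsilon>\<close>, which exceeds pi
  once \<open>\<epsilon> \<le> const * e\<close>. The obstacle is that contraction is not pointwise:
  solutions overshoot the folds or cross the middle branch. Rates are therefore summed over a
  period: an antiderivative \<open>\<Phi>\<close> of \<open>- f' (\<xi> t)\<close> is shown to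
  change by at most -1 or at least 1. As \<open>gbar c\<close> is cubic for negative arguments, a
  globally Lipschitz \<open>field c\<close> replaces it there. The forcing stays positive, so
  bounded solutions of either equation are positive and the two equations have the same bounded
  solutions.\<close>

lemma barrier:
  fixes h h' :: "real \<Rightarrow> real"
  assumes ab: "a \<le> b" and ha: "h a \<le> 0"
    and der: "\<And>t. a \<le> t \<Longrightarrow> t \<le> b \<Longrightarrow> (h has_real_derivative h' t) (at t)"
    and dec: "\<And>t. a \<le> t \<Longrightarrow> t \<le> b \<Longrightarrow> h t > 0 \<Longrightarrow> h' t \<le> 0"
  shows "h b \<le> 0"
proof (rule ccontr)
  assume "\<not> h b \<le> 0"
  then have hb: "h b > 0" by simp
  \<comment> \<open>The last time at which \<open>h\<close> is nonpositive is \<open>Sup S\<close>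
    below. Beyond it \<open>h\<close> is positive, so \<open>dec\<close> applies at the mean value
    point and \<open>h\<close> cannot climb to \<open>h b > 0\<close>.\<close>
  have cont: "continuous_on {a..b} h"
    by (rule continuous_at_imp_continuous_on) (use der DERIV_isCont in fastforce)
  define S where "S = {a..b} \<inter> h -` {..0}"
  have "closed S" unfolding S_def
    by (rule continuous_closed_preimage[OF cont]) auto
  moreover have "a \<in> S" using ab ha by (auto simp: S_def)
  moreover have bdd: "bdd_above S" by (auto simp: S_def bdd_above_def)
  ultimately have mem: "Sup S \<in> S" by (intro closed_contains_Sup) auto
  define s where "s = Sup S"
  have s: "a \<le> s" "s \<le> b" "h s \<le> 0" using mem by (auto simp: S_def s_def)
  with hb have sb: "s < b" by (cases "s = b") auto
  obtain \<xi> where \<xi>: "s < \<xi>" "\<xi> < b" "h b - h s = (b - s) * h' \<xi>"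
    using MVT2[OF sb, of h h'] der s by force
  have "h \<xi> > 0"
  proof (rule ccontr)
    assume "\<not> h \<xi> > 0"
    then have "\<xi> \<in> S" using \<xi> s by (auto simp: S_def)
    then have "\<xi> \<le> s" unfolding s_def using bdd by (rule cSup_upper)
    with \<xi> show False by simp
  qed
  then have "h' \<xi> \<le> 0" using dec[of \<xi>] \<xi> s by auto
  then have "(b - s) * h' \<xi> \<le> 0" using sb by (simp add: mult_nonneg_nonpos)
  with \<xi> hb s show False by linarith
qed

text \<open>Above the level \<open>d\<close> the function falls at rate at least \<open>k\<close>,
  so an initial excess of \<open>k * \<tau>\<close> is used up by time \<open>a + \<tau>\<close>;
  from then on \<open>d\<close> is a barrier. With \<open>k = 0\<close> and
  \<open>\<tau> = 0\<close> this is plain invariance.\<close>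

lemma absorbing:
  fixes h h' :: "real \<Rightarrow> real"
  assumes \<tau>: "0 \<le> \<tau>" "a + \<tau> \<le> b" and k: "0 \<le> k" and ha: "h a \<le> d + k * \<tau>"
    and der: "\<And>t. a \<le> t \<Longrightarrow> t \<le> b \<Longrightarrow> (h has_real_derivative h' t) (at t)"
    and dec: "\<And>t. a \<le> t \<Longrightarrow> t \<le> b \<Longrightarrow> h t > d \<Longrightarrow> h' t \<le> - k"
  shows "h b \<le> d"
proof -
  have "h (a + \<tau>) - d - k * (\<tau> - (a + \<tau> - a)) \<le> 0"
  proof (rule barrier[where h' = "\<lambda>t. h' t + k" and h = "\<lambda>t. h t - d - k * (\<tau> - (t - a))" and a = a])
    fix t assume t: "a \<le> t" "t \<le> a + \<tau>"
    show "((\<lambda>t. h t - d - k * (\<tau> - (t - a))) has_real_derivative h' t + k) (at t)"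
      by (rule derivative_eq_intros der | use t \<tau> in simp)+
    assume "0 < h t - d - k * (\<tau> - (t - a))"
    moreover have "k * (\<tau> - (t - a)) \<ge> 0" using t k by simp
    ultimately have "h t > d" by linarith
    then show "h' t + k \<le> 0" using dec[of t] t \<tau> by simp
  qed (use \<tau> ha in auto)
  then have "h (a + \<tau>) - d \<le> 0" by simp
  then have "h b - d \<le> 0"
  proof (rule barrier[where h' = h' and h = "\<lambda>t. h t - d" and a = "a + \<tau>", rotated])
    fix t assume t: "a + \<tau> \<le> t" "t \<le> b"
    show "((\<lambda>t. h t - d) has_real_derivative h' t) (at t)"
      by (rule derivative_eq_intros der | use t \<tau> in simp)+
    show "0 < h t - d \<Longrightarrow> h' t \<le> 0" using dec[of t] t \<tau> k by simp
  qed (use \<tau> in auto)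
  then show ?thesis by simp
qed

lemma absorbing_below:
  fixes h h' :: "real \<Rightarrow> real"
  assumes \<tau>: "0 \<le> \<tau>" "a + \<tau> \<le> b" and k: "0 \<le> k" and ha: "h a \<ge> d - k * \<tau>"
    and der: "\<And>t. a \<le> t \<Longrightarrow> t \<le> b \<Longrightarrow> (h has_real_derivative h' t) (at t)"
    and dec: "\<And>t. a \<le> t \<Longrightarrow> t \<le> b \<Longrightarrow> h t < d \<Longrightarrow> h' t \<ge> k"
  shows "h b \<ge> d"
proof -
  have "- h b \<le> - d"
    by (rule absorbing[where h = "\<lambda>t. - h t" and b = b and h' = "\<lambda>t. - h' t" and k = k and \<tau> = \<tau> and a = a])
       (use assms in \<open>auto intro!: derivative_eq_intros\<close>)
  then show ?thesis by simp
qed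

text \<open>Boundedness on the whole line allows a start so far in the past that any possible excess
  over \<open>d\<close> has been used up by time \<open>t\<close>.\<close>

lemma bounded_le_of_absorbing:
  fixes h h' :: "real \<Rightarrow> real"
  assumes bd: "bounded (range h)" and k: "0 < k"
    and der: "\<And>t. (h has_real_derivative h' t) (at t)"
    and dec: "\<And>t. h t > d \<Longrightarrow> h' t \<le> - k"
  shows "h t \<le> d"
proof -
  obtain C where C: "\<And>s. \<bar>h s\<bar> \<le> C" using bd by (auto simp: bounded_iff)
  define \<tau> where "\<tau> = (C + \<bar>d\<bar>) / k"
  have C0: "C \<ge> 0" using C[of 0] by linarith
  show ?thesis
  proof (rule absorbing[where h = h and h' = h' and k = k and \<tau> = \<tau> and a = "t - \<tau>" and b = t])
    have "C \<le> d + k * \<tau>" using k by (simp add: \<tau>_def)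
    then show "h (t - \<tau>) \<le> d + k * \<tau>" using C[of "t - \<tau>"] by linarith
    show "0 \<le> \<tau>" using k C0 by (simp add: \<tau>_def)
  qed (use k der dec in auto)
qed

lemma bounded_ge_of_absorbing:
  fixes h h' :: "real \<Rightarrow> real"
  assumes bd: "bounded (range h)" and k: "0 < k"
    and der: "\<And>t. (h has_real_derivative h' t) (at t)"
    and dec: "\<And>t. h t < d \<Longrightarrow> h' t \<ge> k"
  shows "h t \<ge> d"
proof -
  have "bounded (range (\<lambda>t. - h t))" using bd by (auto simp: bounded_iff)
  from bounded_le_of_absorbing[OF this k, of "\<lambda>t. - h' t" "- d" t]
  have "- h t \<le> - d" using der dec by (auto intro!: derivative_eq_intros)
  then show ?thesis by simp
qed

text \<open>The factor \<open>exp (- L * t)\<close> removes the term \<open>L * (x t - u t)\<close>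
  from the derivative of the difference. A one-sided bound where \<open>x\<close> lies above
  \<open>u\<close> is enough, so \<open>u\<close> may be any upper solution.\<close>

lemma comparison:
  fixes x u x' u' :: "real \<Rightarrow> real"
  assumes ab: "a \<le> b" and le: "x a \<le> u a"
    and dx: "\<And>t. a \<le> t \<Longrightarrow> t \<le> b \<Longrightarrow> (x has_real_derivative x' t) (at t)"
    and du: "\<And>t. a \<le> t \<Longrightarrow> t \<le> b \<Longrightarrow> (u has_real_derivative u' t) (at t)"
    and ineq: "\<And>t. a \<le> t \<Longrightarrow> t \<le> b \<Longrightarrow> x t > u t \<Longrightarrow> x' t - u' t \<le> L * (x t - u t)"
  shows "x b \<le> u b"
proof -
  have "(x b - u b) * exp (- L * b) \<le> 0"
  proof (rule barrier[where h = "\<lambda>t. (x t - u t) * exp (- L * t)" and a = a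
        and h' = "\<lambda>t. (x' t - u' t - L * (x t - u t)) * exp (- L * t)"])
    fix t assume t: "a \<le> t" "t \<le> b"
    show "((\<lambda>t. (x t - u t) * exp (- L * t)) has_real_derivative
         (x' t - u' t - L * (x t - u t)) * exp (- L * t)) (at t)"
      by (rule derivative_eq_intros dx[OF t] du[OF t] refl | simp add: algebra_simps)+
    assume "0 < (x t - u t) * exp (- L * t)"
    then have "x t > u t" by (simp add: zero_less_mult_iff)
    then show "(x' t - u' t - L * (x t - u t)) * exp (- L * t) \<le> 0"
      using ineq[OF t] by (simp add: mult_le_0_iff)
  qed (use ab le in \<open>auto simp: mult_le_0_iff\<close>)
  then show ?thesis by (simp add: mult_le_0_iff)
qed

lemma increment_le:
  fixes \<Phi> \<Phi>' :: "real \<Rightarrow> real"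
  assumes "a \<le> b"
    and "\<And>t. a \<le> t \<Longrightarrow> t \<le> b \<Longrightarrow> (\<Phi> has_real_derivative \<Phi>' t) (at t)"
    and "\<And>t. a \<le> t \<Longrightarrow> t \<le> b \<Longrightarrow> \<Phi>' t \<le> \<rho>"
  shows "\<Phi> b - \<Phi> a \<le> \<rho> * (b - a)"
proof (cases "a = b")
  case False
  then have "a < b" using assms by simp
  then obtain \<xi> where "a < \<xi>" "\<xi> < b" "\<Phi> b - \<Phi> a = (b - a) * \<Phi>' \<xi>"
    using MVT2[of a b \<Phi> \<Phi>'] assms by force
  then show ?thesis using assms(3)[of \<xi>] \<open>a < b\<close> by (simp add: mult.commute)
qed auto

text \<open>Normalised by \<open>H 0 = 0\<close>, this is the integral operator of the Picard
  iteration; its increments are the oriented integrals in the definitions of hyperbolicity.\<close>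

lemma continuous_antiderivative:
  fixes h :: "real \<Rightarrow> real"
  assumes h: "continuous_on UNIV h"
  obtains H where "\<And>t. (H has_real_derivative h t) (at t)"
    and "\<And>s t. (LBINT \<tau>=ereal s..ereal t. h \<tau>) = H t - H s" and "H 0 = 0"
proof -
  define H where "H t = (LBINT \<tau>=ereal 0..ereal t. h \<tau>)" for t
  have der: "(H has_real_derivative h t) (at t)" for t
  proof -
    define A where "A = \<bar>t\<bar> + 1"
    have "(H has_vector_derivative h t) (at t within {-A..A})"
      unfolding H_def
      by (rule interval_integral_FTC2) (auto simp: A_def intro: continuous_on_subset[OF h])
    moreover have "at t within {-A..A} = at t"
      by (rule at_within_interior) (auto simp: A_def abs_if split: if_splits)
    ultimately show ?thesis by (simp add: has_real_derivative_iff_has_vector_derivative)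
  qed
  have "(LBINT \<tau>=ereal s..ereal t. h \<tau>) = H t - H s" for s t
    by (rule interval_integral_FTC_finite)
       (auto intro: continuous_on_subset[OF h] has_field_derivative_at_within der
          simp flip: has_real_derivative_iff_has_vector_derivative)
  moreover have "H 0 = 0" by (simp add: H_def)
  ultimately show ?thesis using der that by blast
qed

lemma periodic_int:
  fixes x :: "real \<Rightarrow> 'a"
  assumes "\<And>t. x (t + T) = x t"
  shows "x (t + of_int k * T) = x t"
proof -
  have nat: "x (t + real n * T) = x t" for n t
  proof (induction n)
    case (Suc n)
    then show ?case using assms[of "t + real n * T"] by (simp add: algebra_simps)
  qed simp
  show ?thesis
  proof (cases "k \<ge> 0")
    case True
    then show ?thesis using nat[of t "nat k"] by simp
  next
    case False
    then show ?thesis using nat[of "t + of_int k * T" "nat (- k)"] by simp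
  qed
qed

lemma periodic_representative:
  fixes T :: real
  assumes "T > 0"
  obtains k :: int where "a \<le> t + of_int k * T" "t + of_int k * T < a + T"
proof -
  define k where "k = - \<lfloor>(t - a) / T\<rfloor>"
  have "of_int (- k) \<le> (t - a) / T" "(t - a) / T < of_int (- k) + 1" unfolding k_def by linarith+
  then have "a \<le> t + of_int k * T" "t + of_int k * T < a + T"
    using assms by (simp_all add: field_simps)
  with that show ?thesis by blast
qed

lemma periodic_bounded:
  fixes x :: "real \<Rightarrow> real"
  assumes per: "\<And>t. x (t + T) = x t" and T: "T > 0" and cont: "continuous_on UNIV x"
  shows "bounded (range x)"
proof -
  have "range x \<subseteq> x ` {0..T}"
  proof
    fix v assume "v \<in> range x"
    then obtain t where v: "v = x t" by blast
    obtain k where "0 \<le> t + of_int k * T" "t + of_int k * T < 0 + T"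
      using periodic_representative[OF T] by blast
    then show "v \<in> x ` {0..T}"
      using periodic_int[of x T t k, OF per] v by (intro image_eqI[of _ _ "t + of_int k * T"]) auto
  qed
  moreover have "bounded (x ` {0..T})"
    by (intro compact_imp_bounded compact_continuous_image continuous_on_subset[OF cont]) auto
  ultimately show ?thesis by (rule bounded_subset[rotated])
qed

section \<open>The scalar equation with globally Lipschitz field\<close>

text \<open>The sign convention makes increasing branches of \<open>f\<close> attracting; since the
  solutions live on all of the real line, no domain has to be carried along.\<close>

definition entire_solution :: "(real \<Rightarrow> real) \<Rightarrow> (real \<Rightarrow> real) \<Rightarrow> (real \<Rightarrow> real) \<Rightarrow> bool" where
  "entire_solution y f x \<longleftrightarrow> (\<forall>t. (x has_real_derivative y t - f (x t)) (at t))"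

lemma entire_solutionD:
  "entire_solution y f x \<Longrightarrow> (x has_real_derivative y t - f (x t)) (at t)"
  by (simp add: entire_solution_def)

lemma entire_solution_continuous: "entire_solution y f x \<Longrightarrow> continuous_on A x"
  by (auto intro!: continuous_at_imp_continuous_on DERIV_isCont entire_solutionD)

text \<open>The global Lipschitz bound makes every initial value problem uniquely solvable on the
  whole line, so the time-\<open>T\<close> map is defined everywhere.\<close>

locale lipschitz_equation =
  fixes y f :: "real \<Rightarrow> real" and L :: real
  assumes L: "L > 0" and lip: "\<And>u v. \<bar>f u - f v\<bar> \<le> L * \<bar>u - v\<bar>"
    and y_cont: "continuous_on UNIV y" and y_bdd: "bounded (range y)"
begin

lemma f_cont: "continuous_on UNIV f"
proof -
  have "L-lipschitz_on UNIV f" using L lip by (auto intro!: lipschitz_onI simp: dist_real_def)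
  then show ?thesis by (rule lipschitz_on_continuous_on)
qed

text \<open>A smooth substitute for \<open>exp (2 * L * \<bar>t\<bar>)\<close> with an explicit
  antiderivative, so that one formula serves both time directions.\<close>

definition weight :: "real \<Rightarrow> real" where "weight t = exp (2 * L * t) + exp (- 2 * L * t)"

lemma weight_ge: "weight t \<ge> 1 + 2 * L * \<bar>t\<bar>"
  using exp_ge_add_one_self[of "2 * L * t"] exp_ge_add_one_self[of "- 2 * L * t"]
    exp_gt_zero[of "2 * L * t"] exp_gt_zero[of "- 2 * L * t"]
  unfolding weight_def by (smt (verit) mult_minus_right mult_minus_left)

lemma weight_pos: "weight t > 0" unfolding weight_def by (simp add: add_pos_pos)

text \<open>Integrating \<open>L * d * weight\<close> gives
  \<open>d / 2 * (exp (2 * L * t) - exp (- 2 * L * t))\<close>, which the weight dominates with the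
  factor \<open>d / 2\<close>. This 1/2 is the contraction constant of the Picard iteration.\<close>

lemma weighted_bound:
  fixes D D' :: "real \<Rightarrow> real"
  assumes D0: "D 0 = 0" and der: "\<And>t. (D has_real_derivative D' t) (at t)"
    and bd: "\<And>t. \<bar>D' t\<bar> \<le> L * d * weight t" and d: "d \<ge> 0"
  shows "\<bar>D t\<bar> \<le> d / 2 * weight t"
proof -
  define S where "S t = d / 2 * (exp (2 * L * t) - exp (- 2 * L * t))" for t
  have S: "(S has_real_derivative L * d * weight t) (at t)" for t
    unfolding S_def weight_def by (auto intro!: derivative_eq_intros simp: algebra_simps)
  have mono: "G s \<le> G t" if "s \<le> t" and G: "\<And>t. (G has_real_derivative G' t) (at t)"
    and "\<And>t. G' t \<ge> 0" for G G' :: "real \<Rightarrow> real" and s t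
    using DERIV_nonneg_imp_nondecreasing[of s t G] that by blast
  have bd': "L * d * weight t - D' t \<ge> 0" "L * d * weight t + D' t \<ge> 0" for t
    using bd[of t] by linarith+
  have m1: "S s - D s \<le> S t - D t" if "s \<le> t" for s t
    by (rule mono[where G = "\<lambda>t. S t - D t" and G' = "\<lambda>t. L * d * weight t - D' t"])
       (use that bd' in \<open>auto intro!: derivative_eq_intros S der\<close>)
  have m2: "S s + D s \<le> S t + D t" if "s \<le> t" for s t
    by (rule mono[where G = "\<lambda>t. S t + D t" and G' = "\<lambda>t. L * d * weight t + D' t"])
       (use that bd' in \<open>auto intro!: derivative_eq_intros S der\<close>)
  have S0: "S 0 = 0" by (simp add: S_def)
  have "\<bar>D t\<bar> \<le> \<bar>S t\<bar>"
    using m1[of 0 t] m2[of 0 t] m1[of t 0] m2[of t 0] D0 S0 by (cases "t \<ge> 0") auto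
  also have "\<dots> \<le> d / 2 * weight t"
  proof -
    have "\<bar>S t\<bar> = d / 2 * \<bar>exp (2 * L * t) - exp (- 2 * L * t)\<bar>"
      using d by (simp add: S_def abs_mult)
    also have "\<dots> \<le> d / 2 * weight t"
      using d by (intro mult_left_mono) (auto simp: weight_def abs_if)
    finally show ?thesis .
  qed
  finally show ?thesis .
qed

text \<open>Picard iteration, written for \<open>x / weight\<close> with the integral taken from time 0; the
  exponential weight makes it a contraction on the whole line.\<close>

lemma exists_solution_0: "\<exists>x. entire_solution y f x \<and> x 0 = v"
proof -
  define F where "F w \<tau> = y \<tau> - f (weight \<tau> * apply_bcontfun w \<tau>)" for w :: "real \<Rightarrow>\<^sub>C real" and \<tau>
  have weight_cont: "continuous_on A weight" for A
    unfolding weight_def by (intro continuous_intros)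
  have F_cont: "continuous_on UNIV (F w)" for w
    unfolding F_def
    by (intro continuous_intros continuous_on_compose2[OF f_cont] weight_cont y_cont) auto
  have "\<exists>H. (\<forall>t. (H has_real_derivative F w t) (at t)) \<and> H 0 = 0" for w
    using continuous_antiderivative[OF F_cont[of w]] by metis
  then obtain H where H: "\<And>w t. (H w has_real_derivative F w t) (at t)" and H0: "\<And>w. H w 0 = 0"
    by metis
  obtain C where C: "\<And>t. \<bar>y t\<bar> \<le> C" using y_bdd by (auto simp: bounded_iff)
  have C0: "C \<ge> 0" using C[of 0] by linarith
  define Tw where "Tw w t = (v + H w t) / weight t" for w t
  \<comment> \<open>Linear growth of \<open>f\<close> keeps the image of a bounded \<open>w\<close>
    bounded after division by the weight, so the iteration stays in the space of bounded continuous
    functions.\<close>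
  have H_bound: "\<bar>H w t\<bar> \<le> ((C + \<bar>f 0\<bar>) / L + norm w) / 2 * weight t" for w t
  proof (rule weighted_bound[OF H0 H])
    fix t
    have "\<bar>f (weight t * apply_bcontfun w t)\<bar> \<le> \<bar>f 0\<bar> + L * \<bar>weight t * apply_bcontfun w t\<bar>"
      using lip[of "weight t * apply_bcontfun w t" 0] by (simp; linarith)
    also have "\<bar>weight t * apply_bcontfun w t\<bar> \<le> weight t * norm w"
      using weight_pos[of t] norm_bounded[of w t] by (simp add: abs_mult)
    finally have "\<bar>F w t\<bar> \<le> C + \<bar>f 0\<bar> + L * (weight t * norm w)"
      using C[of t] L unfolding F_def by (simp; linarith)
    also have "C + \<bar>f 0\<bar> \<le> (C + \<bar>f 0\<bar>) * weight t"
      using C0 weight_ge[of t] L by (simp add: mult_le_cancel_left1) (smt (verit) mult_nonneg_nonneg)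
    also have "(C + \<bar>f 0\<bar>) * weight t + L * (weight t * norm w)
        = (L * ((C + \<bar>f 0\<bar>) / L) + L * norm w) * weight t"
    proof -
      have "L * ((C + \<bar>f 0\<bar>) / L) = C + \<bar>f 0\<bar>" using L by simp
      then show ?thesis by (simp only:) (simp add: algebra_simps)
    qed
    finally show "\<bar>F w t\<bar> \<le> L * ((C + \<bar>f 0\<bar>) / L + norm w) * weight t"
      by (simp add: distrib_left)
  qed (use C0 L in simp)
  have Tw_mem: "Tw w \<in> bcontfun" for w
  proof (rule bcontfun_normI)
    have "continuous_on UNIV (H w)" by (auto intro!: continuous_at_imp_continuous_on DERIV_isCont H)
    then show "continuous_on UNIV (Tw w)" unfolding Tw_def
      using weight_pos by (intro continuous_intros weight_cont) (auto simp: less_le)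
    fix t
    have "\<bar>v + H w t\<bar> \<le> \<bar>v\<bar> * weight t + ((C + \<bar>f 0\<bar>) / L + norm w) / 2 * weight t"
    proof -
      have "\<bar>v\<bar> * 1 \<le> \<bar>v\<bar> * weight t"
        using weight_ge[of t] L by (intro mult_left_mono) (auto, smt (verit) mult_nonneg_nonneg)
      then show ?thesis using H_bound[of w t] by linarith
    qed
    then show "norm (Tw w t) \<le> \<bar>v\<bar> + ((C + \<bar>f 0\<bar>) / L + norm w) / 2"
      using weight_pos[of t] by (simp add: Tw_def abs_divide pos_divide_le_eq algebra_simps)
  qed
  have contraction: "dist (Bcontfun (Tw w)) (Bcontfun (Tw z)) \<le> 1 / 2 * dist w z" for w z
  proof (rule dist_bound)
    fix t
    have "\<bar>H w t - H z t\<bar> \<le> dist w z / 2 * weight t"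
    proof (rule weighted_bound[where D = "\<lambda>t. H w t - H z t" and D' = "\<lambda>t. F w t - F z t"])
      fix t
      have "\<bar>F w t - F z t\<bar> \<le> L * \<bar>weight t * apply_bcontfun w t - weight t * apply_bcontfun z t\<bar>"
        unfolding F_def using lip[of "weight t * apply_bcontfun z t" "weight t * apply_bcontfun w t"]
        by (simp add: abs_minus_commute)
      also have "\<dots> = L * (weight t * \<bar>apply_bcontfun w t - apply_bcontfun z t\<bar>)"
        using weight_pos[of t] by (simp add: abs_mult flip: right_diff_distrib)
      also have "\<dots> \<le> L * (weight t * dist w z)"
        using L weight_pos[of t] dist_bounded[of w t z]
        by (intro mult_left_mono) (auto simp: dist_real_def)
      finally show "\<bar>F w t - F z t\<bar> \<le> L * dist w z * weight t" by (simp add: algebra_simps)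
    qed (use H H0 in \<open>auto intro!: derivative_eq_intros\<close>)
    moreover have "Tw w t - Tw z t = (H w t - H z t) / weight t"
      by (simp add: Tw_def diff_divide_distrib add_divide_distrib)
    ultimately show "dist (apply_bcontfun (Bcontfun (Tw w)) t) (apply_bcontfun (Bcontfun (Tw z)) t)
        \<le> 1 / 2 * dist w z"
      using weight_pos[of t] Tw_mem
      by (simp add: Bcontfun_inverse dist_real_def abs_divide pos_divide_le_eq)
  qed
  have "\<exists>!w. Bcontfun (Tw w) = w"
    by (rule banach_fix_type[where c = "1 / 2"]) (use contraction in auto)
  then obtain w where "Bcontfun (Tw w) = w" by blast
  then have w: "apply_bcontfun w t = Tw w t" for t
    by (metis Bcontfun_inverse Tw_mem)
  have "weight t * apply_bcontfun w t = v + H w t" for t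
    unfolding w Tw_def using weight_pos[of t] by simp
  then have "entire_solution y f (\<lambda>t. v + H w t)"
    unfolding entire_solution_def using H[of w] by (auto intro!: derivative_eq_intros simp: F_def)
  then show ?thesis using H0[of w] by force
qed

lemma exists_solution: "\<exists>x. entire_solution y f x \<and> x s = v"
proof -
  interpret shift: lipschitz_equation "\<lambda>t. y (t + s)" f L
  proof
    show "continuous_on UNIV (\<lambda>t. y (t + s))"
      by (rule continuous_on_compose2[OF y_cont]) (auto intro!: continuous_intros)
    show "bounded (range (\<lambda>t. y (t + s)))" by (rule bounded_subset[OF y_bdd]) auto
  qed (use L lip in auto)
  obtain x where x: "entire_solution (\<lambda>t. y (t + s)) f x" "x 0 = v"
    using shift.exists_solution_0 by blast
  have "entire_solution y f (\<lambda>t. x (t - s))"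
    unfolding entire_solution_def
  proof
    fix t
    show "((\<lambda>t. x (t - s)) has_real_derivative y t - f (x (t - s))) (at t)"
      using entire_solutionD[OF x(1), of "t - s"] DERIV_shift[of x _ t "- s"] by simp
  qed
  with x show ?thesis by (intro exI[of _ "\<lambda>t. x (t - s)"]) auto
qed

lemma solution_le:
  assumes "a \<le> b" "x a \<le> z a"
    and "\<And>t. a \<le> t \<Longrightarrow> t \<le> b \<Longrightarrow> (x has_real_derivative y t - f (x t)) (at t)"
    and "\<And>t. a \<le> t \<Longrightarrow> t \<le> b \<Longrightarrow> (z has_real_derivative y t - f (z t)) (at t)"
  shows "x b \<le> z b"
proof (rule comparison[where a = a and x' = "\<lambda>t. y t - f (x t)" and u' = "\<lambda>t. y t - f (z t)" and L = L
      and x = x and u = z and b = b])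
  fix t assume "z t < x t"
  then show "y t - f (x t) - (y t - f (z t)) \<le> L * (x t - z t)"
    using lip[of "x t" "z t"] by simp
qed (use assms in auto)

text \<open>The squared difference is differentiable even where the solutions meet, and its
  derivative is at most \<open>2 * L\<close> times itself in absolute value. The factors
  \<open>exp (2 * L * u)\<close> and \<open>exp (- 2 * L * u)\<close> turn this into two monotone
  functions, one for each time direction; backward estimates are used as often as forward
  ones.\<close>

lemma solution_square_dist:
  assumes x: "entire_solution y f x" and z: "entire_solution y f z"
  shows "(x t - z t)\<^sup>2 \<le> exp (2 * L * \<bar>t - s\<bar>) * (x s - z s)\<^sup>2"
proof -
  define D' where "D' u = 2 * (x u - z u) * (f (z u) - f (x u))" for u
  have D: "((\<lambda>u. (x u - z u)\<^sup>2) has_real_derivative D' u) (at u)" for u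
    unfolding D'_def
    by (rule derivative_eq_intros entire_solutionD x z refl | simp add: algebra_simps)+
  have D'_bound: "\<bar>D' u\<bar> \<le> 2 * L * (x u - z u)\<^sup>2" for u
  proof -
    have "\<bar>D' u\<bar> = 2 * \<bar>x u - z u\<bar> * \<bar>f (z u) - f (x u)\<bar>"
      unfolding D'_def abs_mult abs_numeral ..
    also have "\<dots> \<le> 2 * \<bar>x u - z u\<bar> * (L * \<bar>z u - x u\<bar>)"
      by (rule mult_left_mono[OF lip]) simp
    also have "\<dots> = 2 * L * (\<bar>x u - z u\<bar> * \<bar>x u - z u\<bar>)" by (simp add: abs_minus_commute)
    finally show ?thesis by (simp add: power2_eq_square)
  qed
  have up: "(x u - z u)\<^sup>2 * exp (2 * L * u) \<le> (x v - z v)\<^sup>2 * exp (2 * L * v)" if "u \<le> v" for u v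
  proof (rule DERIV_nonneg_imp_nondecreasing[OF that])
    fix w
    have "((\<lambda>u. (x u - z u)\<^sup>2 * exp (2 * L * u)) has_real_derivative
       (D' w + 2 * L * (x w - z w)\<^sup>2) * exp (2 * L * w)) (at w)"
      by (rule derivative_eq_intros D refl | simp add: algebra_simps)+
    moreover have "(D' w + 2 * L * (x w - z w)\<^sup>2) * exp (2 * L * w) \<ge> 0"
      using D'_bound[of w] by simp
    ultimately show "\<exists>d. ((\<lambda>u. (x u - z u)\<^sup>2 * exp (2 * L * u)) has_real_derivative d) (at w) \<and> 0 \<le> d"
      by blast
  qed
  have down: "(x v - z v)\<^sup>2 * exp (- 2 * L * v) \<le> (x u - z u)\<^sup>2 * exp (- 2 * L * u)" if "u \<le> v" for u v
  proof (rule DERIV_nonpos_imp_nonincreasing[OF that])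
    fix w
    have "((\<lambda>u. (x u - z u)\<^sup>2 * exp (- 2 * L * u)) has_real_derivative
       (D' w - 2 * L * (x w - z w)\<^sup>2) * exp (- 2 * L * w)) (at w)"
      by (rule derivative_eq_intros D refl | simp add: algebra_simps)+
    moreover have "(D' w - 2 * L * (x w - z w)\<^sup>2) * exp (- 2 * L * w) \<le> 0"
      using D'_bound[of w] by (simp add: mult_le_0_iff)
    ultimately show "\<exists>d. ((\<lambda>u. (x u - z u)\<^sup>2 * exp (- 2 * L * u)) has_real_derivative d) (at w) \<and> d \<le> 0"
      by blast
  qed
  show ?thesis
  proof (cases "s \<le> t")
    case True
    then have "(x t - z t)\<^sup>2 \<le> (x s - z s)\<^sup>2 * exp (- 2 * L * s) / exp (- 2 * L * t)"
      using down[of s t] by (simp add: pos_le_divide_eq)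
    also have "\<dots> = exp (2 * L * \<bar>t - s\<bar>) * (x s - z s)\<^sup>2"
      using True exp_diff[of "- 2 * L * s" "- 2 * L * t"] by (simp add: algebra_simps)
    finally show ?thesis .
  next
    case False
    then have "(x t - z t)\<^sup>2 \<le> (x s - z s)\<^sup>2 * exp (2 * L * s) / exp (2 * L * t)"
      using up[of t s] by (simp add: pos_le_divide_eq)
    also have "\<dots> = exp (2 * L * \<bar>t - s\<bar>) * (x s - z s)\<^sup>2"
      using False exp_diff[of "2 * L * s" "2 * L * t"] by (simp add: algebra_simps)
    finally show ?thesis .
  qed
qed

lemma solution_dist:
  assumes x: "entire_solution y f x" and z: "entire_solution y f z"
  shows "\<bar>x t - z t\<bar> \<le> exp (L * \<bar>t - s\<bar>) * \<bar>x s - z s\<bar>"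
proof -
  have "exp (2 * L * \<bar>t - s\<bar>) = (exp (L * \<bar>t - s\<bar>))\<^sup>2" by (simp add: algebra_simps flip: exp_double)
  then have "\<bar>x t - z t\<bar>\<^sup>2 \<le> (exp (L * \<bar>t - s\<bar>) * \<bar>x s - z s\<bar>)\<^sup>2"
    using solution_square_dist[OF x z, of t s] by (simp add: power_mult_distrib)
  then show ?thesis by (rule power2_le_imp_le) simp
qed

lemma solution_unique:
  assumes "entire_solution y f x" "entire_solution y f z" "x s = z s"
  shows "x = z"
  using solution_dist[OF assms(1,2), of _ s] assms(3) by force

text \<open>A loss of order would produce a common value by the intermediate value theorem, and then
  uniqueness makes the solutions equal. The time \<open>t\<close> may also precede
  \<open>s\<close>.\<close>

lemma solution_less:
  assumes x: "entire_solution y f x" and z: "entire_solution y f z" and less: "x s < z s"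
  shows "x t < z t"
proof (rule ccontr)
  assume "\<not> x t < z t"
  then have "\<exists>u. x u - z u = 0"
    using less IVT'[of "\<lambda>u. x u - z u" s 0 t] IVT2'[of "\<lambda>u. x u - z u" s 0 t]
      entire_solution_continuous[OF x] entire_solution_continuous[OF z]
    by (cases "s \<le> t") (auto intro!: continuous_intros)
  then obtain u where "x u = z u" by auto
  from solution_unique[OF x z this] less show False by simp
qed

lemma solution_order:
  assumes "entire_solution y f x" "entire_solution y f z" "x s \<le> z s"
  shows "x t \<le> z t"
  using solution_less[OF assms(2,1), of t s] assms(3) by linarith

lemma entire_solution_shift:
  assumes x: "entire_solution y f x" and per: "\<And>t. y (t + T) = y t"
  shows "entire_solution y f (\<lambda>t. x (t + T))"
  unfolding entire_solution_def
  using entire_solutionD[OF x] per DERIV_shift[of x _ _ T] by metis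

text \<open>The time-\<open>T\<close> map is continuous, so a sign change of its displacement gives a fixed point.\<close>

lemma exists_periodic:
  assumes per: "\<And>t. y (t + T) = y t" and v: "v1 \<le> v2"
    and sign: "(\<forall>x. entire_solution y f x \<and> x s = v1 \<longrightarrow> x (s + T) \<ge> v1) \<and>
                (\<forall>x. entire_solution y f x \<and> x s = v2 \<longrightarrow> x (s + T) \<le> v2) \<or>
               (\<forall>x. entire_solution y f x \<and> x s = v1 \<longrightarrow> x (s + T) \<le> v1) \<and>
                (\<forall>x. entire_solution y f x \<and> x s = v2 \<longrightarrow> x (s + T) \<ge> v2)"
  obtains x where "entire_solution y f x" "\<And>t. x (t + T) = x t" "v1 \<le> x s" "x s \<le> v2"
proof -
  obtain X where X: "\<And>v. entire_solution y f (X v)" "\<And>v. X v s = v"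
    using exists_solution by metis
  have "(exp (L * \<bar>T\<bar>))-lipschitz_on UNIV (\<lambda>v. X v (s + T))"
    using solution_dist[OF X(1) X(1), where s = s and t = "s + T"] X(2)
    by (auto intro!: lipschitz_onI simp: dist_real_def)
  then have cont: "continuous_on {v1..v2} (\<lambda>v. X v (s + T) - v)"
    by (intro continuous_intros continuous_on_subset[OF lipschitz_on_continuous_on]) auto
  \<comment> \<open>The inward alternative of \<open>sign\<close> serves the attracting orbits, the
    outward one the repelling middle orbit.\<close>
  have "\<exists>v\<ge>v1. v \<le> v2 \<and> X v (s + T) - v = 0"
    using sign
  proof
    assume "(\<forall>x. entire_solution y f x \<and> x s = v1 \<longrightarrow> x (s + T) \<ge> v1) \<and>
                (\<forall>x. entire_solution y f x \<and> x s = v2 \<longrightarrow> x (s + T) \<le> v2)"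
    then have "X v1 (s + T) - v1 \<ge> 0" "X v2 (s + T) - v2 \<le> 0" using X by auto
    then show ?thesis using IVT2'[of "\<lambda>v. X v (s + T) - v" v2 0 v1] v cont by auto
  next
    assume "(\<forall>x. entire_solution y f x \<and> x s = v1 \<longrightarrow> x (s + T) \<le> v1) \<and>
                (\<forall>x. entire_solution y f x \<and> x s = v2 \<longrightarrow> x (s + T) \<ge> v2)"
    then have "X v1 (s + T) - v1 \<le> 0" "X v2 (s + T) - v2 \<ge> 0" using X by auto
    then show ?thesis using IVT'[of "\<lambda>v. X v (s + T) - v" v1 0 v2] v cont by auto
  qed
  then obtain v where "v1 \<le> v" "v \<le> v2" and fixed: "X v (s + T) = v" by auto
  have "(\<lambda>t. X v (t + T)) = X v"
    by (rule solution_unique[OF entire_solution_shift[OF X(1) per] X(1), where s = s])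
       (simp add: X(2) fixed)
  then have "X v (t + T) = X v t" for t by metis
  with that[of "X v"] X \<open>v1 \<le> v\<close> \<open>v \<le> v2\<close> show ?thesis by metis
qed

end

text \<open>From \<open>1 - cos \<theta> = 2 * (sin (\<theta> / 2))\<^sup>2\<close> and
  \<open>sin v \<ge> v / 2\<close> on the first quadrant. Up to pi/3 the latter holds because the
  cosine is at least 1/2; beyond, the sine exceeds 0.85 while \<open>v / 2\<close> is at most
  0.8.\<close>

lemma one_minus_cos_ge:
  assumes "\<bar>\<theta>\<bar> \<le> pi"
  shows "1 - cos \<theta> \<ge> \<theta>\<^sup>2 / 8"
proof -
  have half: "sin v \<ge> v / 2" if v: "0 \<le> v" "v \<le> pi / 2" for v
  proof (cases "v \<le> pi / 3")
    case True
    have "sin 0 - 0 / 2 \<le> sin v - v / 2"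
    proof (rule DERIV_nonneg_imp_nondecreasing[OF v(1)])
      fix w assume w: "0 \<le> w" "w \<le> v"
      have "cos (pi / 3) \<le> cos w" using w True by (intro cos_monotone_0_pi_le) auto
      then have "cos w - 1 / 2 \<ge> 0" by (simp add: cos_60)
      moreover have "((\<lambda>v. sin v - v / 2) has_real_derivative cos w - 1 / 2) (at w)"
        by (auto intro!: derivative_eq_intros)
      ultimately show "\<exists>d. ((\<lambda>v. sin v - v / 2) has_real_derivative d) (at w) \<and> 0 \<le> d" by blast
    qed
    then show ?thesis by simp
  next
    case False
    have "sqrt 3 / 2 \<le> sin v"
      using False v sin_monotone_2pi_le[of "pi / 3" v] by (simp add: sin_60)
    moreover have "sqrt 3 \<ge> 1.7" by (rule real_le_rsqrt) (simp add: power2_eq_square)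
    moreover have "v / 2 \<le> 0.8" using v pi_less_4 pi_approx by simp
    ultimately show ?thesis by simp
  qed
  have "1 - cos \<theta> = 2 * (sin \<bar>\<theta> / 2\<bar>)\<^sup>2"
    using cos_double_sin[of "\<theta> / 2"] by (simp add: abs_if)
  moreover have "(\<bar>\<theta> / 2\<bar> / 2)\<^sup>2 \<le> (sin \<bar>\<theta> / 2\<bar>)\<^sup>2"
    using assms half[of "\<bar>\<theta> / 2\<bar>"] by (intro power_mono) auto
  ultimately show ?thesis by (simp add: power2_eq_square)
qed

lemma one_minus_cos_le: "1 - cos \<theta> \<le> \<theta>\<^sup>2 / 2" for \<theta> :: real
proof -
  have "(sin (\<theta> / 2))\<^sup>2 \<le> (\<theta> / 2)\<^sup>2"
    using abs_sin_x_le_abs_x[of "\<theta> / 2"] unfolding abs_le_square_iff .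
  then show ?thesis using cos_double_sin[of "\<theta> / 2"] by (simp add: power2_eq_square)
qed

section \<open>S-shaped fields\<close>

text \<open>The folds are \<open>p\<close> (local maximum) and \<open>q\<close> (local minimum) and \<open>qh\<close>, \<open>ph\<close> are the landing
  points on the opposite outer branches. The assumptions are invariant under \<open>x \<mapsto> - x\<close>,
  so statements about the fold \<open>q\<close> follow from those about \<open>p\<close>.\<close>

locale S_shape =
  fixes f f' :: "real \<Rightarrow> real" and p q ph qh L K :: real
  assumes f_der: "\<And>x. (f has_real_derivative f' x) (at x)"
    and f'_lip: "\<And>u v. \<bar>f' u - f' v\<bar> \<le> K * \<bar>u - v\<bar>" and K: "K > 0"
    and f'_bound: "\<And>u. \<bar>f' u\<bar> \<le> L" and L: "L > 0"
    and p_less_q: "p < q"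
    and left_branch: "\<And>d. d > 0 \<Longrightarrow> \<exists>c0>0. \<forall>x\<le>p - d. f' x \<ge> c0"
    and right_branch: "\<And>d. d > 0 \<Longrightarrow> \<exists>c0>0. \<forall>x\<ge>q + d. f' x \<ge> c0"
    and middle_branch: "\<And>x. p < x \<Longrightarrow> x < q \<Longrightarrow> f' x < 0"
    and qh: "q < qh" "f qh = f p" and ph: "ph < p" "f ph = f q"
    and fold_p: "\<And>a d. d > 0 \<Longrightarrow> \<exists>\<kappa>>0. \<forall>x. a \<le> x \<and> x \<le> qh - d \<longrightarrow> f p - f x \<ge> \<kappa> * (x - p)\<^sup>2"
    and fold_q: "\<And>a d. d > 0 \<Longrightarrow> \<exists>\<kappa>>0. \<forall>x. ph + d \<le> x \<and> x \<le> a \<longrightarrow> f x - f q \<ge> \<kappa> * (x - q)\<^sup>2"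
begin

lemma mirror: "S_shape (\<lambda>x. - f (- x)) (\<lambda>x. f' (- x)) (- q) (- p) (- qh) (- ph) L K"
proof
  show "((\<lambda>x. - f (- x)) has_real_derivative f' (- x)) (at x)" for x
  proof -
    have "((\<lambda>x. f (- x)) has_real_derivative f' (- x) * (- 1)) (at x)"
      by (rule DERIV_chain2[OF f_der]) (auto intro!: derivative_eq_intros)
    then show ?thesis by (auto dest: DERIV_minus)
  qed
  show "\<bar>f' (- u) - f' (- v)\<bar> \<le> K * \<bar>u - v\<bar>" for u v
    using f'_lip[of "- u" "- v"] by (simp add: abs_minus_commute)
  show "\<exists>c0>0. \<forall>x\<le>- q - d. c0 \<le> f' (- x)" if d: "d > 0" for d
  proof -
    obtain c0 where "c0 > 0" "\<forall>x\<ge>q + d. f' x \<ge> c0" using right_branch[OF d] by blast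
    then show ?thesis by (intro exI[of _ c0]) auto
  qed
  show "\<exists>c0>0. \<forall>x\<ge>- p + d. c0 \<le> f' (- x)" if d: "d > 0" for d
  proof -
    obtain c0 where "c0 > 0" "\<forall>x\<le>p - d. f' x \<ge> c0" using left_branch[OF d] by blast
    then show ?thesis by (intro exI[of _ c0]) auto
  qed
  show "\<exists>\<kappa>>0. \<forall>x. a \<le> x \<and> x \<le> - ph - d \<longrightarrow> \<kappa> * (x - (- q))\<^sup>2 \<le> - f (- (- q)) - (- f (- x))" if d: "d > 0" for a d
  proof -
    obtain \<kappa> where \<kappa>: "\<kappa> > 0" "\<And>x. ph + d \<le> x \<Longrightarrow> x \<le> - a \<Longrightarrow> f x - f q \<ge> \<kappa> * (x - q)\<^sup>2"
      using fold_q[OF d, of "- a"] by blast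
    have "\<kappa> * (x - (- q))\<^sup>2 \<le> - f (- (- q)) - (- f (- x))" if "a \<le> x" "x \<le> - ph - d" for x
      using \<kappa>(2)[of "- x"] that by (simp add: power2_eq_square algebra_simps)
    with \<kappa>(1) show ?thesis by blast
  qed
  show "\<exists>\<kappa>>0. \<forall>x. - qh + d \<le> x \<and> x \<le> a \<longrightarrow> \<kappa> * (x - (- p))\<^sup>2 \<le> - f (- x) - (- f (- (- p)))" if d: "d > 0" for a d
  proof -
    obtain \<kappa> where \<kappa>: "\<kappa> > 0" "\<And>x. - a \<le> x \<Longrightarrow> x \<le> qh - d \<Longrightarrow> f p - f x \<ge> \<kappa> * (x - p)\<^sup>2"
      using fold_p[OF d, of "- a"] by blast
    have "\<kappa> * (x - (- p))\<^sup>2 \<le> - f (- x) - (- f (- (- p)))" if "- qh + d \<le> x" "x \<le> a" for x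
      using \<kappa>(2)[of "- x"] that by (simp add: power2_eq_square algebra_simps)
    with \<kappa>(1) show ?thesis by blast
  qed
  show "f' (- x) < 0" if "- q < x" "x < - p" for x using middle_branch[of "- x"] that by simp
qed (use K L f'_bound p_less_q qh ph in simp_all)

lemma f_lip: "\<bar>f u - f v\<bar> \<le> L * \<bar>u - v\<bar>"
proof -
  have "norm (f u - f v) \<le> L * norm (u - v)"
    by (rule field_differentiable_bound[where S = UNIV and f' = f'])
       (use f_der f'_bound in \<open>auto intro: has_field_derivative_at_within\<close>)
  then show ?thesis by simp
qed

lemma f_cont: "continuous_on A f"
  by (auto intro!: continuous_at_imp_continuous_on DERIV_isCont f_der)

lemma f'_cont: "continuous_on A f'"
proof -
  have "K-lipschitz_on A f'" using K f'_lip by (auto intro!: lipschitz_onI simp: dist_real_def)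
  then show ?thesis by (rule lipschitz_on_continuous_on)
qed

lemma f'_pos_left: "x < p \<Longrightarrow> f' x > 0"
  using left_branch[of "p - x"] by force

text \<open>\<open>f'\<close> is positive to the left of \<open>p\<close> and negative to the right;
  being \<open>K\<close>-Lipschitz, a nonzero value at \<open>p\<close> would keep its sign too far
  on the wrong side.\<close>

lemma f'_p: "f' p = 0"
proof (rule antisym)
  have le: "f' p \<le> K * d" if "d > 0" "d < q - p" for d
    using f'_lip[of p "p + d"] middle_branch[of "p + d"] that by simp
  show "f' p \<le> 0"
  proof (rule ccontr)
    assume "\<not> f' p \<le> 0"
    then have pos: "f' p > 0" by simp
    define d where "d = min (f' p / (2 * K)) ((q - p) / 2)"
    have d: "d > 0" "d < q - p" "d \<le> f' p / (2 * K)" using pos K p_less_q by (auto simp: d_def min_less_iff_disj)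
    then have "K * d \<le> f' p / 2" using K by (simp add: field_simps)
    with le[OF d(1,2)] pos show False by simp
  qed
  show "0 \<le> f' p"
  proof (rule ccontr)
    assume neg: "\<not> 0 \<le> f' p"
    define d where "d = - f' p / (2 * K)"
    have d: "d > 0" using neg K by (simp add: d_def divide_neg_pos)
    have "K * d = - f' p / 2" using K by (simp add: d_def)
    then show False using f'_lip[of "p - d" p] f'_pos_left[of "p - d"] d neg by simp
  qed
qed

lemma f'_nonneg_left: "x \<le> p \<Longrightarrow> f' x \<ge> 0"
  using f'_pos_left[of x] f'_p by (cases "x = p") auto

lemma f'_nonneg_right: "x \<ge> q \<Longrightarrow> f' x \<ge> 0"
proof -
  interpret mir: S_shape "\<lambda>x. - f (- x)" "\<lambda>x. f' (- x)" "- q" "- p" "- qh" "- ph" L K by (rule mirror)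
  show "x \<ge> q \<Longrightarrow> f' x \<ge> 0" using mir.f'_nonneg_left[of "- x"] by simp
qed

lemma f_strict_left: assumes "u < v" "v \<le> p" shows "f u < f v"
proof (rule DERIV_pos_imp_increasing_open[OF assms(1) _ f_cont])
  show "\<exists>d. (f has_real_derivative d) (at x) \<and> 0 < d" if "u < x" "x < v" for x
    using f_der[of x] f'_pos_left[of x] that assms by (intro exI[of _ "f' x"]) simp
qed

lemma f_strict_right: assumes "u < v" "q \<le> u" shows "f u < f v"
proof -
  interpret mir: S_shape "\<lambda>x. - f (- x)" "\<lambda>x. f' (- x)" "- q" "- p" "- qh" "- ph" L K by (rule mirror)
  show ?thesis using mir.f_strict_left[of "- v" "- u"] assms by simp
qed

lemma f_mono_left: "u \<le> v \<Longrightarrow> v \<le> p \<Longrightarrow> f u \<le> f v"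
  using f_strict_left[of u v] by (cases "u = v") auto

lemma f_mono_right: "q \<le> u \<Longrightarrow> u \<le> v \<Longrightarrow> f u \<le> f v"
  using f_strict_right[of u v] by (cases "u = v") auto

lemma f_strict_middle: assumes "u < v" "p \<le> u" "v \<le> q" shows "f v < f u"
proof (rule DERIV_neg_imp_decreasing_open[OF assms(1) _ f_cont])
  show "\<exists>d. (f has_real_derivative d) (at x) \<and> d < 0" if "u < x" "x < v" for x
    using f_der[of x] middle_branch[of x] that assms by (intro exI[of _ "f' x"]) simp
qed

lemma fq_less_fp: "f q < f p"
  using f_strict_middle[of p q] p_less_q by simp

text \<open>The mean value theorem with \<open>f' p = 0\<close> and the Lipschitz bound for
  \<open>f'\<close>. It controls the loss when the barrier \<open>p\<close> is perturbed: a
  displacement of size \<open>\<delta>\<close> costs at most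
  \<open>K * \<delta>\<^sup>2\<close>.\<close>

lemma f_ge_parabola: "f x \<ge> f p - K * (x - p)\<^sup>2"
proof -
  have "f p - f x \<le> K * (x - p)\<^sup>2"
  proof (cases "x = p")
    case False
    obtain \<xi> where \<xi>: "\<bar>\<xi> - p\<bar> \<le> \<bar>x - p\<bar>" "f x - f p = (x - p) * f' \<xi>"
    proof (cases "x < p")
      case True
      then obtain \<xi> where "x < \<xi>" "\<xi> < p" "f p - f x = (p - x) * f' \<xi>"
        using MVT2[of x p f f'] f_der by auto
      then show ?thesis using that[of \<xi>] by (auto simp: algebra_simps)
    next
      case F: False
      with False obtain \<xi> where "p < \<xi>" "\<xi> < x" "f x - f p = (x - p) * f' \<xi>"
        using MVT2[of p x f f'] f_der by auto
      then show ?thesis using that[of \<xi>] by auto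
    qed
    have "\<bar>f' \<xi>\<bar> \<le> K * \<bar>x - p\<bar>"
      using f'_lip[of \<xi> p] f'_p \<xi>(1) K by (smt (verit) mult_left_mono)
    then have "\<bar>f x - f p\<bar> \<le> \<bar>x - p\<bar> * (K * \<bar>x - p\<bar>)"
      unfolding \<xi>(2) abs_mult by (rule mult_left_mono) simp
    then have "\<bar>f x - f p\<bar> \<le> K * (\<bar>x - p\<bar> * \<bar>x - p\<bar>)" by (simp only: mult.left_commute)
    then have "\<bar>f x - f p\<bar> \<le> K * (x - p)\<^sup>2" by (simp add: power2_eq_square)
    then show ?thesis by simp
  qed auto
  then show ?thesis by simp
qed

text \<open>The barrier lets lower solutions overshoot the fold by \<open>\<delta>\<close>; this
  bounds the rate at which differences can grow there.\<close>

lemma f'_ge_near_fold: "x \<le> p + \<delta> \<Longrightarrow> 0 \<le> \<delta> \<Longrightarrow> f' x \<ge> - K * \<delta>"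
proof (cases "x \<le> p")
  case True
  then show "0 \<le> \<delta> \<Longrightarrow> f' x \<ge> - K * \<delta>" using f'_nonneg_left[of x] K by (smt (verit) mult_minus_left mult_nonneg_nonneg)
next
  case False
  assume "x \<le> p + \<delta>"
  with False have "K * \<bar>x - p\<bar> \<le> K * \<delta>" using K by (intro mult_left_mono) auto
  then show ?thesis using f'_lip[of x p] f'_p by simp
qed

lemma f'_le_left_of_q: "p - \<delta> \<le> x \<Longrightarrow> x < q \<Longrightarrow> 0 \<le> \<delta> \<Longrightarrow> f' x \<le> K * \<delta>"
proof (cases "x \<ge> p")
  case True
  assume "x < q" "0 \<le> \<delta>"
  with True have "f' x \<le> 0" using f'_p middle_branch[of x] by (cases "x = p") auto
  with K \<open>0 \<le> \<delta>\<close> show ?thesis by (smt (verit) mult_nonneg_nonneg)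
next
  case False
  assume "p - \<delta> \<le> x"
  with False have "K * \<bar>x - p\<bar> \<le> K * \<delta>" using K by (intro mult_left_mono) auto
  then show ?thesis using f'_lip[of x p] f'_p by simp
qed

lemma f'_le_between:
  assumes "p - \<delta> \<le> x" "x \<le> q + \<delta>" "0 \<le> \<delta>"
  shows "f' x \<le> K * \<delta>"
proof (cases "x < q")
  case True
  then show ?thesis using f'_le_left_of_q assms by blast
next
  case False
  interpret mir: S_shape "\<lambda>x. - f (- x)" "\<lambda>x. f' (- x)" "- q" "- p" "- qh" "- ph" L K by (rule mirror)
  show ?thesis using mir.f'_le_left_of_q[of \<delta> "- x"] assms False p_less_q by simp
qed

end

section \<open>Slow periodic forcing of an S-shaped field\<close>

text \<open>The phase \<open>c\<close> is a time of maximal forcing, with value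
  \<open>f p + e\<close>; half a period later the minimum \<open>f q - e\<close> is attained.
  Leaving \<open>c\<close> free makes shifted and reflected systems instances of the same
  locale.\<close>

locale forced = S_shape +
  fixes y :: "real \<Rightarrow> real" and c \<epsilon> e :: real
  assumes y: "\<And>t. y t = (f p + f q) / 2 + ((f p - f q) / 2 + e) * cos (\<epsilon> * (t - c))"
    and \<epsilon>: "\<epsilon> > 0" and e: "e > 0"
begin

definition T :: real where "T = 2 * pi / \<epsilon>"
text \<open>Half the gap between the fold values times the constant 1/8 of
  \<open>one_minus_cos_ge\<close>: the forcing lies below a parabola with this coefficient in the
  slow time.\<close>

definition Q :: real where "Q = (f p - f q) / 16"

lemma T_pos: "T > 0" using \<epsilon> by (simp add: T_def)
lemma \<epsilon>T: "\<epsilon> * T = 2 * pi" using \<epsilon> by (simp add: T_def)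
lemma Q_pos: "Q > 0" using fq_less_fp by (simp add: Q_def)

lemma amplitude_pos: "(f p - f q) / 2 + e > 0"
  using fq_less_fp e by (intro add_nonneg_pos) auto

lemma y_periodic: "y (t + T) = y t"
proof -
  have "\<epsilon> * (t + T - c) = \<epsilon> * (t - c) + 2 * pi"
    using \<epsilon>T by (simp add: algebra_simps)
  then show ?thesis unfolding y by simp
qed

lemma y_deriv: "(y has_real_derivative - ((f p - f q) / 2 + e) * \<epsilon> * sin (\<epsilon> * (t - c))) (at t)"
proof -
  have "((\<lambda>t. a + b * cos (\<epsilon> * (t - c))) has_real_derivative - b * \<epsilon> * sin (\<epsilon> * (t - c))) (at t)" for a b
    by (auto intro!: derivative_eq_intros)
  moreover have "y = (\<lambda>t. (f p + f q) / 2 + ((f p - f q) / 2 + e) * cos (\<epsilon> * (t - c)))"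
    using y by (rule ext)
  ultimately show ?thesis by (simp only:)
qed

lemma y_continuous: "continuous_on A y"
  by (auto intro!: continuous_at_imp_continuous_on DERIV_isCont y_deriv)

lemma y_le_max: "y t \<le> f p + e" and y_ge_min: "y t \<ge> f q - e"
proof -
  let ?b = "(f p - f q) / 2 + e" and ?c = "cos (\<epsilon> * (t - c))"
  have "?b * ?c \<le> ?b * 1" "?b * (-1) \<le> ?b * ?c"
    using amplitude_pos by (intro mult_left_mono; simp)+
  then show "y t \<le> f p + e" "y t \<ge> f q - e" unfolding y by argo+
qed

sublocale lipschitz_equation y f L
proof
  show "continuous_on UNIV y" by (rule y_continuous)
  have "\<bar>y t\<bar> \<le> max \<bar>f p + e\<bar> \<bar>f q - e\<bar>" for t using y_le_max[of t] y_ge_min[of t] by linarith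
  then show "bounded (range y)" by (auto simp: bounded_iff)
qed (use L f_lip in auto)

lemma forced_shift: "forced f f' p q ph qh L K y (c + of_int n * T) \<epsilon> e"
proof
  fix t
  have "\<epsilon> * (t - c) = \<epsilon> * (t - (c + of_int n * T)) + of_int n * (2 * pi)"
    using \<epsilon>T by (simp add: algebra_simps)
  then have "cos (\<epsilon> * (t - c)) = cos (\<epsilon> * (t - (c + of_int n * T)))"
    using sin_int_2pin[of n] cos_int_2pin[of n] by (simp add: cos_add mult.commute)
  then show "y t = (f p + f q) / 2 + ((f p - f q) / 2 + e) * cos (\<epsilon> * (t - (c + of_int n * T)))"
    unfolding y by simp
qed (use \<epsilon> e in auto)

lemma forced_mirror: "forced (\<lambda>x. - f (- x)) (\<lambda>x. f' (- x)) (- q) (- p) (- qh) (- ph) L K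
    (\<lambda>t. - y t) (c + T / 2) \<epsilon> e"
proof -
  interpret mir: S_shape "\<lambda>x. - f (- x)" "\<lambda>x. f' (- x)" "- q" "- p" "- qh" "- ph" L K by (rule mirror)
  show ?thesis
  proof
    fix t
    have "\<epsilon> * (t - c) = \<epsilon> * (t - (c + T / 2)) + pi" using \<epsilon>T by (simp add: algebra_simps)
    then have "cos (\<epsilon> * (t - c)) = - cos (\<epsilon> * (t - (c + T / 2)))" by (simp only: cos_periodic_pi)
    then show "- y t = (- f (- (- q)) + - f (- (- p))) / 2 +
        ((- f (- (- q)) - (- f (- (- p)))) / 2 + e) * cos (\<epsilon> * (t - (c + T / 2)))"
      unfolding y minus_minus by (simp only:) argo
  qed (use \<epsilon> e in auto)
qed

lemma y_le_near:
  assumes "\<epsilon> * \<bar>t - c\<bar> \<le> pi"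
  shows "y t \<le> f p + e - Q * \<epsilon>\<^sup>2 * (t - c)\<^sup>2"
proof -
  let ?b = "(f p - f q) / 2"
  have "1 - cos (\<epsilon> * (t - c)) \<ge> (\<epsilon> * (t - c))\<^sup>2 / 8"
    using assms \<epsilon> by (intro one_minus_cos_ge) (simp add: abs_mult)
  then have "(?b + e) * (1 - cos (\<epsilon> * (t - c))) \<ge> (?b + e) * ((\<epsilon> * (t - c))\<^sup>2 / 8)"
    using amplitude_pos by (intro mult_left_mono) auto
  moreover have "(?b + e) * ((\<epsilon> * (t - c))\<^sup>2 / 8) \<ge> ?b * ((\<epsilon> * (t - c))\<^sup>2 / 8)"
    using e by (intro mult_right_mono) auto
  moreover have "?b * ((\<epsilon> * (t - c))\<^sup>2 / 8) = Q * \<epsilon>\<^sup>2 * (t - c)\<^sup>2"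
    by (simp add: Q_def power_mult_distrib)
  moreover have "y t = f p + e - (?b + e) * (1 - cos (\<epsilon> * (t - c)))"
    unfolding y by argo
  ultimately show ?thesis by linarith
qed

lemma y_ge_near: "y t \<ge> f p + e - ((f p - f q) / 2 + e) * \<epsilon>\<^sup>2 * (t - c)\<^sup>2 / 2"
proof -
  let ?b = "(f p - f q) / 2"
  have "(?b + e) * (1 - cos (\<epsilon> * (t - c))) \<le> (?b + e) * ((\<epsilon> * (t - c))\<^sup>2 / 2)"
    using amplitude_pos one_minus_cos_le by (intro mult_left_mono) auto
  moreover have "y t = f p + e - (?b + e) * (1 - cos (\<epsilon> * (t - c)))"
    unfolding y by argo
  ultimately show ?thesis by (simp add: power_mult_distrib)
qed

text \<open>The parabolic bound at the maximum \<open>c\<close> covers the first half of the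
  interval, the one at the next maximum \<open>c + T\<close> the second.\<close>

lemma y_le_fold:
  assumes w: "0 \<le> w" "Q * \<epsilon>\<^sup>2 * w\<^sup>2 \<ge> e" and t: "c + w \<le> t" "t \<le> c + T - w"
  shows "y t \<le> f p"
proof -
  interpret sh: forced f f' p q ph qh L K y "c + of_int 1 * T" \<epsilon> e by (rule forced_shift)
  have sq: "Q * \<epsilon>\<^sup>2 * u\<^sup>2 \<ge> e" if "\<bar>u\<bar> \<ge> w" for u
  proof -
    have "w\<^sup>2 \<le> u\<^sup>2" using that w by (metis abs_le_square_iff abs_of_nonneg)
    then have "Q * \<epsilon>\<^sup>2 * w\<^sup>2 \<le> Q * \<epsilon>\<^sup>2 * u\<^sup>2" using Q_pos by (intro mult_left_mono) auto
    with w show ?thesis by linarith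
  qed
  show ?thesis
  proof (cases "t \<le> c + T / 2")
    case True
    have "\<epsilon> * (t - c) \<le> \<epsilon> * (T / 2)" using True \<epsilon> by (intro mult_left_mono) auto
    then have "y t \<le> f p + e - Q * \<epsilon>\<^sup>2 * (t - c)\<^sup>2"
      using t w \<epsilon>T by (intro y_le_near) simp
    moreover have "Q * \<epsilon>\<^sup>2 * (t - c)\<^sup>2 \<ge> e" using t by (intro sq) simp
    ultimately show ?thesis by linarith
  next
    case False
    have "\<epsilon> * (c + T - t) \<le> \<epsilon> * (T / 2)" using False \<epsilon> by (intro mult_left_mono) auto
    then have "y t \<le> f p + e - Q * \<epsilon>\<^sup>2 * (t - (c + of_int 1 * T))\<^sup>2"
      using t w \<epsilon>T by (intro sh.y_le_near) simp
    moreover have "Q * \<epsilon>\<^sup>2 * (t - (c + of_int 1 * T))\<^sup>2 \<ge> e" using t by (intro sq) simp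
    ultimately show ?thesis by linarith
  qed
qed

end

section \<open>Constant barriers\<close>

context lipschitz_equation
begin

lemma mirror_equation: "lipschitz_equation (\<lambda>t. - y t) (\<lambda>x. - f (- x)) L"
proof
  show "\<bar>- f (- u) - - f (- v)\<bar> \<le> L * \<bar>u - v\<bar>" for u v
    using lip[of "- v" "- u"] by simp
  show "bounded (range (\<lambda>t. - y t))" using y_bdd by (auto simp: bounded_iff)
qed (use L y_cont in \<open>auto intro!: continuous_intros\<close>)

lemma solution_mirror:
  "entire_solution y f x \<Longrightarrow> entire_solution (\<lambda>t. - y t) (\<lambda>x. - f (- x)) (\<lambda>t. - x t)"
  unfolding entire_solution_def using DERIV_minus by fastforce

lemma constant_upper_barrier:
  assumes x: "entire_solution y f x" and ab: "a \<le> b" and xa: "x a \<le> u"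
    and y: "\<And>t. a \<le> t \<Longrightarrow> t \<le> b \<Longrightarrow> y t \<le> f u"
  shows "x b \<le> u"
proof (rule comparison[where a = a and b = b and x = x and u = "\<lambda>_. u" and u' = "\<lambda>_. 0" and L = L
      and x' = "\<lambda>t. y t - f (x t)"])
  fix t assume t: "a \<le> t" "t \<le> b"
  assume "u < x t"
  then show "y t - f (x t) - 0 \<le> L * (x t - u)"
    using lip[of "x t" u] y[OF t] by simp
qed (use ab xa entire_solutionD[OF x] in auto)

lemma constant_lower_barrier:
  assumes x: "entire_solution y f x" and ab: "a \<le> b" and xa: "x a \<ge> u"
    and y: "\<And>t. a \<le> t \<Longrightarrow> t \<le> b \<Longrightarrow> y t \<ge> f u"
  shows "x b \<ge> u"
proof -
  interpret mir: lipschitz_equation "\<lambda>t. - y t" "\<lambda>x. - f (- x)" L by (rule mirror_equation)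
  show ?thesis using mir.constant_upper_barrier[OF solution_mirror[OF x] ab, of "- u"] xa y by simp
qed

text \<open>The conclusion looks backwards. A solution at or below \<open>v\<close> could not rise
  above it, because \<open>f v\<close> exceeds the forcing, and would fall at rate \<open>k\<close>;
  within time \<open>\<tau>\<close> it would drop below \<open>lo\<close>. So remaining above
  \<open>lo\<close> for that long forces it to be above \<open>v\<close> now.\<close>

lemma above_of_stays_above:
  assumes x: "entire_solution y f x" and t: "a \<le> t" "t + \<tau> \<le> b" and \<tau>: "0 \<le> \<tau>" "v - lo < k * \<tau>" "0 \<le> k"
    and lo: "\<And>t. a \<le> t \<Longrightarrow> t \<le> b \<Longrightarrow> lo \<le> x t"
    and y: "\<And>t. a \<le> t \<Longrightarrow> t \<le> b \<Longrightarrow> y t \<le> Y"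
    and f: "\<And>u. lo \<le> u \<Longrightarrow> u \<le> v \<Longrightarrow> f u \<ge> Y + k"
  shows "v < x t"
proof (rule ccontr)
  assume "\<not> v < x t"
  then have xt: "x t \<le> v" by simp
  have "lo \<le> v" using lo[of t] xt t \<tau> by auto
  have le: "x s \<le> v" if "t \<le> s" "s \<le> b" for s
  proof (rule constant_upper_barrier[OF x \<open>t \<le> s\<close> xt])
    fix r assume "t \<le> r" "r \<le> s"
    then show "y r \<le> f v" using y[of r] f[of v] \<open>lo \<le> v\<close> \<tau> that t by auto
  qed
  have "x (t + \<tau>) - x t \<le> - k * (t + \<tau> - t)"
  proof (rule increment_le)
    fix s assume s: "t \<le> s" "s \<le> t + \<tau>"
    show "(x has_real_derivative y s - f (x s)) (at s)" using x by (rule entire_solutionD)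
    show "y s - f (x s) \<le> - k" using y[of s] f[of "x s"] lo[of s] le[of s] s t by simp
  qed (use \<tau> in auto)
  then show False using \<tau> xt lo[of "t + \<tau>"] t by simp
qed

lemma below_of_stays_below:
  assumes x: "entire_solution y f x" and t: "a \<le> t" "t + \<tau> \<le> b" and \<tau>: "0 \<le> \<tau>" "hi - v < k * \<tau>" "0 \<le> k"
    and hi: "\<And>t. a \<le> t \<Longrightarrow> t \<le> b \<Longrightarrow> x t \<le> hi"
    and y: "\<And>t. a \<le> t \<Longrightarrow> t \<le> b \<Longrightarrow> y t \<ge> Y"
    and f: "\<And>u. v \<le> u \<Longrightarrow> u \<le> hi \<Longrightarrow> f u \<le> Y - k"
  shows "x t < v"
proof -
  interpret mir: lipschitz_equation "\<lambda>t. - y t" "\<lambda>x. - f (- x)" L by (rule mirror_equation)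
  have "- v < - x t"
  proof (rule mir.above_of_stays_above[OF solution_mirror[OF x] t, where lo = "- hi" and k = k and Y = "- Y"])
    show "- Y + k \<le> - f (- u)" if "- hi \<le> u" "u \<le> - v" for u using f[of "- u"] that by simp
  qed (use \<tau> hi y in auto)
  then show ?thesis by simp
qed

end

section \<open>A barrier across the window of excess forcing\<close>

locale narrow_window = forced +
  assumes small_e: "384 * K * e\<^sup>2 \<le> Q * \<epsilon>\<^sup>2" and e_small: "6 * e \<le> Q * (pi / 4)\<^sup>2"
begin

text \<open>The half width for which \<open>2 * e - Q * \<epsilon>\<^sup>2 * u\<^sup>2\<close> has
  integral zero over the window, which means
  \<open>Q * \<epsilon>\<^sup>2 * t1\<^sup>2 = 6 * e\<close>. The next constant,
  \<open>\<delta>\<close>, bounds the corrector \<open>bump\<close> there: each of its two terms is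
  at most \<open>4 * e * t1\<close>.\<close>

definition t1 :: real where "t1 = sqrt (6 * e / Q) / \<epsilon>"
definition \<delta> :: real where "\<delta> = 8 * e * t1"

text \<open>The cubic is chosen with \<open>bump (- t1) = bump t1 = 0\<close>: a solution that enters the window around
  the maximum of the forcing below the fold also leaves it below the fold.\<close>

definition bump :: "real \<Rightarrow> real" where
  "bump u = 2 * e * (u + t1) - Q * \<epsilon>\<^sup>2 / 3 * (u ^ 3 + t1 ^ 3)"

lemma t1_pos: "t1 > 0" unfolding t1_def using e Q_pos \<epsilon> by simp

lemma t1_sq: "Q * \<epsilon>\<^sup>2 * t1\<^sup>2 = 6 * e"
  unfolding t1_def using e Q_pos \<epsilon> by (simp add: power_divide)

lemma t1_le: "t1 \<le> T / 8"
proof -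
  have "6 * e / Q \<le> (pi / 4)\<^sup>2" using e_small Q_pos by (simp add: pos_divide_le_eq mult.commute)
  then have "sqrt (6 * e / Q) \<le> pi / 4" by (intro real_le_lsqrt) auto
  then have "t1 \<le> pi / 4 / \<epsilon>" unfolding t1_def using \<epsilon> by (intro divide_right_mono) auto
  then show ?thesis by (simp add: T_def)
qed

lemma \<delta>_pos: "\<delta> > 0" unfolding \<delta>_def using e t1_pos by simp

lemma bump_deriv: "(bump has_real_derivative 2 * e - Q * \<epsilon>\<^sup>2 * u\<^sup>2) (at u)"
proof -
  have "((\<lambda>u. 2 * e * (u + t1) - Q * \<epsilon>\<^sup>2 / 3 * (u ^ 3 + t1 ^ 3)) has_real_derivative
      2 * e - Q * \<epsilon>\<^sup>2 * u\<^sup>2) (at u)"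
    by (auto intro!: derivative_eq_intros)
  then show ?thesis by (simp add: bump_def[abs_def])
qed

lemma bump_right: "bump t1 = 0"
proof -
  have "Q * \<epsilon>\<^sup>2 / 3 * (t1 ^ 3 + t1 ^ 3) = 2 / 3 * t1 * (Q * \<epsilon>\<^sup>2 * t1\<^sup>2)"
    by (simp add: power3_eq_cube power2_eq_square)
  then show ?thesis unfolding bump_def t1_sq by simp
qed

lemma bump_left: "bump (- t1) = 0"
  by (simp add: bump_def)

lemma bump_bound:
  assumes "\<bar>u\<bar> \<le> t1"
  shows "\<bar>bump u\<bar> \<le> \<delta>"
proof -
  have "\<bar>u ^ 3\<bar> \<le> t1 ^ 3" using assms by (simp add: power_abs power_mono)
  then have "\<bar>u ^ 3 + t1 ^ 3\<bar> \<le> 2 * t1 ^ 3" using t1_pos by (simp add: abs_le_iff)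
  then have "Q * \<epsilon>\<^sup>2 / 3 * \<bar>u ^ 3 + t1 ^ 3\<bar> \<le> Q * \<epsilon>\<^sup>2 / 3 * (2 * t1 ^ 3)"
    using Q_pos by (intro mult_left_mono) auto
  also have "\<dots> = 2 / 3 * t1 * (Q * \<epsilon>\<^sup>2 * t1\<^sup>2)" by (simp add: power3_eq_cube power2_eq_square)
  also have "\<dots> = 4 * e * t1" unfolding t1_sq by simp
  finally have "\<bar>Q * \<epsilon>\<^sup>2 / 3 * (u ^ 3 + t1 ^ 3)\<bar> \<le> 4 * e * t1"
    using Q_pos by (simp add: abs_mult)
  moreover have "\<bar>2 * e * (u + t1)\<bar> \<le> 4 * e * t1"
  proof -
    have "2 * e * \<bar>u + t1\<bar> \<le> 2 * e * (2 * t1)" using assms e by (intro mult_left_mono) auto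
    then show ?thesis using e by (simp add: abs_mult)
  qed
  ultimately show ?thesis unfolding bump_def \<delta>_def by linarith
qed

text \<open>This is \<open>small_e\<close> after inserting \<open>\<delta> = 8 * e * t1\<close> and
  \<open>t1_sq\<close>; the constant there is 384 = 64 * 6.\<close>

lemma K_\<delta>_sq: "K * \<delta>\<^sup>2 \<le> e"
proof -
  have "K * \<delta>\<^sup>2 * (Q * \<epsilon>\<^sup>2) = 64 * K * e\<^sup>2 * (Q * \<epsilon>\<^sup>2 * t1\<^sup>2)"
    by (simp add: \<delta>_def power_mult_distrib)
  also have "\<dots> = 384 * K * e\<^sup>2 * e" unfolding t1_sq by simp
  also have "\<dots> \<le> Q * \<epsilon>\<^sup>2 * e" using small_e e by (intro mult_right_mono) auto
  finally have "K * \<delta>\<^sup>2 * (Q * \<epsilon>\<^sup>2) \<le> e * (Q * \<epsilon>\<^sup>2)" by (simp only: mult.commute)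
  then show ?thesis using Q_pos \<epsilon> by simp
qed

text \<open>The corrected barrier has slope
  \<open>2 * e - Q * \<epsilon>\<^sup>2 * (t - c)\<^sup>2\<close>. One \<open>e\<close> pays for the
  excess of the forcing over \<open>f p\<close>, the other for the loss
  \<open>f p - f (p + bump (t - c))\<close>, at most \<open>K * \<delta>\<^sup>2\<close>.\<close>

lemma window_step:
  assumes x: "entire_solution y f x" and ab: "c - t1 \<le> a" "a \<le> b" "b \<le> c + t1" and xa: "x a \<le> p + bump (a - c)"
  shows "x b \<le> p + bump (b - c)"
proof (rule comparison[where a = a and b = b and x = x and u = "\<lambda>t. p + bump (t - c)" and L = L
      and u' = "\<lambda>t. 2 * e - Q * \<epsilon>\<^sup>2 * (t - c)\<^sup>2" and x' = "\<lambda>t. y t - f (x t)"])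
  fix t assume t: "a \<le> t" "t \<le> b"
  show "((\<lambda>t. p + bump (t - c)) has_real_derivative 2 * e - Q * \<epsilon>\<^sup>2 * (t - c)\<^sup>2) (at t)"
  proof -
    have "((\<lambda>t. bump (t - c)) has_real_derivative (2 * e - Q * \<epsilon>\<^sup>2 * (t - c)\<^sup>2) * 1) (at t)"
      by (rule DERIV_chain2[OF bump_deriv]) (auto intro!: derivative_eq_intros)
    then show ?thesis by (auto intro!: derivative_eq_intros)
  qed
  assume less: "p + bump (t - c) < x t"
  have "\<bar>t - c\<bar> \<le> T / 8" using t ab t1_le by linarith
  then have "\<epsilon> * \<bar>t - c\<bar> \<le> \<epsilon> * (T / 8)" using \<epsilon> by (intro mult_left_mono) auto
  then have "y t \<le> f p + e - Q * \<epsilon>\<^sup>2 * (t - c)\<^sup>2" proof (intro y_le_near)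
    assume "\<epsilon> * \<bar>t - c\<bar> \<le> \<epsilon> * (T / 8)"
    moreover have "\<epsilon> * (T / 8) = pi / 4" using \<epsilon>T by simp
    ultimately show "\<epsilon> * \<bar>t - c\<bar> \<le> pi" using pi_gt_zero by linarith
  qed
  moreover have "f (p + bump (t - c)) \<ge> f p - e"
  proof -
    have "\<bar>bump (t - c)\<bar> \<le> \<delta>" using t ab by (intro bump_bound) auto
    then have "(bump (t - c))\<^sup>2 \<le> \<delta>\<^sup>2" using \<delta>_pos by (metis abs_le_square_iff abs_of_pos)
    then have "K * (bump (t - c))\<^sup>2 \<le> K * \<delta>\<^sup>2" using K by (intro mult_left_mono) auto
    then show ?thesis using f_ge_parabola[of "p + bump (t - c)"] K_\<delta>_sq by simp
  qed
  moreover have "f (p + bump (t - c)) - f (x t) \<le> L * (x t - (p + bump (t - c)))"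
    using lip[of "p + bump (t - c)" "x t"] less by simp
  ultimately show "y t - f (x t) - (2 * e - Q * \<epsilon>\<^sup>2 * (t - c)\<^sup>2) \<le> L * (x t - (p + bump (t - c)))"
    by linarith
qed (use ab xa entire_solutionD[OF x] in auto)

lemma outside_step:
  assumes x: "entire_solution y f x" and ab: "c + t1 \<le> a" "a \<le> b" "b \<le> c + T - t1" and xa: "x a \<le> p"
  shows "x b \<le> p"
proof (rule constant_upper_barrier[OF x ab(2) xa])
  fix t assume t: "a \<le> t" "t \<le> b"
  show "y t \<le> f p"
    by (rule y_le_fold[of t1]) (use t1_pos t1_sq e t ab in auto)
qed

lemma narrow_shift: "narrow_window f f' p q ph qh L K y (c + of_int n * T) \<epsilon> e"
proof -
  interpret sh: forced f f' p q ph qh L K y "c + of_int n * T" \<epsilon> e by (rule forced_shift)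
  show ?thesis by unfold_locales (use small_e e_small in auto)
qed

lemma Q_mirror: "forced.Q (\<lambda>x. - f (- x)) (- q) (- p) = Q"
proof -
  interpret mir: forced "\<lambda>x. - f (- x)" "\<lambda>x. f' (- x)" "- q" "- p" "- qh" "- ph" L K
    "\<lambda>t. - y t" "c + T / 2" \<epsilon> e by (rule forced_mirror)
  show ?thesis by (simp add: Q_def mir.Q_def)
qed

lemma narrow_mirror: "narrow_window (\<lambda>x. - f (- x)) (\<lambda>x. f' (- x)) (- q) (- p) (- qh) (- ph) L K
    (\<lambda>t. - y t) (c + T / 2) \<epsilon> e"
proof -
  interpret mir: forced "\<lambda>x. - f (- x)" "\<lambda>x. f' (- x)" "- q" "- p" "- qh" "- ph" L K
    "\<lambda>t. - y t" "c + T / 2" \<epsilon> e by (rule forced_mirror)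
  show ?thesis by unfold_locales (use small_e e_small Q_mirror in auto)
qed

lemma t1_mirror: "narrow_window.t1 (\<lambda>x. - f (- x)) (- q) (- p) \<epsilon> e = t1"
proof -
  interpret mir: narrow_window "\<lambda>x. - f (- x)" "\<lambda>x. f' (- x)" "- q" "- p" "- qh" "- ph" L K
    "\<lambda>t. - y t" "c + T / 2" \<epsilon> e by (rule narrow_mirror)
  show ?thesis unfolding mir.t1_def t1_def Q_mirror ..
qed

lemma \<delta>_mirror: "narrow_window.\<delta> (\<lambda>x. - f (- x)) (- q) (- p) \<epsilon> e = \<delta>"
proof -
  interpret mir: narrow_window "\<lambda>x. - f (- x)" "\<lambda>x. f' (- x)" "- q" "- p" "- qh" "- ph" L K
    "\<lambda>t. - y t" "c + T / 2" \<epsilon> e by (rule narrow_mirror)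
  show ?thesis unfolding mir.\<delta>_def \<delta>_def t1_mirror ..
qed

text \<open>From the end of one window the constant \<open>p\<close> is a barrier up to the next,
  and \<open>p + bump\<close> is one across it. Since \<open>bump\<close> vanishes at both ends, the
  half-line below \<open>p\<close> is mapped into itself, at the price of an overshoot of at most
  \<open>\<delta>\<close> in between.\<close>

lemma section_step:
  assumes x: "entire_solution y f x" and sec: "x (c + t1) \<le> p"
  shows "c + t1 \<le> t \<Longrightarrow> t \<le> c + T + t1 \<Longrightarrow> x t \<le> p + \<delta>" and "x (c + T + t1) \<le> p"
proof -
  interpret sh: narrow_window f f' p q ph qh L K y "c + of_int 1 * T" \<epsilon> e by (rule narrow_shift)
  have out: "x t \<le> p" if "c + t1 \<le> t" "t \<le> c + T - t1" for t
    using outside_step[OF x order_refl _ _ sec] that by auto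
  have "c + t1 \<le> c + T - t1" using t1_le T_pos by simp
  then have start: "x (c + T - t1) \<le> p" using out by simp
  have win: "x t \<le> p + bump (t - (c + T))" if "c + T - t1 \<le> t" "t \<le> c + T + t1" for t
    using sh.window_step[OF x, of "c + T - t1" t] start that bump_left by simp
  show "x (c + T + t1) \<le> p" using win[of "c + T + t1"] t1_pos bump_right by simp
  show "x t \<le> p + \<delta>" if t: "c + t1 \<le> t" "t \<le> c + T + t1"
  proof (cases "t \<le> c + T - t1")
    case True
    then show ?thesis using out[of t] t \<delta>_pos by simp
  next
    case False
    then have "\<bar>bump (t - (c + T))\<bar> \<le> \<delta>" using t by (intro bump_bound) auto
    then show ?thesis using win[of t] False t by simp
  qed
qed

text \<open>The solution started at \<open>p - \<delta>\<close> lies below the barrier, because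
  \<open>bump\<close> is at least \<open>- \<delta>\<close>, and so ends at or below
  \<open>p\<close>. A solution strictly below it would end strictly below \<open>p\<close>.\<close>

lemma above_before_section:
  assumes x: "entire_solution y f x" and sec: "x (c + T + t1) \<ge> p"
    and t: "c + t1 \<le> t" "t \<le> c + T + t1"
  shows "x t \<ge> p - \<delta>"
proof (rule ccontr)
  assume "\<not> p - \<delta> \<le> x t"
  then have xt: "x t < p - \<delta>" by simp
  interpret sh: narrow_window f f' p q ph qh L K y "c + of_int 1 * T" \<epsilon> e by (rule narrow_shift)
  obtain w where w: "entire_solution y f w" "w t = p - \<delta>" using exists_solution by blast
  have "w (c + T + t1) \<le> p"
  proof (cases "t \<le> c + T - t1")
    case True
    then have "w (c + T - t1) \<le> p" using outside_step[OF w(1) t(1)] w(2) \<delta>_pos by simp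
    then show ?thesis
      using sh.window_step[OF w(1), of "c + T - t1" "c + T + t1"] bump_left bump_right t1_pos by simp
  next
    case False
    then have "\<bar>bump (t - (c + T))\<bar> \<le> \<delta>" using t by (intro bump_bound) auto
    then show ?thesis
      using sh.window_step[OF w(1), of t "c + T + t1"] bump_right t w(2) False by simp
  qed
  moreover have "x (c + T + t1) < w (c + T + t1)" using solution_less[OF x w(1), of t] xt w(2) by simp
  ultimately show False using sec by simp
qed

end

section \<open>Contraction below the fold and expansion between the folds, over one period\<close>

context forced
begin

lemma y_le_mean:
  assumes "c + T / 4 \<le> t" "t \<le> c + 3 * T / 4"
  shows "y t \<le> (f p + f q) / 2"
proof -
  have "\<epsilon> * (T / 4) \<le> \<epsilon> * (t - c)" "\<epsilon> * (t - c) \<le> \<epsilon> * (3 * T / 4)"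
    using assms \<epsilon> by (auto intro!: mult_left_mono)
  then have "cos (\<epsilon> * (t - c) - pi) \<ge> 0" using \<epsilon>T by (intro cos_ge_zero) auto
  then have "cos (\<epsilon> * (t - c)) \<le> 0" by simp
  then have "((f p - f q) / 2 + e) * cos (\<epsilon> * (t - c)) \<le> 0"
    using amplitude_pos by (simp only: mult_nonneg_nonpos less_imp_le)
  then show ?thesis unfolding y by argo
qed

text \<open>On this stretch the cosine is at most 1/2 in absolute value, and the amplitude is at
  most 3/4 of the gap between the fold values. Hence the forcing keeps 1/8 of the gap away from both
  fold values.\<close>

lemma y_between:
  assumes t: "c + T / 6 \<le> t" "t \<le> c + T / 3" and e: "e \<le> (f p - f q) / 4"
  shows "y t \<le> (f p + f q) / 2 + 3 / 8 * (f p - f q)" "y t \<ge> (f p + f q) / 2 - 3 / 8 * (f p - f q)"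
proof -
  have th: "\<epsilon> * (T / 6) \<le> \<epsilon> * (t - c)" "\<epsilon> * (t - c) \<le> \<epsilon> * (T / 3)"
    using assms \<epsilon> by (auto intro!: mult_left_mono)
  have "cos (\<epsilon> * (t - c)) \<le> cos (pi / 3)" using th \<epsilon>T by (intro cos_monotone_0_pi_le) auto
  moreover have "cos (2 * pi / 3) \<le> cos (\<epsilon> * (t - c))"
    using th \<epsilon>T mult_nonneg_nonneg[of \<epsilon> "T / 6"] \<epsilon> T_pos by (intro cos_monotone_0_pi_le) auto
  ultimately have "\<bar>cos (\<epsilon> * (t - c))\<bar> \<le> 1 / 2" by (simp add: cos_60 cos_120)
  then have "\<bar>((f p - f q) / 2 + e) * cos (\<epsilon> * (t - c))\<bar> \<le> ((f p - f q) / 2 + e) * (1 / 2)"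
    unfolding abs_mult using amplitude_pos by (intro mult_mono) auto
  then show "y t \<le> (f p + f q) / 2 + 3 / 8 * (f p - f q)" "y t \<ge> (f p + f q) / 2 - 3 / 8 * (f p - f q)"
    unfolding y using e unfolding abs_le_iff by argo+
qed

end

context narrow_window
begin

text \<open>Expansion occurs only in the overshoot, at rate at most
  \<open>K * \<delta> \<le> c0 / 8\<close>. From \<open>c + T / 4\<close> to
  \<open>c + 3 * T / 4\<close> the forcing is at most the mean of the fold values: the first half of
  this time brings \<open>z\<close> below \<open>pl\<close>, and during the second half the rate
  \<open>c0\<close> acts. The balance is \<open>- 5 / 32 * c0 * T\<close>.\<close>

lemma contraction_left:
  assumes pl: "pl < p" and \<eta>: "\<eta> > 0" "\<And>u. pl \<le> u \<Longrightarrow> u \<le> p + \<delta> \<Longrightarrow> f u \<ge> (f p + f q) / 2 + \<eta>"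
    and c0: "c0 > 0" "\<And>u. u \<le> pl \<Longrightarrow> f' u \<ge> c0"
    and small: "K * \<delta> \<le> c0 / 8" "p + \<delta> - pl \<le> \<eta> * (T / 4)"
    and z: "entire_solution y f z" "z (c + t1) \<le> p"
    and \<Phi>: "\<And>t. (\<Phi> has_real_derivative - f' (\<xi> t)) (at t)"
    and \<xi>: "\<And>t. c + t1 \<le> t \<Longrightarrow> t \<le> c + T + t1 \<Longrightarrow> \<xi> t \<le> z t"
  shows "\<Phi> (c + T + t1) - \<Phi> (c + t1) \<le> - c0 * T / 8"
proof -
  note le = section_step(1)[OF z]
  have t1: "0 < t1" "t1 \<le> T / 8" "T > 0" using t1_pos t1_le T_pos by auto
  have good: "z t \<le> pl" if t: "c + T / 2 \<le> t" "t \<le> c + 3 * T / 4" for t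
  proof (rule absorbing[where h = z and h' = "\<lambda>t. y t - f (z t)" and k = \<eta> and \<tau> = "T / 4"
        and a = "c + T / 4" and b = t])
    show "z (c + T / 4) \<le> pl + \<eta> * (T / 4)" using le[of "c + T / 4"] small t1 by simp
    fix s assume s: "c + T / 4 \<le> s" "s \<le> t"
    show "(z has_real_derivative y s - f (z s)) (at s)" by (rule entire_solutionD[OF z(1)])
    assume "pl < z s"
    then have "f (z s) \<ge> (f p + f q) / 2 + \<eta>" using le[of s] s t t1 by (intro \<eta>(2)) auto
    then show "y s - f (z s) \<le> - \<eta>" using y_le_mean[of s] s t by argo
  qed (use t t1 \<eta> in auto)
  have "\<Phi> (c + T / 2) - \<Phi> (c + t1) \<le> c0 / 8 * (c + T / 2 - (c + t1))"
  proof (rule increment_le[OF _ \<Phi>])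
    fix t assume "c + t1 \<le> t" "t \<le> c + T / 2"
    then have "\<xi> t \<le> p + \<delta>" using \<xi>[of t] le[of t] t1 by auto
    then show "- f' (\<xi> t) \<le> c0 / 8" using f'_ge_near_fold[of "\<xi> t" \<delta>] \<delta>_pos small by simp
  qed (use t1 in auto)
  moreover have "\<Phi> (c + 3 * T / 4) - \<Phi> (c + T / 2) \<le> - c0 * (c + 3 * T / 4 - (c + T / 2))"
  proof (rule increment_le[OF _ \<Phi>])
    fix t assume t: "c + T / 2 \<le> t" "t \<le> c + 3 * T / 4"
    then have "\<xi> t \<le> pl" using good[of t] \<xi>[of t] t1 by auto
    then show "- f' (\<xi> t) \<le> - c0" using c0(2) by simp
  qed (use t1 in auto)
  moreover have "\<Phi> (c + T + t1) - \<Phi> (c + 3 * T / 4) \<le> c0 / 8 * (c + T + t1 - (c + 3 * T / 4))"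
  proof (rule increment_le[OF _ \<Phi>])
    fix t assume "c + 3 * T / 4 \<le> t" "t \<le> c + T + t1"
    then have "\<xi> t \<le> p + \<delta>" using \<xi>[of t] le[of t] t1 by auto
    then show "- f' (\<xi> t) \<le> c0 / 8" using f'_ge_near_fold[of "\<xi> t" \<delta>] \<delta>_pos small by simp
  qed (use t1 in auto)
  ultimately have "\<Phi> (c + T + t1) - \<Phi> (c + t1)
      \<le> c0 / 8 * (T / 2 - t1) - c0 * (T / 4) + c0 / 8 * (T / 4 + t1)" by (simp add: algebra_simps)
  also have "\<dots> = c0 * T * (- 5 / 32)" by (simp add: algebra_simps)
  also have "\<dots> \<le> c0 * T * (- 1 / 8)" using c0(1) T_pos by (intro mult_left_mono) auto
  finally show ?thesis by simp
qed

text \<open>While the forcing is away from both fold values, a solution that remains above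
  \<open>p - \<delta>\<close> must already lie above \<open>p'\<close>, and one that remains below
  \<open>q + \<delta>\<close> must lie below \<open>q'\<close>. This gives the rate
  \<open>c0\<close> for a time \<open>T / 12\<close>; the rest of the period loses at rate at most
  \<open>c0 / 24\<close>, leaving \<open>13 / 288 * c0 * T\<close>.\<close>

lemma expansion_middle:
  assumes p': "p < p'" "\<And>u. p - \<delta> \<le> u \<Longrightarrow> u \<le> p' \<Longrightarrow> f u \<ge> (f p + f q) / 2 + 7 / 16 * (f p - f q)"
    and q': "q' < q" "\<And>u. q' \<le> u \<Longrightarrow> u \<le> q + \<delta> \<Longrightarrow> f u \<le> (f p + f q) / 2 - 7 / 16 * (f p - f q)"
    and c0: "c0 > 0" "\<And>u. p' \<le> u \<Longrightarrow> u \<le> q' \<Longrightarrow> f' u \<le> - c0"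
    and small: "K * \<delta> \<le> c0 / 24" "p' - (p - \<delta>) < (f p - f q) / 16 * (T / 12)"
      "q + \<delta> - q' < (f p - f q) / 16 * (T / 12)" "e \<le> (f p - f q) / 4"
    and x: "entire_solution y f x" "\<And>t. c + t1 \<le> t \<Longrightarrow> t \<le> c + T + t1 \<Longrightarrow> p - \<delta> \<le> x t"
    and z: "entire_solution y f z" "\<And>t. c + t1 \<le> t \<Longrightarrow> t \<le> c + T + t1 \<Longrightarrow> z t \<le> q + \<delta>"
    and \<Phi>: "\<And>t. (\<Phi> has_real_derivative - f' (\<xi> t)) (at t)"
    and \<xi>: "\<And>t. c + t1 \<le> t \<Longrightarrow> t \<le> c + T + t1 \<Longrightarrow> x t \<le> \<xi> t \<and> \<xi> t \<le> z t"
  shows "\<Phi> (c + T + t1) - \<Phi> (c + t1) \<ge> c0 * T / 24"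
proof -
  have t1: "0 < t1" "t1 \<le> T / 8" "T > 0" using t1_pos t1_le T_pos by auto
  have d: "f p - f q > 0" using fq_less_fp by simp
  have x_good: "p' < x t" if t: "c + T / 6 \<le> t" "t \<le> c + T / 4" for t
  proof (rule above_of_stays_above[OF x(1), where a = "c + T / 6" and b = "c + T / 3" and \<tau> = "T / 12"
        and lo = "p - \<delta>" and k = "(f p - f q) / 16" and Y = "(f p + f q) / 2 + 3 / 8 * (f p - f q)"])
    show "(f p + f q) / 2 + 3 / 8 * (f p - f q) + (f p - f q) / 16 \<le> f u" if "p - \<delta> \<le> u" "u \<le> p'" for u
      using p'(2)[OF that] by argo
    show "y s \<le> (f p + f q) / 2 + 3 / 8 * (f p - f q)" if "c + T / 6 \<le> s" "s \<le> c + T / 3" for s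
      using y_between(1)[OF that small(4)] .
    show "p - \<delta> \<le> x s" if "c + T / 6 \<le> s" "s \<le> c + T / 3" for s using x(2) that t1 by simp
  qed (use t t1 d small in auto)
  have z_good: "z t < q'" if t: "c + T / 6 \<le> t" "t \<le> c + T / 4" for t
  proof (rule below_of_stays_below[OF z(1), where a = "c + T / 6" and b = "c + T / 3" and \<tau> = "T / 12"
        and hi = "q + \<delta>" and k = "(f p - f q) / 16" and Y = "(f p + f q) / 2 - 3 / 8 * (f p - f q)"])
    show "f u \<le> (f p + f q) / 2 - 3 / 8 * (f p - f q) - (f p - f q) / 16" if "q' \<le> u" "u \<le> q + \<delta>" for u
      using q'(2)[OF that] by argo
    show "y s \<ge> (f p + f q) / 2 - 3 / 8 * (f p - f q)" if "c + T / 6 \<le> s" "s \<le> c + T / 3" for s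
      using y_between(2)[OF that small(4)] .
    show "z s \<le> q + \<delta>" if "c + T / 6 \<le> s" "s \<le> c + T / 3" for s using z(2) that t1 by simp
  qed (use t t1 d small in auto)
  have all: "f' (\<xi> t) \<le> c0 / 24" if t: "c + t1 \<le> t" "t \<le> c + T + t1" for t
    using f'_le_between[of \<delta> "\<xi> t"] \<xi>[OF t] x(2)[OF t] z(2)[OF t] small(1) \<delta>_pos by linarith
  have \<Psi>: "((\<lambda>t. - \<Phi> t) has_real_derivative f' (\<xi> t)) (at t)" for t
    using DERIV_minus[OF \<Phi>[of t]] by simp
  have "- \<Phi> (c + T / 6) - - \<Phi> (c + t1) \<le> c0 / 24 * (c + T / 6 - (c + t1))"
    by (rule increment_le[OF _ \<Psi>]) (use t1 all in auto)
  moreover have "- \<Phi> (c + T / 4) - - \<Phi> (c + T / 6) \<le> - c0 * (c + T / 4 - (c + T / 6))"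
  proof (rule increment_le[OF _ \<Psi>])
    fix t assume t: "c + T / 6 \<le> t" "t \<le> c + T / 4"
    then have "p' \<le> \<xi> t" "\<xi> t \<le> q'" using x_good[of t] z_good[of t] \<xi>[of t] t1 by auto
    then show "f' (\<xi> t) \<le> - c0" using c0(2) by simp
  qed (use t1 in auto)
  moreover have "- \<Phi> (c + T + t1) - - \<Phi> (c + T / 4) \<le> c0 / 24 * (c + T + t1 - (c + T / 4))"
    by (rule increment_le[OF _ \<Psi>]) (use t1 all in auto)
  ultimately have "- \<Phi> (c + T + t1) + \<Phi> (c + t1)
      \<le> c0 / 24 * (T / 6 - t1) - c0 * (T / 12) + c0 / 24 * (3 / 4 * T + t1)" by (simp add: algebra_simps)
  also have "\<dots> = c0 * T * (- 13 / 288)" by (simp add: algebra_simps)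
  also have "\<dots> \<le> c0 * T * (- 1 / 24)" using c0(1) T_pos by (intro mult_left_mono) auto
  finally show ?thesis by simp
qed

end

section \<open>Consequences of contraction at section times\<close>

context lipschitz_equation
begin

text \<open>Between two sections a difference grows at most by the factor
  \<open>exp (L * T)\<close>, so geometric decay along the sections carries over to all later
  times.\<close>

lemma decay_of_section_decay:
  assumes x: "entire_solution y f x" and z: "entire_solution y f z" and T: "T > 0"
    and dec: "\<And>n :: nat. \<bar>x (s + real (Suc n) * T) - z (s + real (Suc n) * T)\<bar>
      \<le> exp (- 1) * \<bar>x (s + real n * T) - z (s + real n * T)\<bar>"
  shows "((\<lambda>t. x t - z t) \<longlongrightarrow> 0) at_top"
proof -
  define C where "C = \<bar>x s - z s\<bar>"
  have step: "\<bar>x (s + real n * T) - z (s + real n * T)\<bar> \<le> exp (- real n) * C" for n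
  proof (induction n)
    case (Suc n)
    have "\<bar>x (s + real (Suc n) * T) - z (s + real (Suc n) * T)\<bar>
        \<le> exp (- 1) * \<bar>x (s + real n * T) - z (s + real n * T)\<bar>" by (rule dec)
    also have "\<dots> \<le> exp (- 1) * (exp (- real n) * C)" using Suc.IH by (intro mult_left_mono) auto
    also have "\<dots> = exp (- real (Suc n)) * C"
      using exp_add[of "- 1" "- real n"] by simp
    finally show ?case .
  qed (simp add: C_def)
  have bound: "norm (x t - z t) \<le> exp (L * T + 1) * C * exp (- (t - s) / T)" if "t \<ge> s" for t
  proof -
    define n where "n = nat \<lfloor>(t - s) / T\<rfloor>"
    have "0 \<le> \<lfloor>(t - s) / T\<rfloor>" using that T by simp
    then have "real n = of_int \<lfloor>(t - s) / T\<rfloor>" unfolding n_def by simp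
    then have b: "real n \<le> (t - s) / T" "(t - s) / T < real n + 1" by linarith+
    then have "real n * T \<le> t - s" "t - s < (real n + 1) * T"
      using T by (simp_all only: pos_le_divide_eq pos_divide_less_eq)
    then have n: "s + real n * T \<le> t" "t - (s + real n * T) \<le> T" by (simp_all add: distrib_right)
    have n': "- real n \<le> 1 - (t - s) / T" using b by linarith
    have "\<bar>x t - z t\<bar> \<le> exp (L * \<bar>t - (s + real n * T)\<bar>) * \<bar>x (s + real n * T) - z (s + real n * T)\<bar>"
      by (rule solution_dist[OF x z])
    also have "\<dots> \<le> exp (L * T) * (exp (- real n) * C)"
      using n L step[of n] by (intro mult_mono) auto
    also have "\<dots> \<le> exp (L * T) * (exp (1 - (t - s) / T) * C)"
      using n' by (intro mult_left_mono mult_right_mono) (auto simp: C_def)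
    also have "\<dots> = exp (L * T) * exp (1 - (t - s) / T) * C" by simp
    also have "exp (L * T) * exp (1 - (t - s) / T) = exp (L * T + 1) * exp (- (t - s) / T)"
      unfolding exp_add[symmetric] by (rule arg_cong[where f = exp]) (simp add: diff_divide_distrib)
    also have "exp (L * T + 1) * exp (- (t - s) / T) * C = exp (L * T + 1) * C * exp (- (t - s) / T)"
      unfolding mult.assoc by (rule arg_cong[OF mult.commute])
    finally show ?thesis by simp
  qed
  have "filterlim (\<lambda>t. - s + t) at_top at_top"
    by (rule filterlim_tendsto_add_at_top[OF tendsto_const filterlim_ident])
  then have lim: "filterlim (\<lambda>t. 1 / T * (- s + t)) at_top at_top"
    by (rule filterlim_tendsto_pos_mult_at_top[OF tendsto_const, rotated]) (use T in simp)
  have eq: "(\<lambda>t. 1 / T * (- s + t)) = (\<lambda>t. - (- (t - s) / T))"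
    by (rule ext) (simp add: diff_divide_distrib)
  from lim have "filterlim (\<lambda>t. - (- (t - s) / T)) at_top at_top"
    by (rule subst[OF eq, where P = "\<lambda>h. filterlim h at_top at_top"])
  then have "filterlim (\<lambda>t. - (t - s) / T) at_bot at_top"
    by (rule filterlim_uminus_at_bot[THEN iffD2])
  then have "((\<lambda>t. exp (- (t - s) / T)) \<longlongrightarrow> 0) at_top"
    by (rule filterlim_compose[OF exp_at_bot])
  then have "((\<lambda>t. exp (L * T + 1) * C * exp (- (t - s) / T)) \<longlongrightarrow> 0) at_top"
    by (rule tendsto_mult_right_zero)
  then show ?thesis
    by (rule Lim_null_comparison[rotated]) (rule eventually_at_top_linorderI[OF bound])
qed

text \<open>Going back \<open>k\<close> periods gains the factor \<open>exp (- k)\<close>, while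
  boundedness keeps the earlier difference below a fixed constant.\<close>

lemma bounded_eq_of_contraction:
  assumes x: "entire_solution y f x" "bounded (range x)" and z: "entire_solution y f z" "bounded (range z)"
    and dec: "\<And>k :: nat. \<bar>x (s - real k * T) - z (s - real k * T)\<bar>
      \<le> exp (- 1) * \<bar>x (s - real (Suc k) * T) - z (s - real (Suc k) * T)\<bar>"
  shows "x = z"
proof -
  obtain A B where A: "\<And>t. \<bar>x t\<bar> \<le> A" and B: "\<And>t. \<bar>z t\<bar> \<le> B"
    using x(2) z(2) by (auto simp: bounded_iff)
  have step: "\<bar>x s - z s\<bar> \<le> exp (- real k) * \<bar>x (s - real k * T) - z (s - real k * T)\<bar>" for k
  proof (induction k)
    case (Suc k)
    let ?d = "\<bar>x (s - real (Suc k) * T) - z (s - real (Suc k) * T)\<bar>"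
    have "\<bar>x s - z s\<bar> \<le> exp (- real k) * \<bar>x (s - real k * T) - z (s - real k * T)\<bar>"
      by (rule Suc.IH)
    also have "\<dots> \<le> exp (- real k) * (exp (- 1) * ?d)"
      using dec[of k] by (intro mult_left_mono) auto
    also have "\<dots> = exp (- real (Suc k)) * ?d"
      using exp_add[of "- 1" "- real k"] by (simp add: mult.commute mult.left_commute)
    finally show ?case .
  qed simp
  have "\<bar>x s - z s\<bar> \<le> exp (- real k) * (A + B)" for k
  proof -
    have "\<bar>x (s - real k * T) - z (s - real k * T)\<bar> \<le> A + B"
      using A[of "s - real k * T"] B[of "s - real k * T"] by linarith
    then have "exp (- real k) * \<bar>x (s - real k * T) - z (s - real k * T)\<bar> \<le> exp (- real k) * (A + B)"
      by (intro mult_left_mono) auto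
    then show ?thesis using step[of k] by linarith
  qed
  moreover have "filterlim (\<lambda>k. - real k) at_bot sequentially"
    by (rule filterlim_uminus_at_top[THEN iffD1, OF filterlim_real_sequentially])
  then have "(\<lambda>k. exp (- real k)) \<longlonglongrightarrow> 0" by (rule filterlim_compose[OF exp_at_bot])
  then have "(\<lambda>k. exp (- real k) * (A + B)) \<longlonglongrightarrow> 0" by (rule tendsto_mult_left_zero)
  ultimately have "\<bar>x s - z s\<bar> \<le> 0"
    using LIMSEQ_le_const by blast
  then show ?thesis using solution_unique[OF x(1) z(1), of s] by simp
qed

end

context forced
begin

text \<open>By the mean value theorem the logarithmic derivative of \<open>z - x\<close> is
  \<open>- f' (\<xi> t)\<close> for an intermediate point. The point \<open>\<xi> t\<close> is
  chosen separately for each time and enters only through bounds on \<open>f'\<close>.\<close>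

lemma log_difference:
  assumes x: "entire_solution y f x" and z: "entire_solution y f z" and less: "x s < z s"
  obtains \<xi> where "\<And>t. x t < \<xi> t" "\<And>t. \<xi> t < z t"
    "\<And>t. ((\<lambda>t. ln (z t - x t)) has_real_derivative - f' (\<xi> t)) (at t)"
proof -
  have lt: "x t < z t" for t using solution_less[OF x z less] .
  have "\<exists>\<xi>. x t < \<xi> \<and> \<xi> < z t \<and> f (z t) - f (x t) = (z t - x t) * f' \<xi>" for t
    using MVT2[OF lt[of t], of f f'] f_der by blast
  then obtain \<xi> where \<xi>: "\<And>t. x t < \<xi> t \<and> \<xi> t < z t \<and> f (z t) - f (x t) = (z t - x t) * f' (\<xi> t)"
    by metis
  have "((\<lambda>t. ln (z t - x t)) has_real_derivative - f' (\<xi> t)) (at t)" for t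
  proof -
    have "((\<lambda>t. z t - x t) has_real_derivative (y t - f (z t)) - (y t - f (x t))) (at t)"
      by (intro DERIV_diff entire_solutionD x z)
    then have "((\<lambda>t. ln (z t - x t)) has_real_derivative
        (1 / (z t - x t)) * ((y t - f (z t)) - (y t - f (x t)))) (at t)"
      using lt[of t] by (intro DERIV_chain2[OF DERIV_ln_divide]) auto
    moreover have "(1 / (z t - x t)) * ((y t - f (z t)) - (y t - f (x t))) = - f' (\<xi> t)"
    proof -
      have "(y t - f (z t)) - (y t - f (x t)) = - ((z t - x t) * f' (\<xi> t))" using \<xi>[of t] by argo
      then show ?thesis using lt[of t] by (simp only:) simp
    qed
    ultimately show ?thesis by simp
  qed
  with \<xi> that show ?thesis by blast
qed

text \<open>A drop of the logarithm of the difference by 1 is a factor \<open>exp (- 1)\<close>;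
  coinciding solutions, which have no logarithm, are settled by uniqueness.\<close>

lemma abs_contraction:
  assumes x: "entire_solution y f x" and z: "entire_solution y f z"
    and log: "\<And>\<Phi> \<xi>. (\<And>t. (\<Phi> has_real_derivative - f' (\<xi> t)) (at t)) \<Longrightarrow>
      (\<And>t. min (x t) (z t) \<le> \<xi> t \<and> \<xi> t \<le> max (x t) (z t)) \<Longrightarrow> \<Phi> s' - \<Phi> s \<le> - 1"
  shows "\<bar>x s' - z s'\<bar> \<le> exp (- 1) * \<bar>x s - z s\<bar>"
proof -
  have main: "z s' - x s' \<le> exp (- 1) * (z s - x s) \<and> x s' < z s'"
    if x: "entire_solution y f x" and z: "entire_solution y f z" and less: "x s < z s"
      and log: "\<And>\<Phi> \<xi>. (\<And>t. (\<Phi> has_real_derivative - f' (\<xi> t)) (at t)) \<Longrightarrow>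
        (\<And>t. x t \<le> \<xi> t \<and> \<xi> t \<le> z t) \<Longrightarrow> \<Phi> s' - \<Phi> s \<le> - 1" for x z
  proof -
    obtain \<xi> where \<xi>: "\<And>t. x t < \<xi> t" "\<And>t. \<xi> t < z t"
      "\<And>t. ((\<lambda>t. ln (z t - x t)) has_real_derivative - f' (\<xi> t)) (at t)"
      using log_difference[OF x z less] by blast
    have pos: "z t - x t > 0" for t using \<xi>(1,2)[of t] by linarith
    have "ln (z s' - x s') - ln (z s - x s) \<le> - 1"
      by (rule log[OF \<xi>(3)]) (simp add: less_imp_le \<xi>(1,2))
    then have "exp (ln (z s' - x s')) \<le> exp (ln (z s - x s) - 1)" by simp
    then have "z s' - x s' \<le> (z s - x s) * exp (- 1)"
      using pos[of s] pos[of s'] by (simp add: exp_diff exp_minus divide_inverse)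
    then show ?thesis using pos[of s'] by (simp add: mult.commute)
  qed
  consider "x s < z s" | "x s = z s" | "z s < x s" by linarith
  then show ?thesis
  proof cases
    case 1
    then have "x t \<le> z t" for t using solution_order[OF x z] by (meson less_imp_le)
    then have "min (x t) (z t) = x t" "max (x t) (z t) = z t" for t by simp_all
    then have "z s' - x s' \<le> exp (- 1) * (z s - x s) \<and> x s' < z s'"
      by (intro main[OF x z 1] log) simp_all
    then show ?thesis using 1 by simp
  next
    case 2
    then have "x = z" using solution_unique[OF x z] by blast
    then show ?thesis by simp
  next
    case 3
    then have "z t \<le> x t" for t using solution_order[OF z x] by (meson less_imp_le)
    then have "min (x t) (z t) = z t" "max (x t) (z t) = x t" for t by simp_all
    then have "x s' - z s' \<le> exp (- 1) * (x s - z s) \<and> z s' < x s'"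
      by (intro main[OF z x 3] log) simp_all
    then show ?thesis using 3 by simp
  qed
qed

end

text \<open>In the following three notions \<open>\<Phi>\<close> is either the logarithm of the difference of two solutions or
  the exponent of the linearization along one of them (then \<open>\<xi>\<close> is that solution), so that one
  estimate yields both convergence and hyperbolicity.\<close>

definition contracts_below where
  "contracts_below y f f' s T v \<longleftrightarrow> (\<forall>z \<Phi> \<xi>. entire_solution y f z \<longrightarrow> z s \<le> v \<longrightarrow>
     (\<forall>t. (\<Phi> has_real_derivative - f' (\<xi> t :: real)) (at t)) \<longrightarrow> (\<forall>t. \<xi> t \<le> z t) \<longrightarrow>
     \<Phi> (s + T) - \<Phi> s \<le> - (1 :: real))"

definition contracts_above where
  "contracts_above y f f' s T v \<longleftrightarrow> (\<forall>z \<Phi> \<xi>. entire_solution y f z \<longrightarrow> v \<le> z s \<longrightarrow>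
     (\<forall>t. (\<Phi> has_real_derivative - f' (\<xi> t :: real)) (at t)) \<longrightarrow> (\<forall>t. z t \<le> \<xi> t) \<longrightarrow>
     \<Phi> (s + T) - \<Phi> s \<le> - (1 :: real))"

definition expands_between where
  "expands_between y f f' s T lo hi \<longleftrightarrow> (\<forall>x z \<Phi> \<xi>. entire_solution y f x \<longrightarrow> entire_solution y f z \<longrightarrow>
     (\<forall>t\<in>{s..s + T}. lo \<le> x t \<and> z t \<le> hi) \<longrightarrow>
     (\<forall>t. (\<Phi> has_real_derivative - f' (\<xi> t :: real)) (at t)) \<longrightarrow> (\<forall>t. x t \<le> \<xi> t \<and> \<xi> t \<le> z t) \<longrightarrow>
     \<Phi> (s + T) - \<Phi> s \<ge> (1 :: real))"

lemma entire_solution_unmirror: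
  assumes "entire_solution (\<lambda>t. - y t) (\<lambda>x. - f (- x)) z"
  shows "entire_solution y f (\<lambda>t. - z t)"
  unfolding entire_solution_def
proof
  fix t show "((\<lambda>t. - z t) has_real_derivative y t - f (- z t)) (at t)"
    using DERIV_minus[OF entire_solutionD[OF assms, of t]] by simp
qed

lemma contracts_below_mirror:
  assumes "contracts_above y f f' s T v"
  shows "contracts_below (\<lambda>t. - y t) (\<lambda>x. - f (- x)) (\<lambda>x. f' (- x)) s T (- v)"
  unfolding contracts_below_def
proof (intro allI impI)
  fix z \<Phi> \<xi>
  assume z: "entire_solution (\<lambda>t. - y t) (\<lambda>x. - f (- x)) z" "z s \<le> - v"
    and \<Phi>: "\<forall>t. (\<Phi> has_real_derivative - f' (- \<xi> t)) (at t)" and \<xi>: "\<forall>t. \<xi> t \<le> z t"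
  show "\<Phi> (s + T) - \<Phi> s \<le> - 1"
    by (rule assms[unfolded contracts_above_def, THEN spec[of _ "\<lambda>t. - z t"], THEN spec[of _ \<Phi>],
        THEN spec[of _ "\<lambda>t. - \<xi> t"], THEN mp, THEN mp, THEN mp, THEN mp, OF entire_solution_unmirror[OF z(1)]])
       (use z(2) \<Phi> \<xi> in auto)
qed

lemma contracts_above_mirror:
  assumes "contracts_below y f f' s T v"
  shows "contracts_above (\<lambda>t. - y t) (\<lambda>x. - f (- x)) (\<lambda>x. f' (- x)) s T (- v)"
  unfolding contracts_above_def
proof (intro allI impI)
  fix z \<Phi> \<xi>
  assume z: "entire_solution (\<lambda>t. - y t) (\<lambda>x. - f (- x)) z" "- v \<le> z s"
    and \<Phi>: "\<forall>t. (\<Phi> has_real_derivative - f' (- \<xi> t)) (at t)" and \<xi>: "\<forall>t. z t \<le> \<xi> t"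
  show "\<Phi> (s + T) - \<Phi> s \<le> - 1"
    by (rule assms[unfolded contracts_below_def, THEN spec[of _ "\<lambda>t. - z t"], THEN spec[of _ \<Phi>],
        THEN spec[of _ "\<lambda>t. - \<xi> t"], THEN mp, THEN mp, THEN mp, THEN mp, OF entire_solution_unmirror[OF z(1)]])
       (use z(2) \<Phi> \<xi> in auto)
qed

lemma expands_between_mirror:
  assumes "expands_between y f f' s T lo hi"
  shows "expands_between (\<lambda>t. - y t) (\<lambda>x. - f (- x)) (\<lambda>x. f' (- x)) s T (- hi) (- lo)"
  unfolding expands_between_def
proof (intro allI impI)
  fix x z \<Phi> \<xi>
  assume x: "entire_solution (\<lambda>t. - y t) (\<lambda>x. - f (- x)) x"
    and z: "entire_solution (\<lambda>t. - y t) (\<lambda>x. - f (- x)) z"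
    and xz: "\<forall>t\<in>{s..s + T}. - hi \<le> x t \<and> z t \<le> - lo"
    and \<Phi>: "\<forall>t. (\<Phi> has_real_derivative - f' (- \<xi> t)) (at t)" and \<xi>: "\<forall>t. x t \<le> \<xi> t \<and> \<xi> t \<le> z t"
  show "\<Phi> (s + T) - \<Phi> s \<ge> 1"
    by (rule assms[unfolded expands_between_def, THEN spec[of _ "\<lambda>t. - z t"], THEN spec[of _ "\<lambda>t. - x t"],
        THEN spec[of _ \<Phi>], THEN spec[of _ "\<lambda>t. - \<xi> t"], THEN mp, THEN mp, THEN mp, THEN mp, THEN mp,
        OF entire_solution_unmirror[OF z] entire_solution_unmirror[OF x]])
       (use xz \<Phi> \<xi> in force)+
qed

text \<open>Collects what the estimates supply for small parameters, so that the argument about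
  periodic orbits is free of constants. The reflection exchanges sections after maxima with sections
  after minima; stating the expansion for both makes the locale invariant under it.\<close>

locale bistable = narrow_window +
  assumes \<delta>_small: "2 * \<delta> < q - p"
    and contract_left: "\<And>n. contracts_below y f f' (c + of_int n * T + t1) T p"
    and contract_right: "\<And>n. contracts_above y f f' (c + T / 2 + of_int n * T + t1) T q"
    and expand: "\<And>n. expands_between y f f' (c + of_int n * T + t1) T (p - \<delta>) (q + \<delta>)"
    and expand': "\<And>n. expands_between y f f' (c + T / 2 + of_int n * T + t1) T (p - \<delta>) (q + \<delta>)"
begin

lemma bistable_mirror: "bistable (\<lambda>x. - f (- x)) (\<lambda>x. f' (- x)) (- q) (- p) (- qh) (- ph) L K
    (\<lambda>t. - y t) (c + T / 2) \<epsilon> e"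
proof -
  interpret mir: narrow_window "\<lambda>x. - f (- x)" "\<lambda>x. f' (- x)" "- q" "- p" "- qh" "- ph" L K
    "\<lambda>t. - y t" "c + T / 2" \<epsilon> e by (rule narrow_mirror)
  have eq: "c + T / 2 + T / 2 + of_int n * T + t1 = c + of_int (n + 1) * T + t1" for n
    by (simp add: algebra_simps)
  have bounds: "- (q + \<delta>) = - q - \<delta>" "- (p - \<delta>) = - p + \<delta>" by simp_all
  show ?thesis
  proof
    show "2 * mir.\<delta> < - p - (- q)" unfolding \<delta>_mirror using \<delta>_small by linarith
    fix n
    show "contracts_below (\<lambda>t. - y t) (\<lambda>x. - f (- x)) (\<lambda>x. f' (- x)) (c + T / 2 + of_int n * T + mir.t1) T (- q)"
      unfolding t1_mirror by (rule contracts_below_mirror[OF contract_right])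
    show "contracts_above (\<lambda>t. - y t) (\<lambda>x. - f (- x)) (\<lambda>x. f' (- x)) (c + T / 2 + T / 2 + of_int n * T + mir.t1) T (- p)"
      unfolding t1_mirror eq by (rule contracts_above_mirror[OF contract_left])
    show "expands_between (\<lambda>t. - y t) (\<lambda>x. - f (- x)) (\<lambda>x. f' (- x)) (c + T / 2 + of_int n * T + mir.t1) T
        (- q - mir.\<delta>) (- p + mir.\<delta>)"
      unfolding t1_mirror \<delta>_mirror bounds[symmetric] by (rule expands_between_mirror[OF expand'])
    show "expands_between (\<lambda>t. - y t) (\<lambda>x. - f (- x)) (\<lambda>x. f' (- x)) (c + T / 2 + T / 2 + of_int n * T + mir.t1) T
        (- q - mir.\<delta>) (- p + mir.\<delta>)"
      using expands_between_mirror[OF expand[of "n + 1"]] unfolding t1_mirror \<delta>_mirror eq bounds .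
  qed
qed

text \<open>The section times at which the forcing has just left the window around a maximum (\<open>sec\<close>) or a
  minimum (\<open>sec'\<close>).\<close>

definition sec :: "int \<Rightarrow> real" where "sec n = c + of_int n * T + t1"
definition sec' :: "int \<Rightarrow> real" where "sec' n = c + T / 2 + of_int n * T + t1"

lemma contract_sec:
  assumes "entire_solution y f z" "z (sec n) \<le> p"
    and "\<And>t. (\<Phi> has_real_derivative - f' (\<xi> t)) (at t)" "\<And>t. \<xi> t \<le> z t"
  shows "\<Phi> (sec n + T) - \<Phi> (sec n) \<le> - 1"
  using contract_left[of n] assms unfolding contracts_below_def sec_def by metis

lemma expand_sec:
  assumes "entire_solution y f x" "entire_solution y f z"
    and "\<And>t. sec n \<le> t \<Longrightarrow> t \<le> sec n + T \<Longrightarrow> p - \<delta> \<le> x t"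
    and "\<And>t. sec n \<le> t \<Longrightarrow> t \<le> sec n + T \<Longrightarrow> z t \<le> q + \<delta>"
    and "\<And>t. (\<Phi> has_real_derivative - f' (\<xi> t)) (at t)" "\<And>t. x t \<le> \<xi> t \<and> \<xi> t \<le> z t"
  shows "\<Phi> (sec n + T) - \<Phi> (sec n) \<ge> 1"
  using expand[of n, unfolded expands_between_def sec_def[symmetric], rule_format, of x z \<Phi> \<xi>] assms by simp

lemma sec_Suc: "sec (n + 1) = sec n + T" and sec'_Suc: "sec' (n + 1) = sec' n + T"
  by (simp_all add: sec_def sec'_def algebra_simps)

lemma sec_add: "sec (n + k) = sec n + of_int k * T"
  by (simp add: sec_def algebra_simps)

lemma sec_step:
  assumes x: "entire_solution y f x" and lo: "x (sec n) \<le> p"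
  shows "sec n \<le> t \<Longrightarrow> t \<le> sec n + T \<Longrightarrow> x t \<le> p + \<delta>" and "x (sec n + T) \<le> p"
proof -
  interpret sh: narrow_window f f' p q ph qh L K y "c + of_int n * T" \<epsilon> e by (rule narrow_shift)
  show "sec n \<le> t \<Longrightarrow> t \<le> sec n + T \<Longrightarrow> x t \<le> p + \<delta>" and "x (sec n + T) \<le> p"
    using sh.section_step[OF x] lo unfolding sec_def by (simp_all add: add.commute add.left_commute)
qed

lemma sec_before:
  assumes x: "entire_solution y f x" and "x (sec n + T) \<ge> p" "sec n \<le> t" "t \<le> sec n + T"
  shows "x t \<ge> p - \<delta>"
proof -
  interpret sh: narrow_window f f' p q ph qh L K y "c + of_int n * T" \<epsilon> e by (rule narrow_shift)
  show ?thesis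
    using sh.above_before_section[OF x, of t] assms(2-) unfolding sec_def by (simp add: add.commute add.left_commute)
qed

lemma sec'_mirror: "bistable.sec (\<lambda>x. - f (- x)) (- q) (- p) (c + T / 2) \<epsilon> e = sec'"
proof -
  interpret mir: bistable "\<lambda>x. - f (- x)" "\<lambda>x. f' (- x)" "- q" "- p" "- qh" "- ph" L K
    "\<lambda>t. - y t" "c + T / 2" \<epsilon> e by (rule bistable_mirror)
  show ?thesis by (rule ext) (simp only: mir.sec_def sec'_def t1_mirror)
qed

lemma sec'_step:
  assumes x: "entire_solution y f x" and hi: "x (sec' n) \<ge> q"
  shows "sec' n \<le> t \<Longrightarrow> t \<le> sec' n + T \<Longrightarrow> x t \<ge> q - \<delta>" and "x (sec' n + T) \<ge> q"
proof -
  interpret mir: bistable "\<lambda>x. - f (- x)" "\<lambda>x. f' (- x)" "- q" "- p" "- qh" "- ph" L K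
    "\<lambda>t. - y t" "c + T / 2" \<epsilon> e by (rule bistable_mirror)
  show "sec' n \<le> t \<Longrightarrow> t \<le> sec' n + T \<Longrightarrow> x t \<ge> q - \<delta>" and "x (sec' n + T) \<ge> q"
    using mir.sec_step(1)[OF solution_mirror[OF x], unfolded sec'_mirror \<delta>_mirror, of n t]
      mir.sec_step(2)[OF solution_mirror[OF x], unfolded sec'_mirror, of n] hi by simp_all
qed

lemma sec'_before:
  assumes x: "entire_solution y f x" and "x (sec' n + T) \<le> q" "sec' n \<le> t" "t \<le> sec' n + T"
  shows "x t \<le> q + \<delta>"
proof -
  interpret mir: bistable "\<lambda>x. - f (- x)" "\<lambda>x. f' (- x)" "- q" "- p" "- qh" "- ph" L K
    "\<lambda>t. - y t" "c + T / 2" \<epsilon> e by (rule bistable_mirror)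
  show ?thesis
    using mir.sec_before[OF solution_mirror[OF x], unfolded sec'_mirror \<delta>_mirror, of n t] assms(2-) by simp
qed

lemma low_forever: "entire_solution y f x \<Longrightarrow> x (sec n) \<le> p \<Longrightarrow> x (sec (n + int k)) \<le> p"
proof (induction k)
  case (Suc k)
  then show ?case using sec_step(2)[OF Suc.prems(1), of "n + int k"] sec_Suc[of "n + int k"]
    by (simp add: algebra_simps)
qed simp

end

context S_shape
begin

lemma f_unbounded_below: "\<exists>v<p. f v \<le> Y"
proof -
  obtain c0 where c0: "c0 > 0" "\<And>x. x \<le> p - 1 \<Longrightarrow> f' x \<ge> c0" using left_branch[of 1] by auto
  define v where "v = p - 1 - \<bar>f (p - 1) - Y\<bar> / c0"
  have v: "v \<le> p - 1" using c0 by (simp add: v_def)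
  have "- f (p - 1) - - f v \<le> - c0 * (p - 1 - v)"
    by (rule increment_le[OF v, where \<Phi>' = "\<lambda>x. - f' x"]) (use c0 f_der in \<open>auto intro!: DERIV_minus\<close>)
  moreover have "c0 * (p - 1 - v) = \<bar>f (p - 1) - Y\<bar>" using c0 by (simp add: v_def)
  ultimately have "f v \<le> Y" by linarith
  with v show ?thesis by (intro exI[of _ v]) auto
qed

lemma f_unbounded_above: "\<exists>v>q. f v \<ge> Y"
proof -
  interpret mir: S_shape "\<lambda>x. - f (- x)" "\<lambda>x. f' (- x)" "- q" "- p" "- qh" "- ph" L K by (rule mirror)
  obtain v where "v < - q" "- f (- v) \<le> - Y" using mir.f_unbounded_below by blast
  then show ?thesis by (intro exI[of _ "- v"]) auto
qed

end

context bistable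
begin

lemma difference_contracts:
  assumes x: "entire_solution y f x" and z: "entire_solution y f z"
    and lo: "x (sec n) \<le> p" "z (sec n) \<le> p"
  shows "\<bar>x (sec n + T) - z (sec n + T)\<bar> \<le> exp (- 1) * \<bar>x (sec n) - z (sec n)\<bar>"
proof (rule abs_contraction[OF x z])
  fix \<Phi> \<xi>
  assume \<Phi>: "\<And>t. (\<Phi> has_real_derivative - f' (\<xi> t)) (at t)"
    and \<xi>: "\<And>t. min (x t) (z t) \<le> \<xi> t \<and> \<xi> t \<le> max (x t) (z t)"
  show "\<Phi> (sec n + T) - \<Phi> (sec n) \<le> - 1"
  proof (cases "x (sec n) \<le> z (sec n)")
    case True
    then have "x t \<le> z t" for t by (rule solution_order[OF x z])
    then show ?thesis using contract_sec[OF z lo(2) \<Phi>] \<xi> by (simp add: max_absorb2)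
  next
    case False
    then have "z t \<le> x t" for t using solution_order[OF z x, of "sec n" t] by simp
    then show ?thesis using contract_sec[OF x lo(1) \<Phi>] \<xi> by (simp add: max_absorb1)
  qed
qed

lemma low_solutions_converge:
  assumes x: "entire_solution y f x" and z: "entire_solution y f z"
    and lo: "x (sec n) \<le> p" "z (sec n) \<le> p"
  shows "((\<lambda>t. x t - z t) \<longlongrightarrow> 0) at_top"
proof (rule decay_of_section_decay[OF x z T_pos, where s = "sec n"])
  fix k :: nat
  have e1: "sec n + real k * T = sec (n + int k)" "sec n + real (Suc k) * T = sec (n + int k) + T"
    by (simp_all add: sec_def algebra_simps)
  show "\<bar>x (sec n + real (Suc k) * T) - z (sec n + real (Suc k) * T)\<bar>
      \<le> exp (- 1) * \<bar>x (sec n + real k * T) - z (sec n + real k * T)\<bar>"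
    unfolding e1 using low_forever[OF x lo(1), of k] low_forever[OF z lo(2), of k]
    by (rule difference_contracts[OF x z])
qed

text \<open>Between the folds differences grow, so a solution below the middle one eventually drops below
  the fold \<open>p\<close> at the section times.\<close>

lemma below_middle_becomes_low:
  assumes m: "entire_solution y f m" "\<And>t. p - \<delta> \<le> m t \<and> m t \<le> q + \<delta>"
    and x: "entire_solution y f x" "x s < m s"
  shows "\<exists>n. x (sec n) \<le> p"
proof (rule ccontr)
  assume "\<nexists>n. x (sec n) \<le> p"
  then have high: "x (sec n) > p" for n by (meson not_le)
  obtain \<xi> where \<xi>: "\<And>t. x t < \<xi> t" "\<And>t. \<xi> t < m t"
    "\<And>t. ((\<lambda>t. ln (m t - x t)) has_real_derivative - f' (\<xi> t)) (at t)"
    using log_difference[OF x(1) m(1) x(2)] by blast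
  have pos: "m t - x t > 0" for t using \<xi>[of t] by linarith
  have lower: "x t \<ge> p - \<delta>" if "sec n \<le> t" "t \<le> sec n + T" for n t
    using sec_before[OF x(1) _ that] high[of "n + 1"] by (simp add: sec_Suc)
  have step: "ln (m (sec n + T) - x (sec n + T)) \<ge> ln (m (sec n) - x (sec n)) + 1" for n
    using expand_sec[OF x(1) m(1) lower[of n] _ \<xi>(3)] m(2) less_imp_le[OF \<xi>(1)] less_imp_le[OF \<xi>(2)]
    by force
  have grow: "ln (m (sec (int k)) - x (sec (int k))) \<ge> ln (m (sec 0) - x (sec 0)) + real k" for k
  proof (induction k)
    case (Suc k)
    have "sec (int (Suc k)) = sec (int k) + T" using sec_Suc[of "int k"] by (simp add: add.commute)
    then show ?case using step[of "int k"] Suc.IH by simp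
  qed simp
  have upper: "ln (m (sec n) - x (sec n)) \<le> ln (q - p + 2 * \<delta>)" for n
    using pos[of "sec n"] lower[of n "sec n"] m(2)[of "sec n"] T_pos by (intro ln_mono) auto
  obtain k :: nat where "real k > ln (q - p + 2 * \<delta>) - ln (m (sec 0) - x (sec 0))"
    using reals_Archimedean2 by blast
  then show False using grow[of k] upper[of "int k"] by linarith
qed

lemma low_bounded_unique:
  assumes x: "entire_solution y f x" "bounded (range x)" "\<And>n. x (sec n) \<le> p"
    and z: "entire_solution y f z" "bounded (range z)" "\<And>n. z (sec n) \<le> p"
  shows "x = z"
proof (rule bounded_eq_of_contraction[OF x(1,2) z(1,2), of "sec 0" T])
  fix k :: nat
  have "sec 0 - real k * T = sec (- int (Suc k)) + T" "sec 0 - real (Suc k) * T = sec (- int (Suc k))"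
    by (simp_all add: sec_def algebra_simps)
  then show "\<bar>x (sec 0 - real k * T) - z (sec 0 - real k * T)\<bar>
      \<le> exp (- 1) * \<bar>x (sec 0 - real (Suc k) * T) - z (sec 0 - real (Suc k) * T)\<bar>"
    using difference_contracts[OF x(1) z(1) x(3) z(3), of "- int (Suc k)"] by simp
qed

text \<open>Lying below \<open>p\<close> at a section persists forward in time, so a solution at or
  above \<open>p\<close> at \<open>sec n\<close> was so at all earlier sections. It therefore spent
  its whole past in the middle strip, where each period adds at least 1 to
  \<open>\<Phi>\<close>.\<close>

lemma not_low_expands_backward:
  assumes m: "entire_solution y f m" "\<And>t. p - \<delta> \<le> m t \<and> m t \<le> q + \<delta>"
    and b: "entire_solution y f b" "\<And>t. b t \<le> m t" and n: "b (sec n) \<ge> p"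
    and \<Phi>: "\<And>t. (\<Phi> has_real_derivative - f' (b t)) (at t)"
  shows "\<Phi> (sec n) \<ge> \<Phi> (sec n - real k * T) + real k"
proof (induction k)
  case (Suc k)
  define s where "s = sec (n - int (Suc k))"
  have s: "s = sec n - real (Suc k) * T" "s + T = sec n - real k * T" "s + T = sec (n - int k)"
    by (simp_all add: s_def sec_def algebra_simps)
  have "b (sec (n - int k)) \<ge> p"
  proof (rule ccontr)
    assume "\<not> b (sec (n - int k)) \<ge> p"
    then have less: "b (sec (n - int k)) < p" by simp
    \<comment> \<open>Comparison with the solution through \<open>p\<close> gives the strict
      inequality that contradicts \<open>n\<close>.\<close>
    obtain w where w: "entire_solution y f w" "w (sec (n - int k)) = p" using exists_solution by blast
    have "b (sec n) < w (sec n)" using solution_less[OF b(1) w(1)] less w(2) by metis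
    moreover have "w (sec n) \<le> p" using low_forever[OF w(1), of "n - int k" k] w(2) by simp
    ultimately show False using n by simp
  qed
  then have "b t \<ge> p - \<delta>" if "s \<le> t" "t \<le> s + T" for t
    using sec_before[OF b(1), of "n - int (Suc k)" t] that s unfolding s_def by simp
  moreover have "b t \<le> q + \<delta>" for t using b(2)[of t] m(2)[of t] by linarith
  ultimately have "\<Phi> (s + T) - \<Phi> s \<ge> 1"
    using expand_sec[OF b(1) b(1) _ _ \<Phi>, of "n - int (Suc k)"] unfolding s_def by blast
  then show ?case using Suc.IH unfolding s(2) s(1)[symmetric] by simp
qed simp

text \<open>All that concerns the region below \<open>m\<close>; the region above comes from the
  reflected system. The last conclusion also covers \<open>b = m\<close>: backward growth of
  \<open>\<Phi>\<close> is what later rules out any further attractive solution.\<close>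

theorem lower_half:
  assumes m: "entire_solution y f m" "\<And>t. p - \<delta> \<le> m t \<and> m t \<le> q + \<delta>" "\<And>n. m (sec n) \<ge> p"
  obtains l where "entire_solution y f l" "\<And>t. l (t + T) = l t" "\<And>t. l t < m t" "\<And>t. l t \<le> p + \<delta>"
    "\<And>\<Phi> t. (\<And>t. (\<Phi> has_real_derivative - f' (l t)) (at t)) \<Longrightarrow> \<exists>s. \<Phi> (s + T) - \<Phi> s \<le> - 1"
    "\<And>x s. entire_solution y f x \<Longrightarrow> x s < m s \<Longrightarrow> ((\<lambda>t. l t - x t) \<longlongrightarrow> 0) at_top"
    "\<And>b s \<Phi>. entire_solution y f b \<Longrightarrow> bounded (range b) \<Longrightarrow> b \<noteq> l \<Longrightarrow> (\<And>t. b t \<le> m t) \<Longrightarrow>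
      (\<And>t. (\<Phi> has_real_derivative - f' (b t)) (at t)) \<Longrightarrow> \<exists>s. \<forall>k::nat. \<Phi> s \<ge> \<Phi> (s - real k * T) + real k"
proof -
  obtain v where v: "v < p" "f v \<le> f q - e" using f_unbounded_below by blast
  obtain l where l: "entire_solution y f l" "\<And>t. l (t + T) = l t" "l (sec 0) \<le> p"
  proof (rule exists_periodic[of T v p "sec 0"])
    show "(\<forall>x. entire_solution y f x \<and> x (sec 0) = v \<longrightarrow> v \<le> x (sec 0 + T)) \<and>
      (\<forall>x. entire_solution y f x \<and> x (sec 0) = p \<longrightarrow> x (sec 0 + T) \<le> p) \<or>
      (\<forall>x. entire_solution y f x \<and> x (sec 0) = v \<longrightarrow> x (sec 0 + T) \<le> v) \<and>
      (\<forall>x. entire_solution y f x \<and> x (sec 0) = p \<longrightarrow> p \<le> x (sec 0 + T))"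
    proof (intro disjI1 conjI allI impI; elim conjE)
      fix x assume x: "entire_solution y f x" "x (sec 0) = v"
      show "v \<le> x (sec 0 + T)"
      proof (rule constant_lower_barrier[OF x(1), where a = "sec 0"])
        show "f v \<le> y t" for t using v(2) y_ge_min[of t] by linarith
      qed (use x(2) T_pos in auto)
    next
      fix x assume "entire_solution y f x" "x (sec 0) = p"
      then show "x (sec 0 + T) \<le> p" using sec_step(2)[of x 0] by simp
    qed
  qed (use y_periodic v in auto)
  have l_per: "l (sec n) = l (sec 0)" for n
    using periodic_int[of l T "sec 0" n, OF l(2)] sec_add[of 0 n] by simp
  have l_low: "l (sec n) \<le> p" for n using l(3) l_per[of n] by linarith
  have l_bd: "bounded (range l)"
    by (rule periodic_bounded[OF l(2) T_pos entire_solution_continuous[OF l(1)]])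
  have l_bound: "l t \<le> p + \<delta>" for t
  proof -
    obtain k where k: "sec 0 \<le> t + of_int k * T" "t + of_int k * T < sec 0 + T"
      using periodic_representative[OF T_pos] by blast
    then show ?thesis
      using sec_step(1)[OF l(1), of 0 "t + of_int k * T"] l(3) periodic_int[of l T t k, OF l(2)] by simp
  qed
  have l_avg: "\<Phi> (sec 0 + T) - \<Phi> (sec 0) \<le> - 1"
    if "\<And>t. (\<Phi> has_real_derivative - f' (l t)) (at t)" for \<Phi>
    by (rule contract_sec[OF l(1) l(3) that order_refl])
  have l_less: "l t < m t" for t
  proof (rule ccontr)
    assume "\<not> l t < m t"
    moreover have "\<not> m t < l t"
      using solution_less[OF m(1) l(1), of t "sec 0"] l(3) m(3)[of 0] by auto
    \<comment> \<open>Equality is impossible, since over one period \<open>\<Phi>\<close> would both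
      fall by at least 1 and rise by at least 1.\<close>
    ultimately have "l = m" using solution_unique[OF l(1) m(1), of t] by simp
    have "continuous_on UNIV (\<lambda>t. - f' (l t))"
      by (intro continuous_intros continuous_on_compose2[OF f'_cont] entire_solution_continuous[OF l(1)]) auto
    then obtain \<Phi> where \<Phi>: "\<And>t. (\<Phi> has_real_derivative - f' (l t)) (at t)"
      using continuous_antiderivative by metis
    have "\<Phi> (sec 0 + T) - \<Phi> (sec 0) \<ge> 1"
      by (rule expand_sec[OF m(1) m(1) _ _ \<Phi>]) (use m \<open>l = m\<close> in auto)
    with l_avg[OF \<Phi>] show False by simp
  qed
  show ?thesis
  proof (rule that[of l])
    show "\<exists>s. \<Phi> (s + T) - \<Phi> s \<le> - 1"
      if "\<And>t. (\<Phi> has_real_derivative - f' (l t)) (at t)" for \<Phi>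
      using l_avg[OF that] by blast
  next
    fix x s assume x: "entire_solution y f x" "x s < m s"
    obtain n where "x (sec n) \<le> p" using below_middle_becomes_low[OF m(1,2) x] by blast
    then show "((\<lambda>t. l t - x t) \<longlongrightarrow> 0) at_top"
      using low_solutions_converge[OF l(1) x(1) l_low] by blast
  next
    fix b \<Phi> assume b: "entire_solution y f b" "bounded (range b)" "b \<noteq> l" "\<And>t. b t \<le> m t"
      and \<Phi>: "\<And>t. (\<Phi> has_real_derivative - f' (b t)) (at t)"
    obtain n where "b (sec n) > p"
      using low_bounded_unique[OF b(1,2) _ l(1) l_bd l_low] b(3) by (meson not_le)
    then show "\<exists>s. \<forall>k::nat. \<Phi> s \<ge> \<Phi> (s - real k * T) + real k"
      using not_low_expands_backward[OF m(1,2) b(1,4) _ \<Phi>, of n] by (intro exI[of _ "sec n"]) auto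
  qed (use l l_less l_bound in auto)
qed

end

context bistable
begin

theorem three_solutions:
  obtains l m u where "entire_solution y f l" "entire_solution y f m" "entire_solution y f u"
    "\<And>t. l (t + T) = l t" "\<And>t. m (t + T) = m t" "\<And>t. u (t + T) = u t"
    "\<And>t. l t < m t" "\<And>t. m t < u t"
    "\<And>t. l t \<le> p + \<delta>" "\<And>t. p - \<delta> \<le> m t \<and> m t \<le> q + \<delta>" "\<And>t. u t \<ge> q - \<delta>"
    "\<And>\<Phi>. (\<And>t. (\<Phi> has_real_derivative - f' (l t)) (at t)) \<Longrightarrow> \<exists>s. \<Phi> (s + T) - \<Phi> s \<le> - 1"
    "\<And>\<Phi>. (\<And>t. (\<Phi> has_real_derivative - f' (m t)) (at t)) \<Longrightarrow> \<exists>s. \<Phi> (s + T) - \<Phi> s \<ge> 1"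
    "\<And>\<Phi>. (\<And>t. (\<Phi> has_real_derivative - f' (u t)) (at t)) \<Longrightarrow> \<exists>s. \<Phi> (s + T) - \<Phi> s \<le> - 1"
    "\<And>x s. entire_solution y f x \<Longrightarrow> x s < m s \<Longrightarrow> ((\<lambda>t. l t - x t) \<longlongrightarrow> 0) at_top"
    "\<And>x s. entire_solution y f x \<Longrightarrow> m s < x s \<Longrightarrow> ((\<lambda>t. u t - x t) \<longlongrightarrow> 0) at_top"
    "\<And>b \<Phi>. entire_solution y f b \<Longrightarrow> bounded (range b) \<Longrightarrow> b \<noteq> l \<Longrightarrow> b \<noteq> u \<Longrightarrow>
      (\<And>t. (\<Phi> has_real_derivative - f' (b t)) (at t)) \<Longrightarrow> \<exists>s. \<forall>k::nat. \<Phi> s \<ge> \<Phi> (s - real k * T) + real k"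
proof -
  interpret mir: bistable "\<lambda>x. - f (- x)" "\<lambda>x. f' (- x)" "- q" "- p" "- qh" "- ph" L K
    "\<lambda>t. - y t" "c + T / 2" \<epsilon> e by (rule bistable_mirror)
  \<comment> \<open>The barrier \<open>p\<close> works at sections after maxima, \<open>q\<close> at
    sections after minima, half a period apart. The solution \<open>h\<close> carries
    \<open>q\<close> to the other kind of section: it does not decrease under a shift by
    \<open>T\<close>, so at \<open>sec 0\<close> its value can serve as the upper end of an interval
    on which the time-\<open>T\<close> map points outward.\<close>
  obtain h where h: "entire_solution y f h" "h (sec' (- 1)) = q" using exists_solution by blast
  have s'0: "sec' (- 1) + T = sec' 0" using sec'_Suc[of "- 1"] by simp
  have in0: "sec' (- 1) \<le> sec 0" "sec 0 \<le> sec' (- 1) + T"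
    using T_pos by (simp_all add: sec_def sec'_def)
  have h_ge: "h (sec 0) \<ge> q - \<delta>" using sec'_step(1)[OF h(1), of "- 1"] h(2) in0 by simp
  have h_up: "h (t + T) \<ge> h t" for t
  proof (rule ccontr)
    assume "\<not> h (t + T) \<ge> h t"
    then have "h (sec' (- 1) + T) < h (sec' (- 1))"
      using solution_less[OF entire_solution_shift[OF h(1) y_periodic] h(1), of t "sec' (- 1)"] by simp
    then show False using sec'_step(2)[OF h(1), of "- 1"] h(2) by simp
  qed
  obtain m where m: "entire_solution y f m" "\<And>t. m (t + T) = m t" "p \<le> m (sec 0)" "m (sec 0) \<le> h (sec 0)"
  proof (rule exists_periodic[of T p "h (sec 0)" "sec 0"])
    show "p \<le> h (sec 0)" using h_ge \<delta>_small \<delta>_pos by linarith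
    show "(\<forall>x. entire_solution y f x \<and> x (sec 0) = p \<longrightarrow> p \<le> x (sec 0 + T)) \<and>
      (\<forall>x. entire_solution y f x \<and> x (sec 0) = h (sec 0) \<longrightarrow> x (sec 0 + T) \<le> h (sec 0)) \<or>
      (\<forall>x. entire_solution y f x \<and> x (sec 0) = p \<longrightarrow> x (sec 0 + T) \<le> p) \<and>
      (\<forall>x. entire_solution y f x \<and> x (sec 0) = h (sec 0) \<longrightarrow> h (sec 0) \<le> x (sec 0 + T))"
    proof (intro disjI2 conjI allI impI; elim conjE)
      fix x assume "entire_solution y f x" "x (sec 0) = p"
      then show "x (sec 0 + T) \<le> p" using sec_step(2)[of x 0] by simp
    next
      fix x assume x: "entire_solution y f x" "x (sec 0) = h (sec 0)"
      then have "x = h" using solution_unique[OF x(1) h(1)] by blast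
      then show "h (sec 0) \<le> x (sec 0 + T)" using h_up by simp
    qed
  qed (use y_periodic in auto)
  have m_sec: "m (sec n) \<ge> p" for n
    using periodic_int[of m T "sec 0" n, OF m(2)] sec_add[of 0 n] m(3) by simp
  \<comment> \<open>Order preservation backward in time turns the bound by \<open>h\<close> at
    \<open>sec 0\<close> into the bound by \<open>q\<close> at a section after a minimum.\<close>
  have "m (sec' (- 1)) \<le> h (sec' (- 1))"
    using solution_less[OF h(1) m(1), of "sec' (- 1)" "sec 0"] m(4) by (meson not_le)
  then have m_sec': "m (sec' n) \<le> q" for n
    using periodic_int[of m T "sec' (- 1)" "n + 1", OF m(2)] h(2) by (simp add: sec'_def algebra_simps)
  have m_bounds: "p - \<delta> \<le> m t \<and> m t \<le> q + \<delta>" for t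
  proof
    obtain k where k: "sec 0 \<le> t + of_int k * T" "t + of_int k * T < sec 0 + T"
      using periodic_representative[OF T_pos] by blast
    then show "p - \<delta> \<le> m t"
      using sec_before[OF m(1), of 0 "t + of_int k * T"] m_sec[of 1] sec_Suc[of 0]
        periodic_int[of m T t k, OF m(2)] by simp
    obtain k where k: "sec' 0 \<le> t + of_int k * T" "t + of_int k * T < sec' 0 + T"
      using periodic_representative[OF T_pos] by blast
    then show "m t \<le> q + \<delta>"
      using sec'_before[OF m(1), of 0 "t + of_int k * T"] m_sec'[of 1] sec'_Suc[of 0]
        periodic_int[of m T t k, OF m(2)] by simp
  qed
  have m_avg: "\<exists>s. \<Phi> (s + T) - \<Phi> s \<ge> 1" if "\<And>t. (\<Phi> has_real_derivative - f' (m t)) (at t)" for \<Phi>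
    using expand_sec[OF m(1) m(1) _ _ that, of 0] m_bounds by blast
  obtain l where l: "entire_solution y f l" "\<And>t. l (t + T) = l t" "\<And>t. l t < m t" "\<And>t. l t \<le> p + \<delta>"
    and l_avg: "\<And>\<Phi> t. (\<And>t. (\<Phi> has_real_derivative - f' (l t)) (at t)) \<Longrightarrow> \<exists>s. \<Phi> (s + T) - \<Phi> s \<le> - 1"
    and l_attr: "\<And>x s. entire_solution y f x \<Longrightarrow> x s < m s \<Longrightarrow> ((\<lambda>t. l t - x t) \<longlongrightarrow> 0) at_top"
    and l_exp: "\<And>b s \<Phi>. entire_solution y f b \<Longrightarrow> bounded (range b) \<Longrightarrow> b \<noteq> l \<Longrightarrow> (\<And>t. b t \<le> m t) \<Longrightarrow>
      (\<And>t. (\<Phi> has_real_derivative - f' (b t)) (at t)) \<Longrightarrow> \<exists>s. \<forall>k::nat. \<Phi> s \<ge> \<Phi> (s - real k * T) + real k"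
    using lower_half[OF m(1) m_bounds m_sec] by blast
  have mm: "- q - \<delta> \<le> - m t \<and> - m t \<le> - p + \<delta>" for t using m_bounds[of t] by simp
  obtain u' where u': "entire_solution (\<lambda>t. - y t) (\<lambda>x. - f (- x)) u'" "\<And>t. u' (t + T) = u' t"
      "\<And>t. u' t < - m t" "\<And>t. u' t \<le> - q + \<delta>"
    and u_avg: "\<And>\<Phi> t. (\<And>t. (\<Phi> has_real_derivative - f' (- u' t)) (at t)) \<Longrightarrow> \<exists>s. \<Phi> (s + T) - \<Phi> s \<le> - 1"
    and u_attr: "\<And>x s. entire_solution (\<lambda>t. - y t) (\<lambda>x. - f (- x)) x \<Longrightarrow> x s < - m s \<Longrightarrow>
      ((\<lambda>t. u' t - x t) \<longlongrightarrow> 0) at_top"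
    and u_exp: "\<And>b s \<Phi>. entire_solution (\<lambda>t. - y t) (\<lambda>x. - f (- x)) b \<Longrightarrow> bounded (range b) \<Longrightarrow> b \<noteq> u' \<Longrightarrow>
      (\<And>t. b t \<le> - m t) \<Longrightarrow>
      (\<And>t. (\<Phi> has_real_derivative - f' (- b t)) (at t)) \<Longrightarrow> \<exists>s. \<forall>k::nat. \<Phi> s \<ge> \<Phi> (s - real k * T) + real k"
    by (rule mir.lower_half[OF solution_mirror[OF m(1)]])
       (use mm m_sec' in \<open>simp_all add: sec'_mirror \<delta>_mirror\<close>)
  define u where "u t = - u' t" for t
  show ?thesis
  proof (rule that[of l m u])
    show "entire_solution y f u" unfolding u_def by (rule entire_solution_unmirror[OF u'(1)])
    show "u (t + T) = u t" "m t < u t" "u t \<ge> q - \<delta>" for t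
      using u'(2-4)[of t] by (simp_all add: u_def)
    show "\<exists>s. \<Phi> (s + T) - \<Phi> s \<le> - 1" if "\<And>t. (\<Phi> has_real_derivative - f' (u t)) (at t)" for \<Phi>
      using u_avg[of \<Phi>] that by (simp add: u_def)
    show "((\<lambda>t. u t - x t) \<longlongrightarrow> 0) at_top" if "entire_solution y f x" "m s < x s" for x s
    proof -
      have "((\<lambda>t. u' t - - x t) \<longlongrightarrow> 0) at_top"
        by (rule u_attr[OF solution_mirror[OF that(1)]]) (use that(2) in simp)
      from tendsto_minus[OF this] show ?thesis by (simp add: u_def)
    qed
    fix b \<Phi>
    assume b: "entire_solution y f b" "bounded (range b)" "b \<noteq> l" "b \<noteq> u"
      and \<Phi>: "\<And>t. (\<Phi> has_real_derivative - f' (b t)) (at t)"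
    show "\<exists>s. \<forall>k::nat. \<Phi> s \<ge> \<Phi> (s - real k * T) + real k"
    proof (cases "b 0 \<le> m 0")
      case True
      have "b t \<le> m t" for t
        using solution_less[OF m(1) b(1), of t 0] True by (meson not_le)
      then show ?thesis using l_exp[OF b(1-3) _ \<Phi>] by blast
    next
      case False
      have le: "- b t \<le> - m t" for t
        using solution_less[OF b(1) m(1), of t 0] False by force
      have "(\<lambda>t. - b t) \<noteq> u'"
      proof
        assume "(\<lambda>t. - b t) = u'"
        then have "b = u" by (auto simp: u_def)
        with b(4) show False ..
      qed
      moreover have "bounded (range (\<lambda>t. - b t))" using b(2) by (auto simp: bounded_iff)
      ultimately show ?thesis
        using u_exp[OF solution_mirror[OF b(1)] _ _ le, of \<Phi>] \<Phi> by simp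
    qed
  qed (use l l_avg l_attr m m_bounds m_avg in auto)
qed

end

section \<open>Thresholds for bistability that depend only on the field\<close>

context S_shape
begin

lemma f_near_p: "\<bar>u - p\<bar> \<le> d / L \<Longrightarrow> f u \<ge> f p - d"
proof -
  assume "\<bar>u - p\<bar> \<le> d / L"
  then have "L * \<bar>u - p\<bar> \<le> d" using L by (simp add: pos_le_divide_eq mult.commute)
  then show ?thesis using f_lip[of u p] by linarith
qed

lemma f_near_q: "\<bar>u - q\<bar> \<le> d / L \<Longrightarrow> f u \<le> f q + d"
proof -
  assume "\<bar>u - q\<bar> \<le> d / L"
  then have "L * \<bar>u - q\<bar> \<le> d" using L by (simp add: pos_le_divide_eq mult.commute)
  then show ?thesis using f_lip[of u q] by linarith
qed

text \<open>The thresholds are chosen before the forcing, so that they hold uniformly as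
  \<open>\<epsilon>\<close> tends to 0.\<close>

lemma contracts_below_window:
  "\<exists>\<delta>0>0. \<exists>T0>0. \<forall>y c \<epsilon> e. narrow_window f f' p q ph qh L K y c \<epsilon> e \<longrightarrow>
     narrow_window.\<delta> f p q \<epsilon> e \<le> \<delta>0 \<longrightarrow> forced.T \<epsilon> \<ge> T0 \<longrightarrow>
     (\<forall>n. contracts_below y f f' (c + of_int n * forced.T \<epsilon> + narrow_window.t1 f p q \<epsilon> e) (forced.T \<epsilon>) p)"
proof -
  \<comment> \<open>A quarter of the gap: within distance \<open>D / L\<close> of \<open>p\<close>
    the field is still at least \<open>D\<close> above the mean of the fold values.\<close>
  define D where "D = (f p - f q) / 4"
  have D: "D > 0" using fq_less_fp by (simp add: D_def)
  obtain c0 where c0: "c0 > 0" "\<And>u. u \<le> p - D / L \<Longrightarrow> f' u \<ge> c0"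
    using left_branch[of "D / L"] D L by auto
  define \<delta>0 where "\<delta>0 = min (D / L) (c0 / (8 * K))"
  \<comment> \<open>The first entry turns \<open>- c0 * T / 8\<close> into at most -1; the second
    lets a quarter period at speed \<open>D\<close> cross the width
    \<open>2 * D / L\<close>.\<close>
  define T0 where "T0 = max (8 / c0) (8 / L)"
  have "\<delta>0 > 0" using D L c0 K by (simp add: \<delta>0_def)
  moreover have "T0 > 0" using c0 by (simp add: T0_def less_max_iff_disj)
  moreover have "contracts_below y f f' (c + of_int n * forced.T \<epsilon> + narrow_window.t1 f p q \<epsilon> e) (forced.T \<epsilon>) p"
    if nw: "narrow_window f f' p q ph qh L K y c \<epsilon> e"
      and \<delta>: "narrow_window.\<delta> f p q \<epsilon> e \<le> \<delta>0" and T: "forced.T \<epsilon> \<ge> T0" for y c \<epsilon> e n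
  proof -
    interpret w0: narrow_window f f' p q ph qh L K y c \<epsilon> e by (rule nw)
    interpret w: narrow_window f f' p q ph qh L K y "c + of_int n * w0.T" \<epsilon> e by (rule w0.narrow_shift)
    have \<delta>': "w.\<delta> \<le> D / L" "w.\<delta> \<le> c0 / (8 * K)" using \<delta> by (simp_all add: \<delta>0_def)
    have T': "w.T \<ge> 8 / c0" "w.T \<ge> 8 / L" using T by (simp_all add: T0_def)
    have K\<delta>: "K * w.\<delta> \<le> c0 / 8" using \<delta>'(2) K by (simp add: pos_le_divide_eq mult.commute mult.left_commute)
    have "D * (w.T / 4) \<ge> D * (2 / L)" using T'(2) D by (intro mult_left_mono) auto
    then have DT: "p + w.\<delta> - (p - D / L) \<le> D * (w.T / 4)" using \<delta>'(1) by simp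
    have cT: "c0 * w.T \<ge> 8" using T'(1) c0 by (simp add: pos_divide_le_eq mult.commute)
    show ?thesis
      unfolding contracts_below_def
    proof (intro allI impI)
      fix z \<Phi> \<xi>
      assume z: "entire_solution y f z" "z (c + of_int n * w.T + w.t1) \<le> p"
        and \<Phi>: "\<forall>t. (\<Phi> has_real_derivative - f' (\<xi> t)) (at t)" and \<xi>: "\<forall>t. \<xi> t \<le> z t"
      have "\<Phi> (c + of_int n * w.T + w.T + w.t1) - \<Phi> (c + of_int n * w.T + w.t1) \<le> - c0 * w.T / 8"
      proof (rule w.contraction_left[where pl = "p - D / L" and \<eta> = D and z = z and \<xi> = \<xi>])
        show "(f p + f q) / 2 + D \<le> f u" if "p - D / L \<le> u" "u \<le> p + w.\<delta>" for u
        proof -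
          have "f u \<ge> f p - D" using that \<delta>' by (intro f_near_p) auto
          then show ?thesis unfolding D_def by argo
        qed
      qed (use D L c0 K\<delta> DT z \<Phi> \<xi> in auto)
      moreover have "c + of_int n * w.T + w.T + w.t1 = c + of_int n * w.T + w.t1 + w.T" by simp
      ultimately show "\<Phi> (c + of_int n * w.T + w.t1 + w.T) - \<Phi> (c + of_int n * w.T + w.t1) \<le> - 1"
        using cT by simp
    qed
  qed
  ultimately show ?thesis by blast
qed

lemma expands_between_window:
  "\<exists>\<delta>0>0. \<exists>T0>0. \<forall>y c \<epsilon> e. narrow_window f f' p q ph qh L K y c \<epsilon> e \<longrightarrow> e \<le> (f p - f q) / 4 \<longrightarrow>
     narrow_window.\<delta> f p q \<epsilon> e \<le> \<delta>0 \<longrightarrow> forced.T \<epsilon> \<ge> T0 \<longrightarrow>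
     (\<forall>n. expands_between y f f' (c + of_int n * forced.T \<epsilon> + narrow_window.t1 f p q \<epsilon> e) (forced.T \<epsilon>)
        (p - narrow_window.\<delta> f p q \<epsilon> e) (q + narrow_window.\<delta> f p q \<epsilon> e))"
proof -
  \<comment> \<open>Near \<open>p\<close> the field exceeds the mean by 7/16 of the gap: 3/8 to
    match the forcing in \<open>y_between\<close> and 1/16 as speed.\<close>
  define D where "D = (f p - f q) / 16"
  have D: "D > 0" using fq_less_fp by (simp add: D_def)
  define p' q' where "p' = p + D / L" and "q' = q - D / L"
  have pq': "p < p'" "q' < q" using D L by (simp_all add: p'_def q'_def)
  obtain c0 where c0: "c0 > 0" "\<And>u. p' \<le> u \<Longrightarrow> u \<le> q' \<Longrightarrow> f' u \<le> - c0"
  proof (cases "p' \<le> q'")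
    case True
    obtain v where v: "v \<in> {p'..q'}" "\<forall>u\<in>{p'..q'}. f' u \<le> f' v"
      using continuous_attains_sup[of "{p'..q'}" f'] True f'_cont by auto
    then have "f' v < 0" using middle_branch[of v] pq' by auto
    with v show ?thesis by (intro that[of "- f' v"]) auto
  next
    case False
    then show ?thesis by (intro that[of 1]) auto
  qed
  define \<delta>0 where "\<delta>0 = min (D / L) (c0 / (24 * K))"
  \<comment> \<open>Ensures \<open>c0 * T / 24 \<ge> 1\<close>, and that a time
    \<open>T / 12\<close> at speed \<open>D\<close> covers \<open>3 * D / L\<close>, more than the
    widths \<open>2 * D / L\<close> to be crossed.\<close>
  define T0 where "T0 = max (24 / c0) (36 / L)"
  have "\<delta>0 > 0" using D L c0 K by (simp add: \<delta>0_def)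
  moreover have "T0 > 0" using c0 by (simp add: T0_def less_max_iff_disj)
  moreover have "expands_between y f f' (c + of_int n * forced.T \<epsilon> + narrow_window.t1 f p q \<epsilon> e) (forced.T \<epsilon>)
        (p - narrow_window.\<delta> f p q \<epsilon> e) (q + narrow_window.\<delta> f p q \<epsilon> e)"
    if nw: "narrow_window f f' p q ph qh L K y c \<epsilon> e" and e: "e \<le> (f p - f q) / 4"
      and \<delta>: "narrow_window.\<delta> f p q \<epsilon> e \<le> \<delta>0" and T: "forced.T \<epsilon> \<ge> T0" for y c \<epsilon> e n
  proof -
    interpret w0: narrow_window f f' p q ph qh L K y c \<epsilon> e by (rule nw)
    interpret w: narrow_window f f' p q ph qh L K y "c + of_int n * w0.T" \<epsilon> e by (rule w0.narrow_shift)
    have \<delta>': "w.\<delta> \<le> D / L" "w.\<delta> \<le> c0 / (24 * K)" using \<delta> by (simp_all add: \<delta>0_def)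
    have T': "w.T \<ge> 24 / c0" "w.T \<ge> 36 / L" using T by (simp_all add: T0_def)
    have K\<delta>: "K * w.\<delta> \<le> c0 / 24" using \<delta>'(2) K by (simp add: pos_le_divide_eq mult.commute mult.left_commute)
    have "D * (w.T / 12) \<ge> D * (3 / L)" using T'(2) D by (intro mult_left_mono) auto
    moreover have "D / L > 0" using D L by simp
    ultimately have DT: "p' - (p - w.\<delta>) < (f p - f q) / 16 * (w.T / 12)" "q + w.\<delta> - q' < (f p - f q) / 16 * (w.T / 12)"
      using \<delta>'(1) unfolding D_def[symmetric] p'_def q'_def by simp_all
    have cT: "c0 * w.T \<ge> 24" using T'(1) c0 by (simp add: pos_divide_le_eq mult.commute)
    show ?thesis
      unfolding expands_between_def
    proof (intro allI impI)
      fix x z \<Phi> \<xi>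
      assume x: "entire_solution y f x" and z: "entire_solution y f z"
        and xz: "\<forall>t\<in>{c + of_int n * w.T + w.t1..c + of_int n * w.T + w.t1 + w.T}. p - w.\<delta> \<le> x t \<and> z t \<le> q + w.\<delta>"
        and \<Phi>: "\<forall>t. (\<Phi> has_real_derivative - f' (\<xi> t)) (at t)" and \<xi>: "\<forall>t. x t \<le> \<xi> t \<and> \<xi> t \<le> z t"
      have "\<Phi> (c + of_int n * w.T + w.T + w.t1) - \<Phi> (c + of_int n * w.T + w.t1) \<ge> c0 * w.T / 24"
      proof (rule w.expansion_middle[where p' = p' and q' = q' and x = x and z = z and \<xi> = \<xi>])
        show "(f p + f q) / 2 + 7 / 16 * (f p - f q) \<le> f u" if "p - w.\<delta> \<le> u" "u \<le> p'" for u
        proof -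
          have "f u \<ge> f p - D" using that \<delta>' unfolding p'_def by (intro f_near_p) auto
          then show ?thesis unfolding D_def by argo
        qed
        show "f u \<le> (f p + f q) / 2 - 7 / 16 * (f p - f q)" if "q' \<le> u" "u \<le> q + w.\<delta>" for u
        proof -
          have "f u \<le> f q + D" using that \<delta>' unfolding q'_def by (intro f_near_q) auto
          then show ?thesis unfolding D_def by argo
        qed
      qed (use pq' c0 K\<delta> DT e x z xz \<Phi> \<xi> in auto)
      moreover have "c + of_int n * w.T + w.T + w.t1 = c + of_int n * w.T + w.t1 + w.T" by simp
      ultimately show "\<Phi> (c + of_int n * w.T + w.t1 + w.T) - \<Phi> (c + of_int n * w.T + w.t1) \<ge> 1"
        using cT by simp
    qed
  qed
  ultimately show ?thesis by blast
qed

lemma bistable_window: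
  "\<exists>\<delta>0>0. \<exists>T0>0. \<forall>y c \<epsilon> e. narrow_window f f' p q ph qh L K y c \<epsilon> e \<longrightarrow> e \<le> (f p - f q) / 4 \<longrightarrow>
     narrow_window.\<delta> f p q \<epsilon> e \<le> \<delta>0 \<longrightarrow> forced.T \<epsilon> \<ge> T0 \<longrightarrow> bistable f f' p q ph qh L K y c \<epsilon> e"
proof -
  interpret mir: S_shape "\<lambda>x. - f (- x)" "\<lambda>x. f' (- x)" "- q" "- p" "- qh" "- ph" L K by (rule mirror)
  obtain \<delta>1 T1 where 1: "\<delta>1 > 0" "T1 > 0" "\<And>y c \<epsilon> e n. narrow_window f f' p q ph qh L K y c \<epsilon> e \<Longrightarrow>
     narrow_window.\<delta> f p q \<epsilon> e \<le> \<delta>1 \<Longrightarrow> forced.T \<epsilon> \<ge> T1 \<Longrightarrow>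
     contracts_below y f f' (c + of_int n * forced.T \<epsilon> + narrow_window.t1 f p q \<epsilon> e) (forced.T \<epsilon>) p"
    using contracts_below_window by blast
  obtain \<delta>2 T2 where 2: "\<delta>2 > 0" "T2 > 0" "\<And>y c \<epsilon> e n.
     narrow_window (\<lambda>x. - f (- x)) (\<lambda>x. f' (- x)) (- q) (- p) (- qh) (- ph) L K y c \<epsilon> e \<Longrightarrow>
     narrow_window.\<delta> (\<lambda>x. - f (- x)) (- q) (- p) \<epsilon> e \<le> \<delta>2 \<Longrightarrow> forced.T \<epsilon> \<ge> T2 \<Longrightarrow>
     contracts_below y (\<lambda>x. - f (- x)) (\<lambda>x. f' (- x))
       (c + of_int n * forced.T \<epsilon> + narrow_window.t1 (\<lambda>x. - f (- x)) (- q) (- p) \<epsilon> e) (forced.T \<epsilon>) (- q)"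
    using mir.contracts_below_window by blast
  obtain \<delta>3 T3 where 3: "\<delta>3 > 0" "T3 > 0" "\<And>y c \<epsilon> e n. narrow_window f f' p q ph qh L K y c \<epsilon> e \<Longrightarrow>
     e \<le> (f p - f q) / 4 \<Longrightarrow> narrow_window.\<delta> f p q \<epsilon> e \<le> \<delta>3 \<Longrightarrow> forced.T \<epsilon> \<ge> T3 \<Longrightarrow>
     expands_between y f f' (c + of_int n * forced.T \<epsilon> + narrow_window.t1 f p q \<epsilon> e) (forced.T \<epsilon>)
       (p - narrow_window.\<delta> f p q \<epsilon> e) (q + narrow_window.\<delta> f p q \<epsilon> e)"
    using expands_between_window by blast
  obtain \<delta>4 T4 where 4: "\<delta>4 > 0" "T4 > 0" "\<And>y c \<epsilon> e n.
     narrow_window (\<lambda>x. - f (- x)) (\<lambda>x. f' (- x)) (- q) (- p) (- qh) (- ph) L K y c \<epsilon> e \<Longrightarrow>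
     e \<le> (- f (- (- q)) - (- f (- (- p)))) / 4 \<Longrightarrow>
     narrow_window.\<delta> (\<lambda>x. - f (- x)) (- q) (- p) \<epsilon> e \<le> \<delta>4 \<Longrightarrow> forced.T \<epsilon> \<ge> T4 \<Longrightarrow>
     expands_between y (\<lambda>x. - f (- x)) (\<lambda>x. f' (- x))
       (c + of_int n * forced.T \<epsilon> + narrow_window.t1 (\<lambda>x. - f (- x)) (- q) (- p) \<epsilon> e) (forced.T \<epsilon>)
       (- q - narrow_window.\<delta> (\<lambda>x. - f (- x)) (- q) (- p) \<epsilon> e)
       (- p + narrow_window.\<delta> (\<lambda>x. - f (- x)) (- q) (- p) \<epsilon> e)"
    using mir.expands_between_window by blast
  define \<delta>0 where "\<delta>0 = min (min \<delta>1 \<delta>2) (min (min \<delta>3 \<delta>4) ((q - p) / 4))"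
  define T0 where "T0 = max (max T1 T2) (max T3 T4)"
  have "bistable f f' p q ph qh L K y c \<epsilon> e"
    if nw: "narrow_window f f' p q ph qh L K y c \<epsilon> e" and e: "e \<le> (f p - f q) / 4"
      and \<delta>: "narrow_window.\<delta> f p q \<epsilon> e \<le> \<delta>0" and T: "forced.T \<epsilon> \<ge> T0" for y c \<epsilon> e
  proof -
    interpret w: narrow_window f f' p q ph qh L K y c \<epsilon> e by (rule nw)
    have d: "w.\<delta> \<le> \<delta>1" "w.\<delta> \<le> \<delta>2" "w.\<delta> \<le> \<delta>3" "w.\<delta> \<le> \<delta>4" "w.\<delta> \<le> (q - p) / 4"
      using \<delta> by (simp_all add: \<delta>0_def)
    have t: "T1 \<le> w.T" "T2 \<le> w.T" "T3 \<le> w.T" "T4 \<le> w.T" using T by (simp_all add: T0_def)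
    have e': "e \<le> (- f (- (- q)) - (- f (- (- p)))) / 4" using e by simp
    show ?thesis
    proof
      show "2 * w.\<delta> < q - p" using d(5) p_less_q by simp
      fix n
      show "contracts_below y f f' (c + of_int n * w.T + w.t1) w.T p" by (rule 1(3)[OF nw d(1) t(1)])
      show "expands_between y f f' (c + of_int n * w.T + w.t1) w.T (p - w.\<delta>) (q + w.\<delta>)"
        by (rule 3(3)[OF nw e d(3) t(3)])
      show "contracts_above y f f' (c + w.T / 2 + of_int n * w.T + w.t1) w.T q"
        using contracts_above_mirror[OF 2(3)[OF w.narrow_mirror, unfolded w.\<delta>_mirror w.t1_mirror, OF d(2) t(2), of n]]
        by simp
      show "expands_between y f f' (c + w.T / 2 + of_int n * w.T + w.t1) w.T (p - w.\<delta>) (q + w.\<delta>)"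
        using expands_between_mirror[OF 4(3)[OF w.narrow_mirror e', unfolded w.\<delta>_mirror w.t1_mirror, OF d(4) t(4), of n]]
        by (simp add: add.commute)
    qed
  qed
  moreover have "\<delta>0 > 0" "T0 > 0" using 1 2 3 4 p_less_q by (simp_all add: \<delta>0_def T0_def less_max_iff_disj)
  ultimately show ?thesis by blast
qed

end

section \<open>Fast passage through the folds\<close>

context forced
begin

text \<open>Within \<open>hw\<close> of its maximum the forcing exceeds the fold value by at least \<open>e / 2\<close>;
  beyond \<open>4 * hw\<close> it is below the fold value.\<close>

definition hw :: real where "hw = sqrt (e / (f p - f q)) / \<epsilon>"

lemma hw_pos: "hw > 0" unfolding hw_def using e \<epsilon> fq_less_fp by simp

lemma hw_sq: "(f p - f q) * \<epsilon>\<^sup>2 * hw\<^sup>2 = e"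
  unfolding hw_def using e \<epsilon> fq_less_fp by (simp add: power_divide)

lemma hw_mirror: "forced.hw (\<lambda>x. - f (- x)) (- q) (- p) \<epsilon> e = hw"
proof -
  interpret mir: forced "\<lambda>x. - f (- x)" "\<lambda>x. f' (- x)" "- q" "- p" "- qh" "- ph" L K
    "\<lambda>t. - y t" "c + T / 2" \<epsilon> e by (rule forced_mirror)
  show ?thesis by (simp add: mir.hw_def hw_def)
qed

lemma y_above_fold:
  assumes e: "e \<le> (f p - f q) / 2" and t: "\<bar>t - c\<bar> \<le> hw"
  shows "y t \<ge> f p + e / 2"
proof -
  have "(t - c)\<^sup>2 \<le> hw\<^sup>2" using t hw_pos by (metis abs_le_square_iff abs_of_pos)
  moreover have "(f p - f q) / 2 + e \<le> f p - f q" using e by argo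
  ultimately have "((f p - f q) / 2 + e) * \<epsilon>\<^sup>2 * (t - c)\<^sup>2 \<le> (f p - f q) * \<epsilon>\<^sup>2 * hw\<^sup>2"
    using fq_less_fp by (intro mult_mono) auto
  then show ?thesis using y_ge_near[of t] hw_sq by linarith
qed

lemma y_below_fold:
  assumes "c + 4 * hw \<le> t" "t \<le> c + T - 4 * hw"
  shows "y t \<le> f p"
proof (rule y_le_fold[of "4 * hw"])
  have "Q * \<epsilon>\<^sup>2 * (4 * hw)\<^sup>2 = (f p - f q) * \<epsilon>\<^sup>2 * hw\<^sup>2" by (simp add: Q_def power_mult_distrib)
  then show "e \<le> Q * \<epsilon>\<^sup>2 * (4 * hw)\<^sup>2" using hw_sq by simp
qed (use assms hw_pos in auto)

text \<open>The reflected form of \<open>y_below_fold\<close>; the shift by minus one period places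
  the reflected maximum at \<open>c - T / 2\<close>.\<close>

lemma y_above_lower_fold:
  assumes "c - T / 2 + 4 * hw \<le> t" "t \<le> c + T / 2 - 4 * hw"
  shows "y t \<ge> f q"
proof -
  interpret sh: forced f f' p q ph qh L K y "c + of_int (- 1) * T" \<epsilon> e by (rule forced_shift)
  interpret mir: forced "\<lambda>x. - f (- x)" "\<lambda>x. f' (- x)" "- q" "- p" "- qh" "- ph" L K
    "\<lambda>t. - y t" "c + of_int (- 1) * T + T / 2" \<epsilon> e by (rule sh.forced_mirror)
  have "- y t \<le> - f (- (- q))"
    by (rule mir.y_below_fold[unfolded hw_mirror]) (use assms in auto)
  then show ?thesis by simp
qed

text \<open>While the forcing exceeds the fold value, \<open>arctan ((x - p) / \<omega>)\<close> grows at rate at least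
  \<open>\<kappa> * \<omega>\<close>, so the passage takes a time of order \<open>e powr (- 1 / 2)\<close> at most.\<close>

lemma jump_up:
  assumes e: "e \<le> (f p - f q) / 2" and x: "entire_solution y f x"
    and \<kappa>: "\<kappa> > 0" "\<And>u. a \<le> u \<Longrightarrow> u \<le> v \<Longrightarrow> f p - f u \<ge> \<kappa> * (u - p)\<^sup>2" and av: "a \<le> v"
    and xa: "\<And>t. \<bar>t - c\<bar> \<le> hw \<Longrightarrow> a \<le> x t"
    and fast: "8 * (f p - f q) * \<epsilon>\<^sup>2 \<le> \<kappa> * e\<^sup>2"
  shows "x (c + hw) \<ge> v"
proof (rule ccontr)
  assume "\<not> v \<le> x (c + hw)"
  then have end_less: "x (c + hw) < v" by simp
  have fv: "f v \<le> f p" using \<kappa>(2)[OF av order_refl] \<kappa>(1) by (smt (verit) mult_nonneg_nonneg zero_le_power2)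
  \<comment> \<open>Within the window \<open>v\<close> cannot be crossed downwards, as
    \<open>f v \<le> f p\<close> lies below the forcing. Missing \<open>v\<close> at the end
    therefore means missing it throughout, so that the fold estimate is available at all times of
    the window.\<close>
  have less: "x t < v" if t: "c - hw \<le> t" "t \<le> c + hw" for t
  proof (rule ccontr)
    assume "\<not> x t < v"
    then have "x (c + hw) \<ge> v"
    proof (intro constant_lower_barrier[OF x t(2)])
      fix s assume "t \<le> s" "s \<le> c + hw"
      then show "f v \<le> y s" using y_above_fold[OF e, of s] t fv forced.e[OF forced_axioms] by (simp add: abs_le_iff)
    qed auto
    with end_less show False by simp
  qed
  \<comment> \<open>The scale on which excess and parabola balance:
    \<open>e / 2 + \<kappa> * (x - p)\<^sup>2\<close> becomes
    \<open>\<kappa> * \<omega>\<^sup>2\<close> times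
    \<open>1 + ((x - p) / \<omega>)\<^sup>2\<close>, the denominator in the derivative of
    \<open>arctan\<close>.\<close>
  define \<omega> where "\<omega> = sqrt (e / (2 * \<kappa>))"
  have \<omega>: "\<omega> > 0" "\<kappa> * \<omega>\<^sup>2 = e / 2" using forced.e[OF forced_axioms] \<kappa>(1) by (simp_all add: \<omega>_def)
  define A' where "A' t = (y t - f (x t)) / \<omega> / (1 + ((x t - p) / \<omega>)\<^sup>2)" for t
  have A: "((\<lambda>t. - arctan ((x t - p) / \<omega>)) has_real_derivative - A' t) (at t)" for t
  proof -
    have "((\<lambda>t. (x t - p) / \<omega>) has_real_derivative (y t - f (x t)) / \<omega>) (at t)"
      by (intro DERIV_cdivide) (auto intro!: derivative_eq_intros entire_solutionD[OF x])
    from DERIV_chain2[OF DERIV_arctan this] show ?thesis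
      unfolding A'_def by (intro DERIV_minus) (simp add: divide_inverse mult.commute)
  qed
  have A'_ge: "- A' t \<le> - (\<kappa> * \<omega>)" if t: "c - hw \<le> t" "t \<le> c + hw" for t
  proof -
    have t': "\<bar>t - c\<bar> \<le> hw" using t by (simp add: abs_le_iff)
    have "y t - f (x t) \<ge> e / 2 + \<kappa> * (x t - p)\<^sup>2"
      using y_above_fold[OF e t'] \<kappa>(2)[OF xa[OF t'] less_imp_le[OF less[OF t]]] by linarith
    also have "e / 2 + \<kappa> * (x t - p)\<^sup>2 = \<kappa> * \<omega> * (1 + ((x t - p) / \<omega>)\<^sup>2) * \<omega>"
    proof -
      have "\<omega>\<^sup>2 * ((x t - p) / \<omega>)\<^sup>2 = (x t - p)\<^sup>2" using \<omega>(1) by (simp add: power_divide)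
      moreover have "\<kappa> * \<omega> * (1 + ((x t - p) / \<omega>)\<^sup>2) * \<omega> = \<kappa> * \<omega>\<^sup>2 + \<kappa> * (\<omega>\<^sup>2 * ((x t - p) / \<omega>)\<^sup>2)"
        by (simp add: power2_eq_square[of \<omega>] distrib_left distrib_right mult.assoc mult.left_commute mult.commute)
      ultimately show ?thesis using \<omega>(2) by simp
    qed
    finally have "\<kappa> * \<omega> * (1 + ((x t - p) / \<omega>)\<^sup>2) \<le> (y t - f (x t)) / \<omega>"
      using \<omega>(1) by (simp only: pos_le_divide_eq)
    moreover have "1 + ((x t - p) / \<omega>)\<^sup>2 > 0" by (simp add: add_pos_nonneg)
    ultimately have "\<kappa> * \<omega> \<le> A' t" unfolding A'_def by (simp only: pos_le_divide_eq)
    then show ?thesis by simp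
  qed
  have "- arctan ((x (c + hw) - p) / \<omega>) - - arctan ((x (c - hw) - p) / \<omega>) \<le> - (\<kappa> * \<omega>) * (c + hw - (c - hw))"
    by (rule increment_le[OF _ A A'_ge]) (use hw_pos in auto)
  then have "2 * (\<kappa> * \<omega> * hw) \<le> arctan ((x (c + hw) - p) / \<omega>) - arctan ((x (c - hw) - p) / \<omega>)" by simp
  also have "\<dots> < pi" using arctan_bounded[of "(x (c + hw) - p) / \<omega>"] arctan_bounded[of "(x (c - hw) - p) / \<omega>"] by linarith
  finally have "\<kappa> * \<omega> * hw < 2" using pi_less_4 by linarith
  moreover have "\<kappa> * \<omega> * hw \<ge> 0" using \<kappa> \<omega> hw_pos by simp
  ultimately have "(\<kappa> * \<omega> * hw)\<^sup>2 < 2\<^sup>2" by (intro power_strict_mono) auto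
  moreover have "(\<kappa> * \<omega> * hw)\<^sup>2 = \<kappa> * (\<kappa> * \<omega>\<^sup>2) * hw\<^sup>2"
    by (simp add: power2_eq_square mult.assoc mult.left_commute)
  ultimately have "\<kappa> * e * hw\<^sup>2 < 8" unfolding \<omega>(2) by simp
  \<comment> \<open>The gain of \<open>arctan\<close> over the window is less than pi, hence less
    than 4, which bounds \<open>\<kappa> * e * hw\<^sup>2\<close> by 8; by \<open>hw_sq\<close>, the
    hypothesis \<open>fast\<close> says the opposite.\<close>
  moreover have "8 \<le> \<kappa> * e * hw\<^sup>2"
  proof -
    have D: "(f p - f q) * \<epsilon>\<^sup>2 > 0" using fq_less_fp \<epsilon> by simp
    have "8 * ((f p - f q) * \<epsilon>\<^sup>2) \<le> \<kappa> * e * ((f p - f q) * \<epsilon>\<^sup>2 * hw\<^sup>2)"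
      using fast unfolding hw_sq by (simp only: power2_eq_square mult.assoc)
    also have "\<dots> = \<kappa> * e * hw\<^sup>2 * ((f p - f q) * \<epsilon>\<^sup>2)" by (simp only: mult.assoc mult.commute mult.left_commute)
    finally show ?thesis using D by (rule mult_right_le_imp_le)
  qed
  ultimately show False by simp
qed

lemma y_ge_mean:
  assumes "c - T / 4 \<le> t" "t \<le> c + T / 4"
  shows "y t \<ge> (f p + f q) / 2"
proof -
  have "\<epsilon> * (- (T / 4)) \<le> \<epsilon> * (t - c)" using assms \<epsilon> by (intro mult_left_mono) auto
  moreover have "\<epsilon> * (t - c) \<le> \<epsilon> * (T / 4)" using assms \<epsilon> by (intro mult_left_mono) auto
  ultimately have "cos (\<epsilon> * (t - c)) \<ge> 0" using \<epsilon>T by (intro cos_ge_zero) auto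
  then have "((f p - f q) / 2 + e) * cos (\<epsilon> * (t - c)) \<ge> 0"
    using amplitude_pos by (simp only: mult_nonneg_nonneg less_imp_le)
  then show ?thesis unfolding y by argo
qed

lemma above_until_next_fold:
  assumes x: "entire_solution y f x" and start: "x (c + hw) \<ge> q" and t: "c + hw \<le> t" "t \<le> c + T / 2 - 4 * hw"
  shows "x t \<ge> q"
proof (rule constant_lower_barrier[OF x t(1) start])
  fix s assume s: "c + hw \<le> s" "s \<le> t"
  show "f q \<le> y s" by (rule y_above_lower_fold) (use s t hw_pos in auto)
qed

text \<open>Up to \<open>c + T / 4\<close> the forcing is at least the mean, so the solution stays
  above \<open>v\<close> and the rate \<open>c0\<close> acts. Until \<open>4 * hw\<close> before the
  next minimum it stays above \<open>q\<close>, where \<open>f'\<close> is nonnegative. Only the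
  remaining \<open>5 * hw\<close> are charged with the global bound \<open>L\<close>.\<close>

lemma half_contraction:
  assumes x: "entire_solution y f x" and start: "x (c + hw) \<ge> v" and v: "v > q" "f v \<le> (f p + f q) / 2"
    and c0: "\<And>u. v \<le> u \<Longrightarrow> f' u \<ge> c0" and hw: "hw \<le> T / 16"
    and \<Phi>: "\<And>t. (\<Phi> has_real_derivative - f' (\<xi> t)) (at t)" and \<xi>: "\<And>t. x t \<le> \<xi> t"
  shows "\<Phi> (c + T / 2 + hw) - \<Phi> (c + hw) \<le> - c0 * (T / 4 - hw) + 5 * L * hw"
proof -
  note hp = hw_pos
  have "\<Phi> (c + T / 4) - \<Phi> (c + hw) \<le> - c0 * (c + T / 4 - (c + hw))"
  proof (rule increment_le[OF _ \<Phi>])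
    fix t assume t: "c + hw \<le> t" "t \<le> c + T / 4"
    have "x t \<ge> v"
    proof (rule constant_lower_barrier[OF x t(1) start])
      fix s assume "c + hw \<le> s" "s \<le> t"
      then show "f v \<le> y s" using y_ge_mean[of s] v(2) t hp hw by simp
    qed
    then show "- f' (\<xi> t) \<le> - c0" using c0[of "\<xi> t"] \<xi>[of t] by simp
  qed (use hp hw in auto)
  moreover have "\<Phi> (c + T / 2 - 4 * hw) - \<Phi> (c + T / 4) \<le> 0 * (c + T / 2 - 4 * hw - (c + T / 4))"
  proof (rule increment_le[OF _ \<Phi>])
    fix t assume t: "c + T / 4 \<le> t" "t \<le> c + T / 2 - 4 * hw"
    have "x t \<ge> q" using above_until_next_fold[OF x _ _ t(2)] start v t hw hp by simp
    then show "- f' (\<xi> t) \<le> 0" using f'_nonneg_right[of "\<xi> t"] \<xi>[of t] by simp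
  qed (use hp hw in auto)
  moreover have "\<Phi> (c + T / 2 + hw) - \<Phi> (c + T / 2 - 4 * hw) \<le> L * (c + T / 2 + hw - (c + T / 2 - 4 * hw))"
  proof (rule increment_le[OF _ \<Phi>])
    fix t show "- f' (\<xi> t) \<le> L" using f'_bound[of "\<xi> t"] by linarith
  qed (use hp hw in auto)
  ultimately show ?thesis by (simp add: algebra_simps)
qed

end

text \<open>\<open>{a..M}\<close> is the strip that contains all bounded solutions.\<close>

locale relaxing = forced +
  fixes a M :: real
  assumes strip: "a \<le> M" "\<And>u. u \<le> a \<Longrightarrow> f u \<le> f q - e - 1" "\<And>u. u \<ge> M \<Longrightarrow> f u \<ge> f p + e + 1"
    and contraction: "\<And>n x z \<Phi> \<xi>. entire_solution y f x \<Longrightarrow> entire_solution y f z \<Longrightarrow>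
      (\<And>t. t \<ge> c + of_int n * T - hw \<Longrightarrow> a \<le> x t \<and> z t \<le> M) \<Longrightarrow>
      (\<And>t. (\<Phi> has_real_derivative - f' (\<xi> t)) (at t)) \<Longrightarrow> (\<And>t. x t \<le> \<xi> t \<and> \<xi> t \<le> z t) \<Longrightarrow>
      \<Phi> (c + of_int n * T + hw + T) - \<Phi> (c + of_int n * T + hw) \<le> - 1"
begin

lemma speed_above: "M \<le> u \<Longrightarrow> y t - f u \<le> - 1"
  using strip(3)[of u] y_le_max[of t] by linarith

lemma speed_below: "u \<le> a \<Longrightarrow> y t - f u \<ge> 1"
  using strip(2)[of u] y_ge_min[of t] by linarith

lemma bounded_in_strip:
  assumes x: "entire_solution y f x" and bd: "bounded (range x)"
  shows "a \<le> x t" "x t \<le> M"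
proof -
  show "a \<le> x t"
    by (rule bounded_ge_of_absorbing[OF bd zero_less_one entire_solutionD[OF x]])
       (rule speed_below[OF less_imp_le])
  show "x t \<le> M"
    by (rule bounded_le_of_absorbing[OF bd zero_less_one entire_solutionD[OF x]])
       (rule speed_above[OF less_imp_le])
qed

lemma eventually_in_strip:
  assumes x: "entire_solution y f x"
  shows "\<exists>s. \<forall>t\<ge>s. a \<le> x t \<and> x t \<le> M"
proof -
  define s where "s = \<bar>x 0\<bar> + \<bar>a\<bar> + \<bar>M\<bar>"
  have "a \<le> x t \<and> x t \<le> M" if "t \<ge> s" for t
  proof
    show "a \<le> x t"
      by (rule absorbing_below[where h = x and a = 0 and \<tau> = s and k = 1 and b = t, OF _ _ _ _ entire_solutionD[OF x]])
         (use that speed_below in \<open>auto simp: s_def\<close>)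
    show "x t \<le> M"
      by (rule absorbing[where h = x and a = 0 and \<tau> = s and k = 1 and b = t, OF _ _ _ _ entire_solutionD[OF x]])
         (use that speed_above in \<open>auto simp: s_def\<close>)
  qed
  then show ?thesis by blast
qed

lemma difference_contracts:
  assumes x: "entire_solution y f x" "\<And>t. t \<ge> c + of_int n * T - hw \<Longrightarrow> a \<le> x t \<and> x t \<le> M"
    and z: "entire_solution y f z" "\<And>t. t \<ge> c + of_int n * T - hw \<Longrightarrow> a \<le> z t \<and> z t \<le> M"
  shows "\<bar>x (c + of_int n * T + hw + T) - z (c + of_int n * T + hw + T)\<bar>
    \<le> exp (- 1) * \<bar>x (c + of_int n * T + hw) - z (c + of_int n * T + hw)\<bar>"
proof (rule abs_contraction[OF x(1) z(1)])
  fix \<Phi> \<xi>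
  assume \<Phi>: "\<And>t. (\<Phi> has_real_derivative - f' (\<xi> t)) (at t)"
    and \<xi>: "\<And>t. min (x t) (z t) \<le> \<xi> t \<and> \<xi> t \<le> max (x t) (z t)"
  show "\<Phi> (c + of_int n * T + hw + T) - \<Phi> (c + of_int n * T + hw) \<le> - 1"
  proof (cases "x 0 \<le> z 0")
    case True
    then have "x t \<le> z t" for t by (rule solution_order[OF x(1) z(1)])
    then have "x t \<le> \<xi> t \<and> \<xi> t \<le> z t" for t using \<xi>[of t] by simp
    then show ?thesis by (intro contraction[OF x(1) z(1) _ \<Phi>]) (use x(2) z(2) in auto)
  next
    case False
    then have "z t \<le> x t" for t using solution_order[OF z(1) x(1), of 0 t] by simp
    then have "z t \<le> \<xi> t \<and> \<xi> t \<le> x t" for t using \<xi>[of t] by simp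
    then show ?thesis by (intro contraction[OF z(1) x(1) _ \<Phi>]) (use x(2) z(2) in auto)
  qed
qed

theorem unique_attractor:
  obtains b where "entire_solution y f b" "\<And>t. b (t + T) = b t"
    "\<And>x. entire_solution y f x \<Longrightarrow> bounded (range x) \<Longrightarrow> x = b"
    "\<And>\<Phi>. (\<And>t. (\<Phi> has_real_derivative - f' (b t)) (at t)) \<Longrightarrow> \<exists>s. \<Phi> (s + T) - \<Phi> s \<le> - 1"
    "\<And>x. entire_solution y f x \<Longrightarrow> ((\<lambda>t. b t - x t) \<longlongrightarrow> 0) at_top"
proof -
  obtain b where b: "entire_solution y f b" "\<And>t. b (t + T) = b t"
  proof (rule exists_periodic[of T a M 0])
    show "(\<forall>x. entire_solution y f x \<and> x 0 = a \<longrightarrow> a \<le> x (0 + T)) \<and>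
      (\<forall>x. entire_solution y f x \<and> x 0 = M \<longrightarrow> x (0 + T) \<le> M) \<or>
      (\<forall>x. entire_solution y f x \<and> x 0 = a \<longrightarrow> x (0 + T) \<le> a) \<and>
      (\<forall>x. entire_solution y f x \<and> x 0 = M \<longrightarrow> M \<le> x (0 + T))"
    proof (intro disjI1 conjI allI impI; elim conjE)
      fix x assume x: "entire_solution y f x" "x 0 = a"
      show "a \<le> x (0 + T)"
      proof (rule constant_lower_barrier[OF x(1), where a = 0])
        show "f a \<le> y t" for t using speed_below[of a t] by simp
      qed (use x(2) T_pos in auto)
    next
      fix x assume x: "entire_solution y f x" "x 0 = M"
      show "x (0 + T) \<le> M"
      proof (rule constant_upper_barrier[OF x(1), where a = 0])
        show "y t \<le> f M" for t using speed_above[of M t] by simp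
      qed (use x(2) T_pos in auto)
    qed
  qed (use y_periodic strip in auto)
  have b_bd: "bounded (range b)"
    by (rule periodic_bounded[OF b(2) T_pos entire_solution_continuous[OF b(1)]])
  show ?thesis
  proof (rule that[OF b])
    fix x assume x: "entire_solution y f x" "bounded (range x)"
    show "x = b"
    proof (rule bounded_eq_of_contraction[OF x b(1) b_bd, of "c + hw" T])
      fix k :: nat
      have eq: "c + hw - real k * T = c + of_int (- int (Suc k)) * T + hw + T"
        "c + hw - real (Suc k) * T = c + of_int (- int (Suc k)) * T + hw" by (simp_all add: algebra_simps)
      show "\<bar>x (c + hw - real k * T) - b (c + hw - real k * T)\<bar>
          \<le> exp (- 1) * \<bar>x (c + hw - real (Suc k) * T) - b (c + hw - real (Suc k) * T)\<bar>"
        unfolding eq using bounded_in_strip[OF x] bounded_in_strip[OF b(1) b_bd]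
        by (intro difference_contracts[OF x(1) _ b(1)] conjI)
    qed
  next
    fix \<Phi> assume \<Phi>: "\<And>t. (\<Phi> has_real_derivative - f' (b t)) (at t)"
    have "\<Phi> (c + of_int 0 * T + hw + T) - \<Phi> (c + of_int 0 * T + hw) \<le> - 1"
      by (rule contraction[OF b(1) b(1) _ \<Phi>]) (auto simp: bounded_in_strip[OF b(1) b_bd])
    then show "\<exists>s. \<Phi> (s + T) - \<Phi> s \<le> - 1" by blast
  next
    fix x assume x: "entire_solution y f x"
    obtain s where s: "\<And>t. t \<ge> s \<Longrightarrow> a \<le> x t \<and> x t \<le> M" using eventually_in_strip[OF x] by blast
    \<comment> \<open>Counting starts only after the solution has entered the strip; the term
      \<open>hw\<close> accounts for the jump window before each section.\<close>
    obtain n :: nat where n: "real n * T > s - c + hw" using ex_less_of_nat_mult[OF T_pos] by blast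
    show "((\<lambda>t. b t - x t) \<longlongrightarrow> 0) at_top"
    proof (rule decay_of_section_decay[OF b(1) x T_pos, where s = "c + of_int (int n) * T + hw"])
      fix k :: nat
      have eq: "c + of_int (int n) * T + hw + real k * T = c + of_int (int (n + k)) * T + hw"
        "c + of_int (int n) * T + hw + real (Suc k) * T = c + of_int (int (n + k)) * T + hw + T"
        by (simp_all add: algebra_simps)
      have "real n * T \<le> real (n + k) * T" using T_pos by simp
      then have late: "t \<ge> s" if "t \<ge> c + of_int (int (n + k)) * T - hw" for t using that n by simp
      show "\<bar>b (c + of_int (int n) * T + hw + real (Suc k) * T) - x (c + of_int (int n) * T + hw + real (Suc k) * T)\<bar>
        \<le> exp (- 1) * \<bar>b (c + of_int (int n) * T + hw + real k * T) - x (c + of_int (int n) * T + hw + real k * T)\<bar>"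
        unfolding eq
        by (rule difference_contracts[OF b(1) _ x]) (use bounded_in_strip[OF b(1) b_bd] s late in auto)
    qed
  qed
qed

end

text \<open>One half of a period. After a maximum the lower solution alone bounds
  \<open>\<xi>\<close> from below; in the other half the upper solution plays this role, through the
  reflection.\<close>

definition half_contracts where
  "half_contracts y f f' start a s s' \<rho> \<longleftrightarrow> (\<forall>x \<Phi> \<xi>. entire_solution y f x \<longrightarrow> (\<forall>t\<ge>start. a \<le> x t) \<longrightarrow>
     (\<forall>t. (\<Phi> has_real_derivative - f' (\<xi> t :: real)) (at t)) \<longrightarrow> (\<forall>t. x t \<le> \<xi> t) \<longrightarrow>
     \<Phi> s' - \<Phi> s \<le> (\<rho> :: real))"

lemma half_contractsD:
  assumes "half_contracts y f f' start a s s' \<rho>" "entire_solution y f x" "\<And>t. t \<ge> start \<Longrightarrow> a \<le> x t"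
    "\<And>t. (\<Phi> has_real_derivative - f' (\<xi> t)) (at t)" "\<And>t. x t \<le> \<xi> t"
  shows "\<Phi> s' - \<Phi> s \<le> \<rho>"
  by (rule assms(1)[unfolded half_contracts_def, rule_format]) (use assms(2-) in auto)

context S_shape
begin

lemma half_contraction_jump:
  "\<exists>\<eta>>0. \<exists>c0>0. \<forall>y c \<epsilon> e. forced f f' p q ph qh L K y c \<epsilon> e \<longrightarrow> e \<le> \<eta> \<longrightarrow> \<epsilon> \<le> \<eta> * e \<longrightarrow>
     forced.hw f p q \<epsilon> e \<le> forced.T \<epsilon> / 16 \<longrightarrow>
     half_contracts y f f' (c - forced.hw f p q \<epsilon> e) a (c + forced.hw f p q \<epsilon> e)
       (c + forced.T \<epsilon> / 2 + forced.hw f p q \<epsilon> e)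
       (- c0 * (forced.T \<epsilon> / 4 - forced.hw f p q \<epsilon> e) + 5 * L * forced.hw f p q \<epsilon> e)"
proof -
  define D where "D = f p - f q"
  have D: "D > 0" using fq_less_fp by (simp add: D_def)
  \<comment> \<open>Close enough to \<open>q\<close> for \<open>f v\<close> to be at most the mean
    of the fold values, yet strictly between \<open>q\<close> and the landing point, so that
    \<open>fold_p\<close> holds up to \<open>v\<close>.\<close>
  define v where "v = min (q + D / 2 / L) ((q + qh) / 2)"
  have v: "q < v" "v < qh" using D L qh by (auto simp: v_def min_less_iff_disj)
  have fv: "f v \<le> (f p + f q) / 2"
  proof -
    have "f v \<le> f q + D / 2" using v by (intro f_near_q) (auto simp: v_def)
    then show ?thesis unfolding D_def by argo
  qed
  obtain c0 where c0: "c0 > 0" "\<And>u. u \<ge> q + (v - q) \<Longrightarrow> f' u \<ge> c0"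
    using right_branch[of "v - q"] v by auto
  obtain \<kappa> where \<kappa>: "\<kappa> > 0" "\<And>u. min a q \<le> u \<Longrightarrow> u \<le> qh - (qh - v) \<Longrightarrow> f p - f u \<ge> \<kappa> * (u - p)\<^sup>2"
    using fold_p[of "qh - v" "min a q"] v by auto
  \<comment> \<open>Squaring \<open>\<epsilon> \<le> sqrt (\<kappa> / (8 * D)) * e\<close> gives the
    hypothesis \<open>fast\<close> of \<open>jump_up\<close>.\<close>
  define \<eta> where "\<eta> = min (D / 2) (sqrt (\<kappa> / (8 * D)))"
  have \<eta>: "\<eta> > 0" using D \<kappa> by (simp add: \<eta>_def)
  have main: "half_contracts y f f' (c - forced.hw f p q \<epsilon> e) a (c + forced.hw f p q \<epsilon> e)
       (c + forced.T \<epsilon> / 2 + forced.hw f p q \<epsilon> e)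
       (- c0 * (forced.T \<epsilon> / 4 - forced.hw f p q \<epsilon> e) + 5 * L * forced.hw f p q \<epsilon> e)"
    if fo: "forced f f' p q ph qh L K y c \<epsilon> e" and e: "e \<le> \<eta>" and \<epsilon>: "\<epsilon> \<le> \<eta> * e"
      and hw: "forced.hw f p q \<epsilon> e \<le> forced.T \<epsilon> / 16"
    for y c \<epsilon> e
    unfolding half_contracts_def
  proof (intro allI impI)
    fix x \<Phi> \<xi>
    assume x: "entire_solution y f x"
      and xa: "\<forall>t\<ge>c - forced.hw f p q \<epsilon> e. a \<le> x t"
      and \<Phi>: "\<forall>t. (\<Phi> has_real_derivative - f' (\<xi> t)) (at t)" and \<xi>: "\<forall>t. x t \<le> \<xi> t"
    interpret w: forced f f' p q ph qh L K y c \<epsilon> e by (rule fo)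
    have "x (c + w.hw) \<ge> v"
    proof (rule w.jump_up[OF _ x \<kappa>(1), where a = "min a q"])
      show "e \<le> (f p - f q) / 2" using e by (simp add: \<eta>_def D_def)
      show "\<kappa> * (u - p)\<^sup>2 \<le> f p - f u" if "min a q \<le> u" "u \<le> v" for u using \<kappa>(2)[of u] that by simp
      show "min a q \<le> v" using v by simp
      show "min a q \<le> x t" if "\<bar>t - c\<bar> \<le> w.hw" for t
        using xa[rule_format, of t] that by (simp add: abs_le_iff min_le_iff_disj)
      have "\<eta> * e \<le> sqrt (\<kappa> / (8 * D)) * e" using w.e by (intro mult_right_mono) (auto simp: \<eta>_def)
      then have "\<epsilon> \<le> sqrt (\<kappa> / (8 * D)) * e" using \<epsilon> by simp
      then have "\<epsilon>\<^sup>2 \<le> (sqrt (\<kappa> / (8 * D)) * e)\<^sup>2" using w.\<epsilon> by (intro power_mono) auto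
      also have "\<dots> = \<kappa> / (8 * D) * e\<^sup>2" using \<kappa>(1) D by (simp add: power_mult_distrib)
      finally have "8 * D * \<epsilon>\<^sup>2 \<le> 8 * D * (\<kappa> / (8 * D) * e\<^sup>2)" using D by (intro mult_left_mono) auto
      then show "8 * (f p - f q) * \<epsilon>\<^sup>2 \<le> \<kappa> * e\<^sup>2" using D by (simp add: D_def)
    qed
    then show "\<Phi> (c + w.T / 2 + w.hw) - \<Phi> (c + w.hw) \<le> - c0 * (w.T / 4 - w.hw) + 5 * L * w.hw"
      by (rule w.half_contraction[OF x _ v(1) fv _ hw]) (use c0 \<Phi> \<xi> in auto)
  qed
  with \<eta> c0(1) show ?thesis by blast
qed

lemma relaxing_exists:
  "\<exists>a M \<eta>. \<eta> > 0 \<and> (\<forall>y c \<epsilon> e. forced f f' p q ph qh L K y c \<epsilon> e \<longrightarrow> e \<le> \<eta> \<longrightarrow> \<epsilon> \<le> \<eta> * e \<longrightarrow>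
     relaxing f f' p q ph qh L K y c \<epsilon> e a M)"
proof -
  interpret m: S_shape "\<lambda>x. - f (- x)" "\<lambda>x. f' (- x)" "- q" "- p" "- qh" "- ph" L K by (rule mirror)
  obtain a where a: "a < p" "f a \<le> f q - 2" using f_unbounded_below by blast
  obtain M where M: "M > q" "f M \<ge> f p + 2" using f_unbounded_above by blast
  obtain \<eta>1 c1 where 1: "\<eta>1 > 0" "c1 > 0" "\<And>y c \<epsilon> e. forced f f' p q ph qh L K y c \<epsilon> e \<Longrightarrow>
     e \<le> \<eta>1 \<Longrightarrow> \<epsilon> \<le> \<eta>1 * e \<Longrightarrow> forced.hw f p q \<epsilon> e \<le> forced.T \<epsilon> / 16 \<Longrightarrow>
     half_contracts y f f' (c - forced.hw f p q \<epsilon> e) a (c + forced.hw f p q \<epsilon> e)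
       (c + forced.T \<epsilon> / 2 + forced.hw f p q \<epsilon> e)
       (- c1 * (forced.T \<epsilon> / 4 - forced.hw f p q \<epsilon> e) + 5 * L * forced.hw f p q \<epsilon> e)"
    using half_contraction_jump[of a] by blast
  obtain \<eta>2 c2 where 2: "\<eta>2 > 0" "c2 > 0" "\<And>y c \<epsilon> e.
     forced (\<lambda>x. - f (- x)) (\<lambda>x. f' (- x)) (- q) (- p) (- qh) (- ph) L K y c \<epsilon> e \<Longrightarrow>
     e \<le> \<eta>2 \<Longrightarrow> \<epsilon> \<le> \<eta>2 * e \<Longrightarrow> forced.hw (\<lambda>x. - f (- x)) (- q) (- p) \<epsilon> e \<le> forced.T \<epsilon> / 16 \<Longrightarrow>
     half_contracts y (\<lambda>x. - f (- x)) (\<lambda>x. f' (- x)) (c - forced.hw (\<lambda>x. - f (- x)) (- q) (- p) \<epsilon> e) (- M) (c + forced.hw (\<lambda>x. - f (- x)) (- q) (- p) \<epsilon> e)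
       (c + forced.T \<epsilon> / 2 + forced.hw (\<lambda>x. - f (- x)) (- q) (- p) \<epsilon> e)
       (- c2 * (forced.T \<epsilon> / 4 - forced.hw (\<lambda>x. - f (- x)) (- q) (- p) \<epsilon> e) + 5 * L * forced.hw (\<lambda>x. - f (- x)) (- q) (- p) \<epsilon> e)"
    using m.half_contraction_jump[of "- M"] by blast
  define c0 where "c0 = min c1 c2"
  have c0: "c0 > 0" "c0 \<le> c1" "c0 \<le> c2" using 1 2 by (simp_all add: c0_def)
  \<comment> \<open>An upper bound for \<open>hw / T\<close>. With it the losses in the windows eat
    up at most half of the gain \<open>c0 * T / 4\<close>, so each half period contributes at most
    \<open>- c0 * T / 8\<close>.\<close>
  define \<mu> where "\<mu> = min (1 / 16) (c0 / (8 * (c0 + 5 * L)))"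
  have \<mu>: "\<mu> > 0" "\<mu> \<le> 1 / 16" "\<mu> * (c0 + 5 * L) \<le> c0 / 8"
  proof -
    have pos: "c0 + 5 * L > 0" using c0 L by simp
    show "\<mu> > 0" using c0 pos by (simp add: \<mu>_def)
    show "\<mu> \<le> 1 / 16" unfolding \<mu>_def by (rule min.cobounded1)
    have "\<mu> * (c0 + 5 * L) \<le> c0 / (8 * (c0 + 5 * L)) * (c0 + 5 * L)"
      using pos by (intro mult_right_mono) (auto simp: \<mu>_def)
    also have "\<dots> = c0 / 8"
    proof -
      have "r / (8 * s) * s = r / 8" if "s > 0" for r s :: real using that by simp
      then show ?thesis using pos .
    qed
    finally show "\<mu> * (c0 + 5 * L) \<le> c0 / 8" .
  qed
  \<comment> \<open>The bound 1 makes the margin 2 in the choice of \<open>a\<close> and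
    \<open>M\<close> exceed \<open>e + 1\<close>, up to equality; the next entry yields
    \<open>hw \<le> \<mu> * T\<close>; the last gives
    \<open>\<epsilon> \<le> \<eta>\<^sup>2 \<le> c0 / 4\<close> and thereby
    \<open>c0 * T \<ge> 8\<close>.\<close>
  define \<eta> where "\<eta> = min (min \<eta>1 \<eta>2) (min 1 (min ((f p - f q) * \<mu>\<^sup>2) (sqrt c0 / 2)))"
  have \<eta>: "\<eta> > 0" "\<eta> \<le> \<eta>1" "\<eta> \<le> \<eta>2" "\<eta> \<le> 1" "\<eta> \<le> (f p - f q) * \<mu>\<^sup>2" "\<eta> \<le> sqrt c0 / 2"
    using 1 2 \<mu> fq_less_fp c0 by (simp_all add: \<eta>_def)
  have "relaxing f f' p q ph qh L K y c \<epsilon> e a M"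
    if fo: "forced f f' p q ph qh L K y c \<epsilon> e" and e: "e \<le> \<eta>" and \<epsilon>: "\<epsilon> \<le> \<eta> * e" for y c \<epsilon> e
  proof -
    interpret w0: forced f f' p q ph qh L K y c \<epsilon> e by (rule fo)
    have e1: "e \<le> 1" "e \<le> \<eta>1" "e \<le> \<eta>2" using e \<eta> by auto
    have \<epsilon>1: "\<epsilon> \<le> \<eta>1 * e" "\<epsilon> \<le> \<eta>2 * e"
      using \<epsilon> \<eta>(2,3) w0.e by (meson mult_right_mono order_trans less_imp_le)+
    have "\<epsilon> \<le> \<eta> * \<eta>" using \<epsilon> e \<eta>(1) by (meson mult_left_mono order_trans less_imp_le)
    also have "\<eta> * \<eta> \<le> sqrt c0 / 2 * (sqrt c0 / 2)" using \<eta> c0 by (intro mult_mono) auto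
    also have "\<dots> = c0 / 4" using c0 by simp
    finally have \<epsilon>c: "4 * \<epsilon> \<le> c0" by simp
    have T: "c0 * w0.T \<ge> 8"
    proof -
      have "8 * \<epsilon> \<le> 2 * c0" using \<epsilon>c by simp
      also have "\<dots> \<le> c0 * (2 * pi)" using c0 pi_ge_two by simp
      also have "\<dots> = c0 * w0.T * \<epsilon>" using w0.\<epsilon>T by (simp add: mult.assoc mult.commute[of w0.T])
      finally show ?thesis using w0.\<epsilon> by simp
    qed
    have hw: "w0.hw \<le> \<mu> * w0.T"
    proof -
      have "e / (f p - f q) \<le> \<mu>\<^sup>2" using e \<eta>(5) fq_less_fp by (simp add: pos_divide_le_eq mult.commute)
      then have "sqrt (e / (f p - f q)) \<le> \<mu>" using \<mu> by (intro real_le_lsqrt) auto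
      then have "w0.hw \<le> \<mu> / \<epsilon>" unfolding w0.hw_def using w0.\<epsilon> by (intro divide_right_mono) auto
      also have "\<dots> \<le> \<mu> * w0.T" using \<mu> w0.\<epsilon> pi_ge_two by (simp add: w0.T_def divide_simps)
      finally show ?thesis .
    qed
    have hw16: "w0.hw \<le> w0.T / 16"
    proof -
      have "\<mu> * w0.T \<le> 1 / 16 * w0.T" using \<mu> w0.T_pos by (intro mult_right_mono) auto
      then show ?thesis using hw by simp
    qed
    have total: "- ci * (w0.T / 4 - w0.hw) + 5 * L * w0.hw \<le> - 1" if ci: "c0 \<le> ci" for ci
    proof -
      have "c0 * (w0.T / 4 - w0.hw) \<le> ci * (w0.T / 4 - w0.hw)"
        using ci hw16 w0.T_pos by (intro mult_right_mono) auto
      moreover have "(c0 + 5 * L) * w0.hw \<le> c0 / 8 * w0.T"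
      proof -
        have "(c0 + 5 * L) * w0.hw \<le> (c0 + 5 * L) * (\<mu> * w0.T)" using hw c0 L by (intro mult_left_mono) auto
        also have "\<dots> = \<mu> * (c0 + 5 * L) * w0.T" by simp
        also have "\<dots> \<le> c0 / 8 * w0.T" using \<mu>(3) w0.T_pos by (intro mult_right_mono) auto
        finally show ?thesis .
      qed
      ultimately show ?thesis using T by (simp add: algebra_simps)
    qed
    show ?thesis
    proof
      show "a \<le> M" using a M p_less_q by simp
      show "f u \<le> f q - e - 1" if "u \<le> a" for u using f_mono_left[OF that] a e1 by simp
      show "f u \<ge> f p + e + 1" if "M \<le> u" for u using f_mono_right[OF _ that] M e1 by simp
    next
      fix n x z \<Phi> \<xi>
      assume x: "entire_solution y f x" and z: "entire_solution y f z"
        and st: "\<And>t. t \<ge> c + of_int n * w0.T - w0.hw \<Longrightarrow> a \<le> x t \<and> z t \<le> M"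
        and \<Phi>: "\<And>t. (\<Phi> has_real_derivative - f' (\<xi> t)) (at t)" and \<xi>: "\<And>t. x t \<le> \<xi> t \<and> \<xi> t \<le> z t"
      interpret w: forced f f' p q ph qh L K y "c + of_int n * w0.T" \<epsilon> e by (rule w0.forced_shift)
      have "\<Phi> (c + of_int n * w.T + w.T / 2 + w.hw) - \<Phi> (c + of_int n * w.T + w.hw)
          \<le> - c1 * (w.T / 4 - w.hw) + 5 * L * w.hw"
        by (rule half_contractsD[OF 1(3)[OF w.forced_axioms e1(2) \<epsilon>1(1) hw16] x _ \<Phi>]) (use st \<xi> in auto)
      moreover have "\<Phi> (c + of_int n * w.T + w.T / 2 + w.T / 2 + w.hw) - \<Phi> (c + of_int n * w.T + w.T / 2 + w.hw)
          \<le> - c2 * (w.T / 4 - w.hw) + 5 * L * w.hw"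
      proof (rule half_contractsD[OF 2(3)[OF w.forced_mirror e1(3) \<epsilon>1(2), unfolded w.hw_mirror, OF hw16]
            w0.solution_mirror[OF z], where \<xi> = "\<lambda>t. - \<xi> t"])
        show "- M \<le> - z t" if "t \<ge> c + of_int n * w.T + w.T / 2 - w.hw" for t
          using st[of t] that w.T_pos by simp
        show "(\<Phi> has_real_derivative - f' (- (- \<xi> t))) (at t)" for t using \<Phi>[of t] by simp
        show "- z t \<le> - \<xi> t" for t using \<xi>[of t] by simp
      qed
      moreover have eq: "c + of_int n * w.T + w.T / 2 + w.T / 2 + w.hw = c + of_int n * w.T + w.hw + w.T" by simp
      ultimately show "\<Phi> (c + of_int n * w.T + w.hw + w.T) - \<Phi> (c + of_int n * w.T + w.hw) \<le> - 1"
        unfolding eq using total[OF c0(2)] total[OF c0(3)] by linarith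
    qed
  qed
  then show ?thesis using \<eta>(1) by blast
qed

end

section \<open>The shape of the relaxation oscillation\<close>

context S_shape
begin

text \<open>The residual \<open>W = y - f b\<close> satisfies \<open>W' = y' - f' b * W\<close> with
  \<open>y'\<close> of order \<open>\<epsilon>\<close>. Once the jump is over, \<open>f' b\<close>
  is at least \<open>c1\<close>, so \<open>W\<^sup>2\<close> decreases at a fixed rate until
  \<open>W\<close> is below \<open>d\<close> in absolute value. Squaring treats both signs at
  once.\<close>

lemma tracking:
  assumes d: "d > 0" and s0: "0 < s0" "s0 \<le> 1"
  shows "\<exists>\<eta>>0. \<forall>y c \<epsilon> e b. forced f f' p q ph qh L K y c \<epsilon> e \<longrightarrow> e \<le> \<eta> \<longrightarrow> \<epsilon> \<le> \<eta> * e \<longrightarrow>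
     entire_solution y f b \<longrightarrow> bounded (range b) \<longrightarrow>
     (\<forall>t. c + s0 / \<epsilon> \<le> t \<longrightarrow> t \<le> c + forced.T \<epsilon> / 2 - s0 / \<epsilon> \<longrightarrow> q \<le> b t \<and> \<bar>y t - f (b t)\<bar> \<le> d)"
proof -
  define D where "D = f p - f q"
  have D: "D > 0" using fq_less_fp by (simp add: D_def)
  obtain a where a: "a < p" "f a \<le> f q - 2" using f_unbounded_below by blast
  obtain M where M: "M > q" "f M \<ge> f p + 2" using f_unbounded_above by blast
  \<comment> \<open>At slow time at least \<open>s0\<close> before the minimum, the forcing exceeds
    \<open>f q - e\<close> by \<open>2 * k2\<close>; one half absorbs \<open>e\<close>, the other
    keeps the solution above \<open>v\<close>.\<close>
  define k2 where "k2 = D / 16 * s0\<^sup>2 / 2"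
  have k2: "k2 > 0" using D s0 by (simp add: k2_def)
  define v where "v = min (q + k2 / L) ((q + qh) / 2)"
  have v: "q < v" "v < qh" using k2 L qh by (auto simp: v_def min_less_iff_disj)
  have fv: "f v \<le> f q + k2" using v by (intro f_near_q) (auto simp: v_def)
  obtain c1 where c1: "c1 > 0" "\<And>u. u \<ge> q + (v - q) \<Longrightarrow> f' u \<ge> c1"
    using right_branch[of "v - q"] v by auto
  obtain \<kappa> where \<kappa>: "\<kappa> > 0" "\<And>u. a \<le> u \<Longrightarrow> u \<le> qh - (qh - v) \<Longrightarrow> f p - f u \<ge> \<kappa> * (u - p)\<^sup>2"
    using fold_p[of "qh - v" a] v by auto
  define W0 where "W0 = f M - f q + 2"
  have W0: "W0 > 0" using M D by (simp add: W0_def D_def)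
  \<comment> \<open>\<open>W0\<close> bounds the residual right after the jump, so
    \<open>\<tau>\<close> is the time in which \<open>W\<^sup>2\<close>, falling at rate
    \<open>c1 * d\<^sup>2\<close>, gets below \<open>d\<^sup>2\<close>.\<close>
  define \<tau> where "\<tau> = W0\<^sup>2 / (c1 * d\<^sup>2)"
  have \<tau>: "\<tau> > 0" using W0 c1 d by (simp add: \<tau>_def)
  \<comment> \<open>The entries with \<open>s0 / 2\<close> and \<open>\<tau>\<close> bound
    \<open>hw\<close> and \<open>\<tau>\<close> by half of \<open>s0 / \<epsilon>\<close> each, so
    jump and relaxation are over in time. The entry \<open>c1 * d / (2 * D)\<close> keeps the drift
    \<open>D * \<epsilon>\<close> of the forcing below half of \<open>c1 * d\<close>.\<close>
  define \<eta> where "\<eta> = min (min (min 1 (D / 2)) (min k2 (D * (s0 / 2)\<^sup>2)))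
      (min (sqrt (\<kappa> / (8 * D))) (min (c1 * d / (2 * D)) (s0 / (2 * \<tau>))))"
  have \<eta>: "\<eta> > 0" "\<eta> \<le> 1" "\<eta> \<le> D / 2" "\<eta> \<le> k2" "\<eta> \<le> D * (s0 / 2)\<^sup>2" "\<eta> \<le> sqrt (\<kappa> / (8 * D))"
      "\<eta> \<le> c1 * d / (2 * D)" "\<eta> \<le> s0 / (2 * \<tau>)"
    using D k2 s0 \<kappa>(1) c1(1) d \<tau> by (auto simp: \<eta>_def)
  have main: "q \<le> b t \<and> \<bar>y t - f (b t)\<bar> \<le> d"
    if fo: "forced f f' p q ph qh L K y c \<epsilon> e" and e: "e \<le> \<eta>" and \<epsilon>: "\<epsilon> \<le> \<eta> * e"
      and b: "entire_solution y f b" "bounded (range b)"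
      and t: "c + s0 / \<epsilon> \<le> t" "t \<le> c + forced.T \<epsilon> / 2 - s0 / \<epsilon>" for y c \<epsilon> e b t
  proof -
    interpret w: forced f f' p q ph qh L K y c \<epsilon> e by (rule fo)
    have ee: "0 < e" "e \<le> 1" "e \<le> D / 2" "e \<le> k2" using w.e e \<eta> by auto
    have "\<eta> * e \<le> \<eta> * 1" using ee \<eta> by (intro mult_left_mono) auto
    then have \<epsilon>': "0 < \<epsilon>" "\<epsilon> \<le> \<eta>" using \<epsilon> w.\<epsilon> by auto
    have b_ge: "a \<le> b t" for t
    proof (rule bounded_ge_of_absorbing[OF b(2) zero_less_one entire_solutionD[OF b(1)]])
      show "1 \<le> y t - f (b t)" if "b t < a" for t
        using w.y_ge_min[of t] f_mono_left[of "b t" a] a that ee by simp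
    qed
    have b_le: "b t \<le> M" for t
    proof (rule bounded_le_of_absorbing[OF b(2) zero_less_one entire_solutionD[OF b(1)]])
      show "y t - f (b t) \<le> - 1" if "M < b t" for t
        using w.y_le_max[of t] f_mono_right[of M "b t"] M that ee by simp
    qed
    have jump: "b (c + w.hw) \<ge> v"
    proof (rule w.jump_up[OF _ b(1) \<kappa>(1)])
      show "e \<le> (f p - f q) / 2" using ee by (simp add: D_def)
      show "\<kappa> * (u - p)\<^sup>2 \<le> f p - f u" if "a \<le> u" "u \<le> v" for u using \<kappa>(2)[of u] that by simp
      show "a \<le> v" using v a p_less_q by simp
      show "a \<le> b t" for t by (rule b_ge)
      have "\<eta> * e \<le> sqrt (\<kappa> / (8 * D)) * e" using \<eta> ee by (intro mult_right_mono) auto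
      then have "\<epsilon> \<le> sqrt (\<kappa> / (8 * D)) * e" using \<epsilon> by simp
      then have "\<epsilon>\<^sup>2 \<le> (sqrt (\<kappa> / (8 * D)) * e)\<^sup>2" using \<epsilon>' by (intro power_mono) auto
      also have "\<dots> = \<kappa> / (8 * D) * e\<^sup>2" using \<kappa>(1) D by (simp add: power_mult_distrib)
      finally have "8 * D * \<epsilon>\<^sup>2 \<le> 8 * D * (\<kappa> / (8 * D) * e\<^sup>2)" using D by (intro mult_left_mono) auto
      then show "8 * (f p - f q) * \<epsilon>\<^sup>2 \<le> \<kappa> * e\<^sup>2" using D by (simp add: D_def)
    qed
    have hw: "w.hw \<le> s0 / 2 / \<epsilon>"
    proof -
      have "e / D \<le> (s0 / 2)\<^sup>2" using e \<eta>(5) D by (simp add: pos_divide_le_eq mult.commute)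
      then have "sqrt (e / D) \<le> s0 / 2" using s0 by (intro real_le_lsqrt) auto
      then show ?thesis unfolding w.hw_def D_def[symmetric] using \<epsilon>' by (intro divide_right_mono) auto
    qed
    have \<tau>_le: "\<tau> \<le> s0 / 2 / \<epsilon>"
    proof -
      have "\<epsilon> \<le> s0 / (2 * \<tau>)" using \<epsilon>' \<eta> by linarith
      then have "\<epsilon> * (2 * \<tau>) \<le> s0" using \<tau> by (simp add: pos_le_divide_eq)
      then show ?thesis using \<epsilon>' by (simp add: pos_le_divide_eq mult.commute mult.left_commute)
    qed
    have half: "s0 / 2 / \<epsilon> + s0 / 2 / \<epsilon> = s0 / \<epsilon>" by simp
    have y_ge: "y s \<ge> f q + k2" if s: "c \<le> s" "s \<le> c + w.T / 2 - s0 / \<epsilon>" for s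
    proof -
      interpret mir: forced "\<lambda>x. - f (- x)" "\<lambda>x. f' (- x)" "- q" "- p" "- qh" "- ph" L K
        "\<lambda>t. - y t" "c + w.T / 2" \<epsilon> e by (rule w.forced_mirror)
      have ab: "\<bar>s - (c + w.T / 2)\<bar> = c + w.T / 2 - s"
      proof -
        have "s0 / \<epsilon> > 0" using s0 \<epsilon>' by simp
        then show ?thesis using s by linarith
      qed
      have "\<epsilon> * (c + w.T / 2 - s) \<le> \<epsilon> * (w.T / 2)" using s \<epsilon>' by (intro mult_left_mono) auto
      then have "- y s \<le> - f (- (- q)) + e - mir.Q * \<epsilon>\<^sup>2 * (s - (c + w.T / 2))\<^sup>2"
        using w.\<epsilon>T ab by (intro mir.y_le_near) simp
      moreover have "mir.Q = D / 16" by (simp add: mir.Q_def D_def)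
      moreover have "s0\<^sup>2 \<le> \<epsilon>\<^sup>2 * (s - (c + w.T / 2))\<^sup>2"
      proof -
        have "s0 / \<epsilon> \<le> c + w.T / 2 - s" using s by simp
        then have "s0 \<le> \<epsilon> * (c + w.T / 2 - s)" using \<epsilon>' by (simp add: pos_divide_le_eq mult.commute)
        then have "s0\<^sup>2 \<le> (\<epsilon> * (c + w.T / 2 - s))\<^sup>2" using s0 by (intro power_mono) auto
        then show ?thesis by (simp add: power_mult_distrib power2_commute)
      qed
      then have "D / 16 * s0\<^sup>2 \<le> D / 16 * (\<epsilon>\<^sup>2 * (s - (c + w.T / 2))\<^sup>2)"
        using D by (intro mult_left_mono) auto
      ultimately show ?thesis using ee(4) unfolding k2_def by (simp add: mult.assoc)
    qed
    have b_v: "b s \<ge> v" if s: "c + w.hw \<le> s" "s \<le> c + w.T / 2 - s0 / \<epsilon>" for s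
    proof (rule w.constant_lower_barrier[OF b(1) s(1) jump])
      fix r assume "c + w.hw \<le> r" "r \<le> s"
      then show "f v \<le> y r" using y_ge[of r] fv s w.hw_pos by simp
    qed
    define y' where "y' t = - ((f p - f q) / 2 + e) * \<epsilon> * sin (\<epsilon> * (t - c))" for t
    have y'_bound: "\<bar>y' t\<bar> \<le> D * \<epsilon>" for t
    proof -
      have "(f p - f q) / 2 + e \<le> D" using ee unfolding D_def by argo
      moreover have "\<bar>y' t\<bar> = ((f p - f q) / 2 + e) * \<epsilon> * \<bar>sin (\<epsilon> * (t - c))\<bar>"
        unfolding y'_def abs_mult using w.amplitude_pos \<epsilon>' by (simp only: abs_minus_cancel abs_of_pos)
      ultimately show ?thesis
        using D \<epsilon>' mult_mono[of "((f p - f q) / 2 + e) * \<epsilon>" "D * \<epsilon>" "\<bar>sin (\<epsilon> * (t - c))\<bar>" 1] by simp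
    qed
    define W where "W t = y t - f (b t)" for t
    have W: "(W has_real_derivative y' t - f' (b t) * W t) (at t)" for t
      unfolding W_def[abs_def] y'_def
      by (intro DERIV_diff w.y_deriv DERIV_chain2[OF f_der] entire_solutionD[OF b(1)])
    define H' where "H' t = 2 * W t * (y' t - f' (b t) * W t)" for t
    have H: "((\<lambda>t. (W t)\<^sup>2) has_real_derivative H' t) (at t)" for t
      unfolding H'_def by (rule derivative_eq_intros W refl | simp)+
    have "(W t)\<^sup>2 \<le> d\<^sup>2"
    proof (rule absorbing[where h = "\<lambda>t. (W t)\<^sup>2" and h' = H' and a = "c + w.hw" and \<tau> = \<tau> and k = "c1 * d\<^sup>2" and b = t])
      show "c + w.hw + \<tau> \<le> t" using t(1) hw \<tau>_le half by linarith
      show "(W (c + w.hw))\<^sup>2 \<le> d\<^sup>2 + c1 * d\<^sup>2 * \<tau>"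
      proof -
        have "f q \<le> f (b (c + w.hw))" "f (b (c + w.hw)) \<le> f M"
          using f_mono_right[of q "b (c + w.hw)"] f_mono_right[of "b (c + w.hw)" M] jump v b_le by auto
        moreover have "f p \<le> f M" using M by simp
        ultimately have "\<bar>W (c + w.hw)\<bar> \<le> W0"
          unfolding W_def W0_def using w.y_le_max[of "c + w.hw"] w.y_ge_min[of "c + w.hw"] ee by linarith
        then have "(W (c + w.hw))\<^sup>2 \<le> W0\<^sup>2" using W0 by (metis abs_le_square_iff abs_of_pos)
        also have "W0\<^sup>2 = c1 * d\<^sup>2 * \<tau>" using c1 d by (simp add: \<tau>_def)
        finally show ?thesis by (simp add: add_increasing)
      qed
      fix s assume s: "c + w.hw \<le> s" "s \<le> t"
      show "((\<lambda>t. (W t)\<^sup>2) has_real_derivative H' s) (at s)" by (rule H)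
      assume "d\<^sup>2 < (W s)\<^sup>2"
      then have dW: "d \<le> \<bar>W s\<bar>" using d by (metis abs_le_square_iff abs_of_pos less_imp_le)
      have f'c: "f' (b s) \<ge> c1" using b_v[of s] s t by (intro c1) auto
      have "D * \<epsilon> \<le> c1 * d / 2"
      proof -
        have "\<epsilon> \<le> c1 * d / (2 * D)" using \<epsilon>' \<eta> by linarith
        then show ?thesis using D by (simp add: pos_le_divide_eq mult.commute mult.left_commute)
      qed
      moreover have "c1 * d \<le> c1 * \<bar>W s\<bar>" using dW c1 by (intro mult_left_mono) auto
      ultimately have "\<bar>y' s\<bar> \<le> c1 * \<bar>W s\<bar> / 2" using y'_bound[of s] by linarith
      then have "W s * y' s \<le> \<bar>W s\<bar> * (c1 * \<bar>W s\<bar> / 2)"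
        by (metis abs_ge_self abs_mult abs_ge_zero mult_left_mono order_trans)
      also have "\<dots> = c1 / 2 * (W s)\<^sup>2" by (simp add: power2_eq_square abs_mult[symmetric])
      finally have 1: "W s * y' s \<le> c1 / 2 * (W s)\<^sup>2" .
      have 2: "c1 * (W s)\<^sup>2 \<le> f' (b s) * (W s)\<^sup>2" using f'c by (intro mult_right_mono) auto
      have 3: "c1 * d\<^sup>2 \<le> c1 * (W s)\<^sup>2" using \<open>d\<^sup>2 < (W s)\<^sup>2\<close> c1 by (intro mult_left_mono) auto
      have "H' s = 2 * (W s * y' s) - 2 * (f' (b s) * (W s)\<^sup>2)"
        by (simp add: H'_def power2_eq_square algebra_simps)
      then show "H' s \<le> - (c1 * d\<^sup>2)" using 1 2 3 by linarith
    qed (use \<tau> c1 in auto)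
    then have "\<bar>W t\<bar> \<le> d" using d by (metis abs_le_square_iff abs_of_pos)
    moreover have "q \<le> b t"
    proof -
      have "s0 / 2 / \<epsilon> > 0" using s0 \<epsilon>' by simp
      then show ?thesis using b_v[of t] t hw half v by linarith
    qed
    ultimately show ?thesis by (simp add: W_def)
  qed
  then show ?thesis using \<eta>(1) by blast
qed

end

text \<open>Half a period of the oscillation, of length \<open>T / 2\<close>: near its maximum at time \<open>c\<close> the forcing is
  almost constant while the solution jumps from the fold \<open>p\<close> to \<open>qh\<close>; then the solution follows the
  outer branch down to the fold \<open>q\<close>.\<close>

definition profile where
  "profile f p q qh d \<sigma> T y c b \<longleftrightarrow>
     (\<forall>t\<in>{c - \<sigma>..c + \<sigma>}. \<bar>y t - f p\<bar> \<le> (d::real) \<and> p - d \<le> b t \<and> b t \<le> (qh::real) + d) \<and>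
     (\<forall>t\<in>{c + \<sigma>..c + T / 2 - \<sigma>}. \<bar>y t - f (b t)\<bar> \<le> d \<and> q \<le> b t \<and> b t \<le> qh + d) \<and>
     b (c - \<sigma>) \<le> p \<and> qh - d \<le> b (c + \<sigma>) \<and> b (c + T / 2 - \<sigma>) \<le> q + d \<and> 0 \<le> \<sigma> \<and> c + \<sigma> \<le> c + T / 2 - (\<sigma>::real)"

context forced
begin

text \<open>At the edges of the windows \<open>f (b t)\<close> differs from a fold value by at most
  \<open>2 * d'\<close>: one \<open>d'\<close> from the forcing, one from the residual. As
  \<open>f\<close> changes by more than that over distance \<open>d\<close>, closeness of values
  becomes closeness of \<open>b t\<close> to the fold or landing point.\<close>

lemma profile_of_tracking:
  assumes b: "entire_solution y f b" "bounded (range b)"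
    and d: "0 < d" "q \<le> qh - d"
    and d': "0 < d'" "d' \<le> d" "2 * d' < f p - f (p - d)" "2 * d' < f p - f (qh - d)" "2 * d' < f (q + d) - f q"
    and s0: "0 < s0" "s0 \<le> 1" "(f p - f q) * s0\<^sup>2 / 2 \<le> d'"
    and e: "e \<le> (f p - f q) / 2" "e \<le> d'" "2 * e \<le> f (qh + d) - f p"
    and track: "\<And>t. c + s0 / \<epsilon> \<le> t \<Longrightarrow> t \<le> c + T / 2 - s0 / \<epsilon> \<Longrightarrow> q \<le> b t \<and> \<bar>y t - f (b t)\<bar> \<le> d'"
    and before: "b (c - s0 / \<epsilon>) \<le> p" "\<bar>y (c - s0 / \<epsilon>) - f (b (c - s0 / \<epsilon>))\<bar> \<le> d'"
  shows "profile f p q qh d (s0 / \<epsilon>) T y c b"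
proof -
  define \<sigma> where "\<sigma> = s0 / \<epsilon>"
  have \<sigma>: "\<sigma> > 0" "\<epsilon> * \<sigma> = s0" using s0 \<epsilon> by (simp_all add: \<sigma>_def)
  have \<sigma>T: "c + \<sigma> \<le> c + T / 2 - \<sigma>"
  proof -
    have "\<sigma> \<le> 1 / \<epsilon>" unfolding \<sigma>_def using s0 \<epsilon> by (intro divide_right_mono) auto
    moreover have "T / 4 \<ge> 1 / \<epsilon>" using pi_ge_two \<epsilon> by (simp add: T_def divide_simps)
    ultimately show ?thesis by linarith
  qed
  note track' = track[folded \<sigma>_def] and before' = before[folded \<sigma>_def]
  have near: "\<bar>y t - f p\<bar> \<le> d'" if "\<bar>t - c\<bar> \<le> \<sigma>" for t
  proof -
    have "(t - c)\<^sup>2 \<le> \<sigma>\<^sup>2" using that \<sigma> by (metis abs_le_square_iff abs_of_pos)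
    then have "\<epsilon>\<^sup>2 * (t - c)\<^sup>2 \<le> \<epsilon>\<^sup>2 * \<sigma>\<^sup>2" by (intro mult_left_mono) auto
    also have "\<dots> = s0\<^sup>2" unfolding \<sigma>(2)[symmetric] by (simp add: power_mult_distrib)
    finally have "\<epsilon>\<^sup>2 * (t - c)\<^sup>2 \<le> s0\<^sup>2" .
    moreover have "(f p - f q) / 2 + e \<le> f p - f q" using e(1) by argo
    ultimately have "((f p - f q) / 2 + e) * (\<epsilon>\<^sup>2 * (t - c)\<^sup>2) \<le> (f p - f q) * s0\<^sup>2"
      using fq_less_fp by (intro mult_mono) auto
    then have "y t \<ge> f p + e - d'" using y_ge_near[of t] s0(3) by (simp add: mult.assoc)
    then show ?thesis using y_le_max[of t] e(2) forced.e[OF forced_axioms] by (simp add: abs_le_iff)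
  qed
  have le_qh: "b t \<le> qh + d" for t
  proof (rule bounded_le_of_absorbing[OF b(2) forced.e[OF forced_axioms] entire_solutionD[OF b(1)]])
    show "y t - f (b t) \<le> - e" if "qh + d < b t" for t
      using f_mono_right[of "qh + d" "b t"] that d qh y_le_max[of t] e(3) by simp
  qed
  have ge_p: "b (c - \<sigma>) \<ge> p - d"
  proof (rule ccontr)
    assume "\<not> b (c - \<sigma>) \<ge> p - d"
    then have "f (b (c - \<sigma>)) \<le> f (p - d)" using d by (intro f_mono_left) auto
    then show False using before'(2) near[of "c - \<sigma>"] \<sigma> d'(3) by (simp add: abs_le_iff)
  qed
  have window: "b t \<ge> p - d" if t: "c - \<sigma> \<le> t" "t \<le> c + \<sigma>" for t
  proof (rule constant_lower_barrier[OF b(1) t(1) ge_p])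
    fix s assume "c - \<sigma> \<le> s" "s \<le> t"
    then have "\<bar>y s - f p\<bar> \<le> d'" using t by (intro near) (simp add: abs_le_iff)
    then show "f (p - d) \<le> y s" using d' by (simp add: abs_le_iff)
  qed
  have B: "b (c + \<sigma>) \<ge> qh - d"
  proof (rule ccontr)
    assume "\<not> b (c + \<sigma>) \<ge> qh - d"
    then have "f (b (c + \<sigma>)) \<le> f (qh - d)" using track'[of "c + \<sigma>"] \<sigma>T by (intro f_mono_right) auto
    then show False using track'[of "c + \<sigma>"] \<sigma>T near[of "c + \<sigma>"] \<sigma> d'(4) by (simp add: abs_le_iff)
  qed
  have C: "b (c + T / 2 - \<sigma>) \<le> q + d"
  proof (rule ccontr)
    assume "\<not> b (c + T / 2 - \<sigma>) \<le> q + d"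
    then have 1: "f (q + d) \<le> f (b (c + T / 2 - \<sigma>))" using d by (intro f_mono_right) auto
    interpret mir: forced "\<lambda>x. - f (- x)" "\<lambda>x. f' (- x)" "- q" "- p" "- qh" "- ph" L K
      "\<lambda>t. - y t" "c + T / 2" \<epsilon> e by (rule forced_mirror)
    have "- y (c + T / 2 - \<sigma>) \<ge> - f q + e - ((- f q - - f p) / 2 + e) * \<epsilon>\<^sup>2 * \<sigma>\<^sup>2 / 2"
      using mir.y_ge_near[of "c + T / 2 - \<sigma>"] by simp
    moreover have "((- f q - - f p) / 2 + e) * \<epsilon>\<^sup>2 * \<sigma>\<^sup>2 \<le> (f p - f q) * s0\<^sup>2"
    proof -
      have "\<epsilon>\<^sup>2 * \<sigma>\<^sup>2 = s0\<^sup>2" unfolding \<sigma>(2)[symmetric] by (simp add: power_mult_distrib)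
      moreover have "(- f q - - f p) / 2 + e \<le> f p - f q" using e(1) by argo
      ultimately have "((- f q - - f p) / 2 + e) * (\<epsilon>\<^sup>2 * \<sigma>\<^sup>2) \<le> (f p - f q) * s0\<^sup>2"
        using fq_less_fp by (intro mult_mono) auto
      then show ?thesis by (simp add: mult.assoc)
    qed
    ultimately have "y (c + T / 2 - \<sigma>) \<le> f q + d'" using s0(3) forced.e[OF forced_axioms] by linarith
    moreover have "f (b (c + T / 2 - \<sigma>)) \<le> y (c + T / 2 - \<sigma>) + d'"
      using track'[of "c + T / 2 - \<sigma>"] \<sigma>T by (simp add: abs_le_iff)
    ultimately show False using 1 d'(5) by linarith
  qed
  show ?thesis
    unfolding profile_def \<sigma>_def[symmetric]
  proof (intro conjI ballI)
    fix t assume t: "t \<in> {c - \<sigma>..c + \<sigma>}"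
    then have "\<bar>t - c\<bar> \<le> \<sigma>" by (simp add: abs_le_iff)
    then show "\<bar>y t - f p\<bar> \<le> d" using near[of t] d'(2) by simp
    show "p - d \<le> b t" using window t by simp
    show "b t \<le> qh + d" by (rule le_qh)
  next
    fix t assume "t \<in> {c + \<sigma>..c + T / 2 - \<sigma>}"
    then show "\<bar>y t - f (b t)\<bar> \<le> d" "q \<le> b t" using track'[of t] d'(2) by auto
    show "b t \<le> qh + d" by (rule le_qh)
  qed (use before' B C \<sigma> \<sigma>T in auto)
qed

end

context S_shape
begin

lemma profiles_exist:
  assumes d: "0 < d" "d \<le> qh - q" "d \<le> p - ph"
  shows "\<exists>\<eta>>0. \<forall>y c \<epsilon> e b. forced f f' p q ph qh L K y c \<epsilon> e \<longrightarrow> e \<le> \<eta> \<longrightarrow> \<epsilon> \<le> \<eta> * e \<longrightarrow>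
     entire_solution y f b \<longrightarrow> bounded (range b) \<longrightarrow>
     (\<exists>\<sigma>. profile f p q qh d \<sigma> (forced.T \<epsilon>) y c b \<and>
       profile (\<lambda>x. - f (- x)) (- q) (- p) (- ph) d \<sigma> (forced.T \<epsilon>) (\<lambda>t. - y t) (c + forced.T \<epsilon> / 2) (\<lambda>t. - b t))"
proof -
  interpret m: S_shape "\<lambda>x. - f (- x)" "\<lambda>x. f' (- x)" "- q" "- p" "- qh" "- ph" L K by (rule mirror)
  define D where "D = f p - f q"
  have D: "D > 0" using fq_less_fp by (simp add: D_def)
  have gaps: "f p - f (p - d) > 0" "f p - f (qh - d) > 0" "f (q + d) - f q > 0" "f (ph + d) - f q > 0"
    "f (qh + d) - f p > 0" "f q - f (ph - d) > 0"
    using f_strict_left[of "p - d" p] f_strict_right[of "qh - d" qh] f_strict_right[of q "q + d"]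
      f_strict_left[of ph "ph + d"] f_strict_right[of qh "qh + d"] f_strict_left[of "ph - d" ph] d qh ph by auto
  define G where "G = min (min (f p - f (p - d)) (f p - f (qh - d))) (min (f (q + d) - f q) (f (ph + d) - f q))"
  define G2 where "G2 = min (f (qh + d) - f p) (f q - f (ph - d))"
  have G: "G > 0" "G \<le> f p - f (p - d)" "G \<le> f p - f (qh - d)" "G \<le> f (q + d) - f q" "G \<le> f (ph + d) - f q"
    and G2: "G2 > 0" "G2 \<le> f (qh + d) - f p" "G2 \<le> f q - f (ph - d)"
    using gaps by (auto simp: G_def G2_def)
  define d' where "d' = min d (G / 3)"
  have d': "0 < d'" "d' \<le> d" "2 * d' < G" using d G by (auto simp: d'_def min_def)
  \<comment> \<open>Small enough for the forcing to stay within \<open>d'\<close> of the fold value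
    during the whole window of half width \<open>s0 / \<epsilon>\<close>.\<close>
  define s0 where "s0 = min 1 (sqrt (2 * d' / D))"
  have s0: "0 < s0" "s0 \<le> 1" "D * s0\<^sup>2 / 2 \<le> d'"
  proof -
    show "0 < s0" "s0 \<le> 1" using d' D by (simp_all add: s0_def)
    have "s0\<^sup>2 \<le> (sqrt (2 * d' / D))\<^sup>2" using \<open>0 < s0\<close> by (intro power_mono) (auto simp: s0_def)
    also have "\<dots> = 2 * d' / D" using d' D by simp
    finally show "D * s0\<^sup>2 / 2 \<le> d'" using D by (simp add: pos_le_divide_eq mult.commute)
  qed
  obtain \<eta>1 where 1: "\<eta>1 > 0" "\<And>y c \<epsilon> e b t. forced f f' p q ph qh L K y c \<epsilon> e \<Longrightarrow> e \<le> \<eta>1 \<Longrightarrow> \<epsilon> \<le> \<eta>1 * e \<Longrightarrow>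
     entire_solution y f b \<Longrightarrow> bounded (range b) \<Longrightarrow>
     c + s0 / \<epsilon> \<le> t \<Longrightarrow> t \<le> c + forced.T \<epsilon> / 2 - s0 / \<epsilon> \<Longrightarrow> q \<le> b t \<and> \<bar>y t - f (b t)\<bar> \<le> d'"
    using tracking[OF d'(1) s0(1,2)] by blast
  obtain \<eta>2 where 2: "\<eta>2 > 0" "\<And>y c \<epsilon> e b t.
     forced (\<lambda>x. - f (- x)) (\<lambda>x. f' (- x)) (- q) (- p) (- qh) (- ph) L K y c \<epsilon> e \<Longrightarrow> e \<le> \<eta>2 \<Longrightarrow> \<epsilon> \<le> \<eta>2 * e \<Longrightarrow>
     entire_solution y (\<lambda>x. - f (- x)) b \<Longrightarrow> bounded (range b) \<Longrightarrow>
     c + s0 / \<epsilon> \<le> t \<Longrightarrow> t \<le> c + forced.T \<epsilon> / 2 - s0 / \<epsilon> \<Longrightarrow> - p \<le> b t \<and> \<bar>y t - - f (- b t)\<bar> \<le> d'"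
    using m.tracking[OF d'(1) s0(1,2)] by blast
  define \<eta> where "\<eta> = min (min \<eta>1 \<eta>2) (min (D / 2) (min d' (G2 / 2)))"
  have \<eta>: "\<eta> > 0" "\<eta> \<le> \<eta>1" "\<eta> \<le> \<eta>2" "\<eta> \<le> D / 2" "\<eta> \<le> d'" "\<eta> \<le> G2 / 2"
    using 1(1) 2(1) D d' G2 by (auto simp: \<eta>_def)
  have main: "profile f p q qh d (s0 / \<epsilon>) (forced.T \<epsilon>) y c b \<and>
       profile (\<lambda>x. - f (- x)) (- q) (- p) (- ph) d (s0 / \<epsilon>) (forced.T \<epsilon>) (\<lambda>t. - y t) (c + forced.T \<epsilon> / 2) (\<lambda>t. - b t)"
    if fo: "forced f f' p q ph qh L K y c \<epsilon> e" and e: "e \<le> \<eta>" and \<epsilon>: "\<epsilon> \<le> \<eta> * e"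
      and b: "entire_solution y f b" "bounded (range b)" for y c \<epsilon> e b
  proof -
    interpret w: forced f f' p q ph qh L K y c \<epsilon> e by (rule fo)
    interpret n: forced "\<lambda>x. - f (- x)" "\<lambda>x. f' (- x)" "- q" "- p" "- qh" "- ph" L K
      "\<lambda>t. - y t" "c + w.T / 2" \<epsilon> e by (rule w.forced_mirror)
    interpret w1: forced f f' p q ph qh L K y "c + of_int (- 1) * w.T" \<epsilon> e by (rule w.forced_shift)
    have \<epsilon>12: "\<epsilon> \<le> \<eta>1 * e" "\<epsilon> \<le> \<eta>2 * e"
      using \<epsilon> \<eta>(2,3) w.e by (meson mult_right_mono order_trans less_imp_le)+
    have e12: "e \<le> \<eta>1" "e \<le> \<eta>2" using e \<eta> by auto
    have mb: "entire_solution (\<lambda>t. - y t) (\<lambda>x. - f (- x)) (\<lambda>t. - b t)" "bounded (range (\<lambda>t. - b t))"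
      using w.solution_mirror[OF b(1)] b(2) by (auto simp: bounded_iff)
    have e': "e \<le> (f p - f q) / 2" "e \<le> d'" "2 * e \<le> G2" using e \<eta> by (auto simp: D_def)
    have \<sigma>0: "s0 / \<epsilon> > 0" "s0 / \<epsilon> \<le> w.T / 4"
    proof -
      show "s0 / \<epsilon> > 0" using s0 w.\<epsilon> by simp
      have "s0 / \<epsilon> \<le> 1 / \<epsilon>" using s0 w.\<epsilon> by (intro divide_right_mono) auto
      moreover have "w.T / 4 \<ge> 1 / \<epsilon>" using pi_ge_two w.\<epsilon> by (simp add: w.T_def divide_simps)
      ultimately show "s0 / \<epsilon> \<le> w.T / 4" by linarith
    qed
    have tr: "q \<le> b t \<and> \<bar>y t - f (b t)\<bar> \<le> d'" if "c + s0 / \<epsilon> \<le> t" "t \<le> c + w.T / 2 - s0 / \<epsilon>" for t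
      by (rule 1(2)[OF fo e12(1) \<epsilon>12(1) b that])
    have tr_m: "b t \<le> p \<and> \<bar>y t - f (b t)\<bar> \<le> d'"
      if "c + w.T / 2 + s0 / \<epsilon> \<le> t" "t \<le> c + w.T / 2 + w.T / 2 - s0 / \<epsilon>" for t
      using 2(2)[OF w.forced_mirror e12(2) \<epsilon>12(2) mb that] by (simp add: abs_minus_commute)
    have tr_b: "b t \<le> p \<and> \<bar>y t - f (b t)\<bar> \<le> d'"
      if "c + of_int (- 1) * w.T + w.T / 2 + s0 / \<epsilon> \<le> t" "t \<le> c + of_int (- 1) * w.T + w.T / 2 + w.T / 2 - s0 / \<epsilon>" for t
      using 2(2)[OF w1.forced_mirror e12(2) \<epsilon>12(2) mb that] by (simp add: abs_minus_commute)
    \<comment> \<open>The time \<open>c - s0 / \<epsilon>\<close> ends the stretch along the left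
      branch that began after the preceding minimum, which is why the reflected system is also taken
      one period earlier.\<close>
    have bef: "b (c - s0 / \<epsilon>) \<le> p \<and> \<bar>y (c - s0 / \<epsilon>) - f (b (c - s0 / \<epsilon>))\<bar> \<le> d'"
    proof (rule tr_b)
      have eq: "c + of_int (- 1) * w.T + w.T / 2 = c - w.T / 2" "c - w.T / 2 + w.T / 2 = c" by simp_all
      show "c + of_int (- 1) * w.T + w.T / 2 + s0 / \<epsilon> \<le> c - s0 / \<epsilon>" unfolding eq using \<sigma>0 by linarith
      show "c - s0 / \<epsilon> \<le> c + of_int (- 1) * w.T + w.T / 2 + w.T / 2 - s0 / \<epsilon>" unfolding eq by simp
    qed
    have "profile f p q qh d (s0 / \<epsilon>) w.T y c b"
      by (rule w.profile_of_tracking[where d' = d'])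
         (use b d d' G G2 s0 e' tr bef in \<open>auto simp: D_def\<close>)
    moreover have "profile (\<lambda>x. - f (- x)) (- q) (- p) (- ph) d (s0 / \<epsilon>) w.T (\<lambda>t. - y t) (c + w.T / 2) (\<lambda>t. - b t)"
    proof (rule n.profile_of_tracking[where d' = d'])
      show "- p \<le> - ph - d" using d by simp
      show "2 * d' < - f (- (- q)) - - f (- (- q - d))" using d' G by (simp add: add.commute)
      show "2 * d' < - f (- (- q)) - - f (- (- ph - d))" using d' G by (simp add: add.commute)
      show "2 * d' < - f (- (- p + d)) - - f (- (- p))" using d' G by simp
      show "(- f (- (- q)) - - f (- (- p))) * s0\<^sup>2 / 2 \<le> d'" using s0 by (simp add: D_def)
      show "e \<le> (- f (- (- q)) - - f (- (- p))) / 2" using e' by simp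
      show "2 * e \<le> - f (- (- ph + d)) - - f (- (- q))" using e' G2 by simp
      show "- p \<le> - b t \<and> \<bar>- y t - - f (- (- b t))\<bar> \<le> d'"
        if "c + w.T / 2 + s0 / \<epsilon> \<le> t" "t \<le> c + w.T / 2 + w.T / 2 - s0 / \<epsilon>" for t
        using tr_m[OF that] by (simp add: abs_minus_commute)
      have t0: "c + s0 / \<epsilon> \<le> c + w.T / 2 - s0 / \<epsilon>" using \<sigma>0 by linarith
      show "- b (c + w.T / 2 - s0 / \<epsilon>) \<le> - q" using tr[OF t0 order_refl] by simp
      show "\<bar>- y (c + w.T / 2 - s0 / \<epsilon>) - - f (- (- b (c + w.T / 2 - s0 / \<epsilon>)))\<bar> \<le> d'"
        using tr[OF t0 order_refl] by (simp add: abs_minus_commute)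
    qed (use mb d d' s0 e' in auto)
    ultimately show ?thesis ..
  qed
  show ?thesis
  proof (rule exI[of _ \<eta>], rule conjI[OF \<eta>(1)], intro allI impI)
    fix y c \<epsilon> e b
    assume "forced f f' p q ph qh L K y c \<epsilon> e" "e \<le> \<eta>" "\<epsilon> \<le> \<eta> * e" "entire_solution y f b" "bounded (range b)"
    from main[OF this] show "\<exists>\<sigma>. profile f p q qh d \<sigma> (forced.T \<epsilon>) y c b \<and>
       profile (\<lambda>x. - f (- x)) (- q) (- p) (- ph) d \<sigma> (forced.T \<epsilon>) (\<lambda>t. - y t) (c + forced.T \<epsilon> / 2) (\<lambda>t. - b t)"
      by (rule exI)
  qed
qed

end

text \<open>The right branch and the jump segment leading to it; the other half of the limit curve
  is the point reflection of this set for the reflected field.\<close>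

definition half_curve where
  "half_curve f p q qh = {(f x, x) | x. x \<in> {q..qh}} \<union> {f p} \<times> {p..(qh::real)}"

lemma half_curve_near:
  fixes f b y :: "real \<Rightarrow> real"
  assumes pr: "profile f p q qh d \<sigma> T y c b" and d: "0 < d" and pq: "p \<le> q" "q \<le> qh"
    and lip: "\<And>u v. \<bar>f u - f v\<bar> \<le> L * \<bar>u - v\<bar>" and L: "0 \<le> L"
    and t: "c - \<sigma> \<le> t" "t \<le> c + T / 2 - \<sigma>"
  shows "\<exists>P\<in>half_curve f p q qh. \<bar>y t - fst P\<bar> + \<bar>b t - snd P\<bar> \<le> (2 + L) * d"
proof (cases "t \<le> c + \<sigma>")
  case True
  then have b: "\<bar>y t - f p\<bar> \<le> d" "p - d \<le> b t" "b t \<le> qh + d"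
    using pr t unfolding profile_def by auto
  define v where "v = max p (min qh (b t))"
  have v: "p \<le> v" "v \<le> qh" "\<bar>b t - v\<bar> \<le> d" using b pq d by (auto simp: v_def max_def min_def abs_le_iff)
  then have "(f p, v) \<in> half_curve f p q qh" by (simp add: half_curve_def)
  moreover have "0 \<le> L * d" using L d by simp
  ultimately show ?thesis using b v by (intro bexI[of _ "(f p, v)"]) (auto simp: distrib_right)
next
  case False
  then have b: "\<bar>y t - f (b t)\<bar> \<le> d" "q \<le> b t" "b t \<le> qh + d"
    using pr t unfolding profile_def by auto
  define v where "v = min (b t) qh"
  have v: "q \<le> v" "v \<le> qh" "\<bar>b t - v\<bar> \<le> d" using b pq d by (auto simp: v_def min_def abs_le_iff)
  have "L * \<bar>b t - v\<bar> \<le> L * d" using v L by (intro mult_left_mono) auto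
  then have "\<bar>y t - f v\<bar> \<le> d + L * d" using b(1) lip[of "b t" v] by linarith
  moreover have "(f v, v) \<in> half_curve f p q qh" using v by (auto simp: half_curve_def)
  ultimately show ?thesis using v(3) by (intro bexI[of _ "(f v, v)"]) (auto simp: distrib_right)
qed

text \<open>By the intermediate value theorem the jump attains every height in
  \<open>{p..qh - d}\<close> and the branch every height in \<open>{q + d..qh - d}\<close>; the
  other points of the curve are first moved by at most \<open>d\<close>.\<close>

lemma half_curve_reached:
  fixes f b y :: "real \<Rightarrow> real"
  assumes pr: "profile f p q qh d \<sigma> T y c b" and d: "0 < d" "2 * d \<le> qh - q" and pq: "p \<le> q"
    and lip: "\<And>u v. \<bar>f u - f v\<bar> \<le> L * \<bar>u - v\<bar>" and L: "0 \<le> L" and cont: "continuous_on UNIV b"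
    and P: "P \<in> half_curve f p q qh"
  shows "\<exists>t. \<bar>y t - fst P\<bar> + \<bar>b t - snd P\<bar> \<le> (2 + L) * d"
proof -
  have ends: "b (c - \<sigma>) \<le> p" "qh - d \<le> b (c + \<sigma>)" "b (c + T / 2 - \<sigma>) \<le> q + d" "0 \<le> \<sigma>" "c + \<sigma> \<le> c + T / 2 - \<sigma>"
    using pr unfolding profile_def by auto
  have Ld: "0 \<le> L * d" using L d by simp
  consider v where "P = (f p, v)" "p \<le> v" "v \<le> qh" | v where "P = (f v, v)" "q \<le> v" "v \<le> qh"
    using P by (auto simp: half_curve_def)
  then show ?thesis
  proof cases
    case 1
    define v' where "v' = min v (qh - d)"
    have v': "p \<le> v'" "v' \<le> qh - d" "\<bar>v' - v\<bar> \<le> d" using 1 d pq by (auto simp: v'_def min_def abs_le_iff)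
    have "\<exists>t\<ge>c - \<sigma>. t \<le> c + \<sigma> \<and> b t = v'"
      by (rule IVT') (use ends v' in \<open>auto intro: continuous_on_subset[OF cont]\<close>)
    then obtain t where t: "c - \<sigma> \<le> t" "t \<le> c + \<sigma>" "b t = v'" by blast
    then have "\<bar>y t - f p\<bar> \<le> d" using pr unfolding profile_def by auto
    then show ?thesis using 1(1) t(3) v' Ld by (intro exI[of _ t]) (auto simp: distrib_right)
  next
    case 2
    define v' where "v' = max (q + d) (min v (qh - d))"
    have v': "q + d \<le> v'" "v' \<le> qh - d" "\<bar>v' - v\<bar> \<le> d" using 2 d by (auto simp: v'_def min_def max_def abs_le_iff)
    have "\<exists>t\<ge>c + \<sigma>. t \<le> c + T / 2 - \<sigma> \<and> b t = v'"
      by (rule IVT2') (use ends v' in \<open>auto intro: continuous_on_subset[OF cont]\<close>)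
    then obtain t where t: "c + \<sigma> \<le> t" "t \<le> c + T / 2 - \<sigma>" "b t = v'" by blast
    then have "\<bar>y t - f v'\<bar> \<le> d" using pr unfolding profile_def by auto
    moreover have "L * \<bar>v' - v\<bar> \<le> L * d" using v' L by (intro mult_left_mono) auto
    ultimately have "\<bar>y t - f v\<bar> \<le> d + L * d" using lip[of v' v] by linarith
    then show ?thesis using 2(1) t(3) v' by (intro exI[of _ t]) (auto simp: distrib_right)
  qed
qed

lemma dist_le_sum: "dist (a, b) P \<le> \<bar>a - fst P\<bar> + \<bar>b - snd P\<bar>" for a b :: real
  by (cases P) (simp add: dist_Pair_Pair dist_real_def sqrt_sum_squares_le_sum_abs)

text \<open>The bound \<open>C\<close> also makes the suprema bounded; the nonnegativity relies on
  this.\<close>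

lemma hausdorff_distance_le:
  assumes A: "A \<noteq> {}" and B: "B \<noteq> {}"
    and AB: "\<And>a. a \<in> A \<Longrightarrow> \<exists>b\<in>B. dist a b \<le> C" and BA: "\<And>b. b \<in> B \<Longrightarrow> \<exists>a\<in>A. dist b a \<le> C"
  shows "0 \<le> hausdorff_distance A B" "hausdorff_distance A B \<le> C"
proof -
  have 1: "infdist a B \<le> C" if "a \<in> A" for a using AB[OF that] infdist_le2 by blast
  have 2: "infdist b A \<le> C" if "b \<in> B" for b using BA[OF that] infdist_le2 by blast
  have "(SUP a\<in>A. infdist a B) \<le> C" using A 1 by (intro cSUP_least) auto
  moreover have "(SUP b\<in>B. infdist b A) \<le> C" using B 2 by (intro cSUP_least) auto
  ultimately show "hausdorff_distance A B \<le> C" by (simp add: hausdorff_distance_def)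
  obtain a where "a \<in> A" using A by blast
  have "0 \<le> infdist a B" by (rule infdist_nonneg)
  also have "\<dots> \<le> (SUP a\<in>A. infdist a B)"
    by (rule cSUP_upper[OF \<open>a \<in> A\<close> bdd_aboveI2[OF 1]])
  finally show "0 \<le> hausdorff_distance A B" by (simp add: hausdorff_distance_def)
qed

context forced
begin

text \<open>Modulo \<open>T\<close> every time lies in the period starting at
  \<open>c - \<sigma>\<close>, whose two halves are covered by the two profiles.\<close>

lemma curve_hausdorff:
  assumes pr: "profile f p q qh d \<sigma> T y c b"
    and pr': "profile (\<lambda>x. - f (- x)) (- q) (- p) (- ph) d \<sigma> T (\<lambda>t. - y t) (c + T / 2) (\<lambda>t. - b t)"
    and d: "0 < d" "2 * d \<le> qh - q" "2 * d \<le> p - ph"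
    and b: "continuous_on UNIV b" "\<And>t. b (t + T) = b t"
    and \<Gamma>: "\<Gamma> = half_curve f p q qh \<union> (\<lambda>P. - P) ` half_curve (\<lambda>x. - f (- x)) (- q) (- p) (- ph)"
  shows "0 \<le> hausdorff_distance (range (\<lambda>t. (y t, b t))) \<Gamma>"
    "hausdorff_distance (range (\<lambda>t. (y t, b t))) \<Gamma> \<le> (2 + L) * d"
proof -
  let ?f = "\<lambda>x. - f (- x)"
  have lip': "\<bar>?f u - ?f v\<bar> \<le> L * \<bar>u - v\<bar>" for u v using f_lip[of "- u" "- v"] by (simp add: abs_minus_commute)
  have minus: "\<bar>- u - fst P\<bar> + \<bar>- v - snd P\<bar> = \<bar>u - fst (- P)\<bar> + \<bar>v - snd (- P)\<bar>" for u v and P :: "real \<times> real"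
    by (simp add: abs_if)
  have near: "\<exists>P\<in>\<Gamma>. dist (y t, b t) P \<le> (2 + L) * d" for t
  proof -
    obtain k where k: "c - \<sigma> \<le> t + of_int k * T" "t + of_int k * T < c - \<sigma> + T"
      using periodic_representative[OF T_pos] by blast
    define s where "s = t + of_int k * T"
    have ys: "y s = y t" unfolding s_def by (rule periodic_int) (rule y_periodic)
    have bs: "b s = b t" unfolding s_def by (rule periodic_int[of b]) (rule b(2))
    have "\<exists>P\<in>\<Gamma>. \<bar>y s - fst P\<bar> + \<bar>b s - snd P\<bar> \<le> (2 + L) * d"
    proof (cases "s \<le> c + T / 2 - \<sigma>")
      case True
      then have "\<exists>P\<in>half_curve f p q qh. \<bar>y s - fst P\<bar> + \<bar>b s - snd P\<bar> \<le> (2 + L) * d"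
        using k p_less_q qh L by (intro half_curve_near[OF pr d(1) _ _ f_lip]) (auto simp: s_def)
      then show ?thesis unfolding \<Gamma> by blast
    next
      case False
      have "\<exists>P\<in>half_curve ?f (- q) (- p) (- ph). \<bar>- y s - fst P\<bar> + \<bar>- b s - snd P\<bar> \<le> (2 + L) * d"
        using k False p_less_q ph L by (intro half_curve_near[OF pr' d(1) _ _ lip']) (auto simp: s_def)
      then obtain P where P: "P \<in> half_curve ?f (- q) (- p) (- ph)"
        "\<bar>y s - fst (- P)\<bar> + \<bar>b s - snd (- P)\<bar> \<le> (2 + L) * d" unfolding minus by blast
      then show ?thesis unfolding \<Gamma> by (intro bexI[of _ "- P"]) auto
    qed
    then obtain P where "P \<in> \<Gamma>" "\<bar>y t - fst P\<bar> + \<bar>b t - snd P\<bar> \<le> (2 + L) * d" unfolding ys bs by blast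
    then show ?thesis using dist_le_sum[of "y t" "b t" P] by (intro bexI[of _ P]) auto
  qed
  have reached: "\<exists>t. dist P (y t, b t) \<le> (2 + L) * d" if P: "P \<in> \<Gamma>" for P
  proof -
    have "\<exists>t. \<bar>y t - fst P\<bar> + \<bar>b t - snd P\<bar> \<le> (2 + L) * d"
    proof (cases "P \<in> half_curve f p q qh")
      case True
      show ?thesis by (rule half_curve_reached[OF pr d(1,2) _ f_lip _ b(1) True]) (use p_less_q L in auto)
    next
      case False
      then obtain P' where P': "P = - P'" "P' \<in> half_curve ?f (- q) (- p) (- ph)" using P \<Gamma> by blast
      have "\<exists>t. \<bar>- y t - fst P'\<bar> + \<bar>- b t - snd P'\<bar> \<le> (2 + L) * d"
        by (rule half_curve_reached[OF pr' d(1) _ _ lip' _ _ P'(2)])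
           (use p_less_q L d(3) b(1) in \<open>auto intro!: continuous_on_minus\<close>)
      then show ?thesis unfolding minus P'(1) .
    qed
    then obtain t where "\<bar>y t - fst P\<bar> + \<bar>b t - snd P\<bar> \<le> (2 + L) * d" by blast
    then show ?thesis using dist_le_sum[of "y t" "b t" P] by (intro exI[of _ t]) (simp add: dist_commute)
  qed
  have "(f p, p) \<in> \<Gamma>" using \<Gamma> p_less_q qh by (auto simp: half_curve_def)
  then have ne: "\<Gamma> \<noteq> {}" by blast
  show "0 \<le> hausdorff_distance (range (\<lambda>t. (y t, b t))) \<Gamma>"
    "hausdorff_distance (range (\<lambda>t. (y t, b t))) \<Gamma> \<le> (2 + L) * d"
    using hausdorff_distance_le[of "range (\<lambda>t. (y t, b t))" \<Gamma> "(2 + L) * d"] ne near reached by blast+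
qed

end

section \<open>The field of the theorem\<close>

text \<open>On \<open>{0..}\<close> this is \<open>- gbar c\<close>; to the left of \<open>0\<close> it is continued linearly, which makes it
  globally Lipschitz and continuously differentiable.\<close>

definition field :: "real \<Rightarrow> real \<Rightarrow> real" where
  "field c x = (1 + 2 * c) * x - 2 * c * (if x \<ge> 0 then x ^ 3 / (1 + x\<^sup>2) else 0)"

text \<open>The derivative of \<open>x / (1 + x\<^sup>2)\<close> evaluated at the positive part; at
  0 it equals 1, matching the slope \<open>1 + 2 * c\<close> of the linear continuation.\<close>

definition field' :: "real \<Rightarrow> real \<Rightarrow> real" where
  "field' c x = 1 + 2 * c * ((1 - (max x 0)\<^sup>2) / (1 + (max x 0)\<^sup>2)\<^sup>2)"

lemma one_plus_square_pos: "1 + x\<^sup>2 > 0" for x :: real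
  by (simp add: add_pos_nonneg)

lemma field_nonneg: "x \<ge> 0 \<Longrightarrow> field c x = x + 2 * c * (x / (1 + x\<^sup>2))"
proof -
  assume "x \<ge> 0"
  have "x ^ 3 / (1 + x\<^sup>2) = x - x / (1 + x\<^sup>2)"
  proof -
    have "x ^ 3 = x * (1 + x\<^sup>2) - x" by (simp add: algebra_simps power2_eq_square power3_eq_cube)
    then show ?thesis using one_plus_square_pos[of x] by (simp add: diff_divide_distrib)
  qed
  with \<open>x \<ge> 0\<close> have "field c x = (1 + 2 * c) * x - 2 * c * (x - x / (1 + x\<^sup>2))" by (simp only: field_def if_True)
  also have "\<dots> = x + 2 * c * (x / (1 + x\<^sup>2))" unfolding right_diff_distrib distrib_right by simp
  finally show ?thesis .
qed

lemma field_nonpos: "x \<le> 0 \<Longrightarrow> field c x = (1 + 2 * c) * x"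
  by (cases "x = 0") (auto simp: field_def)

lemma gbar_eq_field: "x \<ge> 0 \<Longrightarrow> gbar c x = - field c x"
  by (simp add: gbar_def field_nonneg)

lemma field_deriv: "(field c has_real_derivative field' c x) (at x)"
proof -
  define h :: "real \<Rightarrow> real" where "h x = (if x \<ge> 0 then x ^ 3 / (1 + x\<^sup>2) else 0)" for x
  have h: "(h has_real_derivative 1 - (1 - (max x 0)\<^sup>2) / (1 + (max x 0)\<^sup>2)\<^sup>2) (at x)"
  proof -
    consider "x > 0" | "x = 0" | "x < 0" by linarith
    then show ?thesis
    proof cases
      case 1
      have "((\<lambda>x. x ^ 3 / (1 + x\<^sup>2)) has_real_derivative
          (3 * x\<^sup>2 * (1 + x\<^sup>2) - x ^ 3 * (2 * x)) / ((1 + x\<^sup>2) * (1 + x\<^sup>2))) (at x)"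
      proof (rule DERIV_divide)
        show "((\<lambda>x. x ^ 3) has_real_derivative 3 * x\<^sup>2) (at x)" using DERIV_pow[of 3 x] by simp
        show "((\<lambda>x. 1 + x\<^sup>2) has_real_derivative 2 * x) (at x)" by (auto intro!: derivative_eq_intros)
        show "1 + x\<^sup>2 \<noteq> 0" using one_plus_square_pos[of x] by simp
      qed
      moreover have "(3 * x\<^sup>2 * (1 + x\<^sup>2) - x ^ 3 * (2 * x)) / ((1 + x\<^sup>2) * (1 + x\<^sup>2))
          = 1 - (1 - (max x 0)\<^sup>2) / (1 + (max x 0)\<^sup>2)\<^sup>2"
      proof -
        have "1 + x\<^sup>2 \<noteq> 0" using one_plus_square_pos[of x] by simp
        moreover have "3 * x\<^sup>2 * (1 + x\<^sup>2) - x ^ 3 * (2 * x) = (1 + x\<^sup>2) * (1 + x\<^sup>2) - (1 - x\<^sup>2)"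
          by (simp add: algebra_simps power2_eq_square power3_eq_cube)
        ultimately have "(3 * x\<^sup>2 * (1 + x\<^sup>2) - x ^ 3 * (2 * x)) / ((1 + x\<^sup>2) * (1 + x\<^sup>2))
            = 1 - (1 - x\<^sup>2) / ((1 + x\<^sup>2) * (1 + x\<^sup>2))" by (simp only: diff_divide_distrib) simp
        with 1 show ?thesis by (simp only: max_absorb1[OF less_imp_le] power2_eq_square[of "1 + x\<^sup>2"])
      qed
      ultimately have d: "((\<lambda>x. x ^ 3 / (1 + x\<^sup>2)) has_real_derivative
          1 - (1 - (max x 0)\<^sup>2) / (1 + (max x 0)\<^sup>2)\<^sup>2) (at x)" by (simp only:)
      show ?thesis
        by (rule has_field_derivative_transform_within_open[OF d open_greaterThan[of 0]]) (use 1 in \<open>auto simp: h_def\<close>)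
    next
      case 2
      \<comment> \<open>This is why \<open>h\<close> was split off: it vanishes to third order at 0,
        so its difference quotient is at most \<open>z\<^sup>2\<close> and continuing it by zero
        stays differentiable.\<close>
      have "((\<lambda>z. (h (0 + z) - h 0) / z) \<longlongrightarrow> 0) (at 0)"
      proof (rule Lim_null_comparison[where g = "\<lambda>z. z\<^sup>2"])
        have "norm ((h (0 + z) - h 0) / z) \<le> z\<^sup>2" for z
        proof (cases "z > 0")
          case True
          have "z ^ 3 / (1 + z\<^sup>2) \<le> z ^ 3 / 1" using True one_plus_square_pos[of z] by (intro divide_left_mono) auto
          then show ?thesis using True one_plus_square_pos[of z]
            by (simp add: h_def pos_divide_le_eq power2_eq_square power3_eq_cube)
        qed (auto simp: h_def)
        then show "\<forall>\<^sub>F z in at 0. norm ((h (0 + z) - h 0) / z) \<le> z\<^sup>2" by simp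
        show "((\<lambda>z. z\<^sup>2) \<longlongrightarrow> 0) (at (0::real))" by (auto intro!: tendsto_eq_intros)
      qed
      then show ?thesis using 2 by (simp add: DERIV_def)
    next
      case 3
      have "((\<lambda>x. 0) has_real_derivative 0) (at x)" by simp
      then have "(h has_real_derivative 0) (at x)"
        by (rule has_field_derivative_transform_within_open[where S = "{..<0}"]) (use 3 in \<open>auto simp: h_def\<close>)
      then show ?thesis using 3 by (simp add: max_absorb2)
    qed
  qed
  have "((\<lambda>x. (1 + 2 * c) * x - 2 * c * h x) has_real_derivative
      (1 + 2 * c) * 1 - 2 * c * (1 - (1 - (max x 0)\<^sup>2) / (1 + (max x 0)\<^sup>2)\<^sup>2)) (at x)"
    by (intro DERIV_diff DERIV_cmult DERIV_ident h)
  moreover have "field c = (\<lambda>x. (1 + 2 * c) * x - 2 * c * h x)" by (rule ext) (simp add: field_def h_def)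
  moreover have "(1 + 2 * c) * 1 - 2 * c * (1 - R) = 1 + 2 * c * R" for R by (simp add: algebra_simps)
  ultimately show ?thesis unfolding field'_def by (simp only:)
qed

text \<open>The smooth rational function behind \<open>field'\<close> has derivative at most
  \<open>2 * c * 6\<close>, and taking the positive part of the argument does not increase
  distances.\<close>

lemma field'_lipschitz:
  assumes "c > 0"
  shows "\<bar>field' c u - field' c v\<bar> \<le> 12 * c * \<bar>u - v\<bar>"
proof -
  define g where "g x = 1 + 2 * c * ((1 - x\<^sup>2) / (1 + x\<^sup>2)\<^sup>2)" for x :: real
  define g' where "g' x = 2 * c * ((- 2 * x * (1 + x\<^sup>2)\<^sup>2 - (1 - x\<^sup>2) * (2 * (1 + x\<^sup>2) * (2 * x))) / ((1 + x\<^sup>2)\<^sup>2 * (1 + x\<^sup>2)\<^sup>2))" for x :: real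
  have der: "(g has_real_derivative g' x) (at x)" for x
  proof -
    have "(1 + x\<^sup>2)\<^sup>2 \<noteq> 0" using one_plus_square_pos[of x] by simp
    then show ?thesis unfolding g_def[abs_def] g'_def
      by (auto intro!: derivative_eq_intros) (simp add: algebra_simps)
  qed
  have bound: "\<bar>g' x\<bar> \<le> 12 * c" for x
  proof -
    have s: "1 + x\<^sup>2 > 0" by (rule one_plus_square_pos)
    have eq: "(- 2 * x * (1 + x\<^sup>2)\<^sup>2 - (1 - x\<^sup>2) * (2 * (1 + x\<^sup>2) * (2 * x)))
        = (1 + x\<^sup>2) * (- 2 * x * (3 - x\<^sup>2))"
      by (simp add: algebra_simps power2_eq_square)
    have "0 \<le> (\<bar>x\<bar> - 1)\<^sup>2" by simp
    then have "\<bar>x\<bar> \<le> 1 + x\<^sup>2" by (simp add: power2_eq_square algebra_simps)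
    moreover have "\<bar>3 - x\<^sup>2\<bar> \<le> 3 * (1 + x\<^sup>2)" by (simp add: abs_le_iff)
    ultimately have "\<bar>x\<bar> * \<bar>3 - x\<^sup>2\<bar> \<le> (1 + x\<^sup>2) * (3 * (1 + x\<^sup>2))" using s by (intro mult_mono) auto
    then have "2 * (\<bar>x\<bar> * \<bar>3 - x\<^sup>2\<bar>) \<le> 2 * ((1 + x\<^sup>2) * (3 * (1 + x\<^sup>2)))" by simp
    also have "\<dots> = 6 * ((1 + x\<^sup>2) * (1 + x\<^sup>2))" by simp
    finally have N: "\<bar>- 2 * x * (3 - x\<^sup>2)\<bar> \<le> 6 * (1 + x\<^sup>2)\<^sup>2"
      unfolding abs_mult power2_eq_square[of "1 + x\<^sup>2"] by (simp only: abs_minus_cancel abs_numeral mult.assoc)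
    have gen: "\<bar>S * N / (S\<^sup>2 * S\<^sup>2)\<bar> \<le> 6" if "S \<ge> 1" "\<bar>N\<bar> \<le> 6 * S\<^sup>2" for S N :: real
    proof -
      have "\<bar>S * N\<bar> \<le> S * (6 * S\<^sup>2)" using that by (simp add: abs_mult)
      also have "\<dots> \<le> S\<^sup>2 * (6 * S\<^sup>2)" using that by (intro mult_right_mono) (auto simp: power2_eq_square)
      also have "\<dots> = 6 * (S\<^sup>2 * S\<^sup>2)" by (rule mult.left_commute)
      finally show ?thesis using that(1) unfolding abs_divide by (subst pos_divide_le_eq) auto
    qed
    have "\<bar>(1 + x\<^sup>2) * (- 2 * x * (3 - x\<^sup>2)) / ((1 + x\<^sup>2)\<^sup>2 * (1 + x\<^sup>2)\<^sup>2)\<bar> \<le> 6"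
      by (rule gen[OF _ N]) simp
    then have "2 * c * \<bar>(1 + x\<^sup>2) * (- 2 * x * (3 - x\<^sup>2)) / ((1 + x\<^sup>2)\<^sup>2 * (1 + x\<^sup>2)\<^sup>2)\<bar> \<le> 2 * c * 6"
      using assms by (intro mult_left_mono) auto
    then show ?thesis unfolding g'_def eq abs_mult[of "2 * c"] using assms by simp
  qed
  have "norm (g (max u 0) - g (max v 0)) \<le> 12 * c * norm (max u 0 - max v 0)"
    by (rule field_differentiable_bound[where S = UNIV and f' = g'])
       (use der bound in \<open>auto intro: has_field_derivative_at_within\<close>)
  also have "\<dots> \<le> 12 * c * \<bar>u - v\<bar>" using assms by (intro mult_left_mono) auto
  finally show ?thesis by (simp add: field'_def g_def)
qed

lemma field'_bound:
  assumes "c > 0"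
  shows "\<bar>field' c u\<bar> \<le> 1 + 2 * c"
proof -
  define s where "s = (max u 0)\<^sup>2"
  have s: "s \<ge> 0" by (simp add: s_def)
  have "\<bar>1 - s\<bar> \<le> (1 + s)\<^sup>2" using s by (simp add: abs_le_iff power2_eq_square algebra_simps)
  then have "\<bar>(1 - s) / (1 + s)\<^sup>2\<bar> \<le> 1" using s by (simp add: abs_divide pos_divide_le_eq)
  then have "2 * c * \<bar>(1 - s) / (1 + s)\<^sup>2\<bar> \<le> 2 * c * 1" using assms by (intro mult_left_mono) auto
  then have "\<bar>2 * c * ((1 - s) / (1 + s)\<^sup>2)\<bar> \<le> 2 * c" using assms by (simp add: abs_mult)
  then show ?thesis unfolding field'_def s_def[symmetric] by linarith
qed

section \<open>Folds, landing points and branches of the concrete field\<close>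

context
  fixes c :: real
  assumes c: "c > 4"
begin

text \<open>The squares of the folds are the roots of
  \<open>z\<^sup>2 - 2 * (c - 1) * z + (1 + 2 * c)\<close>, the numerator of the derivative at
  \<open>z = x\<^sup>2\<close>. This polynomial is negative at 3 exactly when \<open>c > 4\<close>,
  so 3 separates the roots.\<close>

lemma fold_points:
  shows "x1 c > 0" "x1 c < x2 c" "(x1 c)\<^sup>2 + (x2 c)\<^sup>2 = 2 * (c - 1)" "(x1 c)\<^sup>2 * (x2 c)\<^sup>2 = 1 + 2 * c"
    "1 < (x1 c)\<^sup>2" "(x1 c)\<^sup>2 < 3" "3 < (x2 c)\<^sup>2"
proof -
  define w where "w = sqrt (c * (c - 4))"
  have w: "w > 0" "w\<^sup>2 = c * (c - 4)" using c by (simp_all add: w_def)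
  have sq: "(c - 1)\<^sup>2 - w\<^sup>2 = 1 + 2 * c" unfolding w(2) by (simp add: power2_eq_square algebra_simps)
  have "w < c - 1"
  proof (rule power2_less_imp_less)
    show "w\<^sup>2 < (c - 1)\<^sup>2" using sq c by linarith
  qed (use c in simp)
  then have s: "(x1 c)\<^sup>2 = c - 1 - w" "(x2 c)\<^sup>2 = c - 1 + w" "x1 c > 0" "x1 c < x2 c"
    using w c by (simp_all add: x1_def x2_def w_def[symmetric])
  then show "x1 c > 0" "x1 c < x2 c" "(x1 c)\<^sup>2 + (x2 c)\<^sup>2 = 2 * (c - 1)" by simp_all
  show "(x1 c)\<^sup>2 * (x2 c)\<^sup>2 = 1 + 2 * c" unfolding s(1,2) using sq by (simp add: power2_eq_square algebra_simps)
  have "w < c - 2"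
  proof (rule power2_less_imp_less)
    show "w\<^sup>2 < (c - 2)\<^sup>2" unfolding w(2) by (simp add: power2_eq_square algebra_simps)
  qed (use c in simp)
  then show "1 < (x1 c)\<^sup>2" unfolding s by simp
  have "c - 4 < w"
  proof (rule power2_less_imp_less)
    have "(c - 4) * (c - 4) < c * (c - 4)" using c by (intro mult_strict_right_mono) auto
    then show "(c - 4)\<^sup>2 < w\<^sup>2" unfolding w(2) by (simp add: power2_eq_square)
  qed (use w in simp)
  then show "(x1 c)\<^sup>2 < 3" "3 < (x2 c)\<^sup>2" unfolding s using c w by simp_all
qed

lemma field'_factor:
  "x \<ge> 0 \<Longrightarrow> field' c x = (x\<^sup>2 - (x1 c)\<^sup>2) * (x\<^sup>2 - (x2 c)\<^sup>2) / (1 + x\<^sup>2)\<^sup>2"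
proof -
  assume x: "x \<ge> 0"
  have "(x\<^sup>2 - (x1 c)\<^sup>2) * (x\<^sup>2 - (x2 c)\<^sup>2) = x\<^sup>2 * x\<^sup>2 - ((x1 c)\<^sup>2 + (x2 c)\<^sup>2) * x\<^sup>2 + (x1 c)\<^sup>2 * (x2 c)\<^sup>2"
    by (simp add: algebra_simps)
  also have "\<dots> = (1 + x\<^sup>2)\<^sup>2 + 2 * c * (1 - x\<^sup>2)"
    unfolding fold_points(3,4) by (simp add: power2_eq_square algebra_simps)
  finally show ?thesis
    using x one_plus_square_pos[of x] by (simp only: field'_def max_absorb1 add_divide_distrib) simp
qed

text \<open>At a critical point \<open>v\<close> the numerator of \<open>field c v - field c x\<close> has the double root \<open>v\<close>;
  the third root is the landing point \<open>2 * v / (v\<^sup>2 - 1)\<close>.\<close>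

lemma field_fold:
  assumes v: "v > 0" "v\<^sup>2 > 1" "(1 + v\<^sup>2)\<^sup>2 = 2 * c * (v\<^sup>2 - 1)" and x: "x \<ge> 0"
  shows "field c v - field c x = (x - v)\<^sup>2 * (2 * v / (v\<^sup>2 - 1) - x) / (1 + x\<^sup>2)"
proof -
  define h where "h = 2 * v / (v\<^sup>2 - 1)"
  have h: "h * (v\<^sup>2 - 1) = 2 * v" using v by (simp add: h_def)
  have c2: "2 * c = (1 + v\<^sup>2)\<^sup>2 / (v\<^sup>2 - 1)" using v by (simp add: eq_divide_eq)
  have lam: "field c v = h + 2 * v"
  proof -
    have "field c v = v + (1 + v\<^sup>2)\<^sup>2 / (v\<^sup>2 - 1) * (v / (1 + v\<^sup>2))"
      using v(1) by (simp add: field_nonneg c2[symmetric])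
    also have "(1 + v\<^sup>2)\<^sup>2 / (v\<^sup>2 - 1) * (v / (1 + v\<^sup>2)) = (1 + v\<^sup>2) * v / (v\<^sup>2 - 1)"
      using one_plus_square_pos[of v] by (simp add: power2_eq_square[of "1 + v\<^sup>2"])
    also have "(1 + v\<^sup>2) * v / (v\<^sup>2 - 1) = h + v"
      using v(2) by (simp add: h_def add_divide_eq_iff divide_add_eq_iff) (simp add: algebra_simps)
    finally show ?thesis by simp
  qed
  have hv: "h * v\<^sup>2 = h + 2 * v" using h by (simp add: algebra_simps)
  have cc: "1 + 2 * c = 2 * v * h + v\<^sup>2"
  proof -
    have "(v\<^sup>2 - 1) * (1 + 2 * c) = (v\<^sup>2 - 1) + (1 + v\<^sup>2)\<^sup>2" using v(3) by (simp add: algebra_simps)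
    also have "\<dots> = 2 * v * (2 * v) + v\<^sup>2 * (v\<^sup>2 - 1)" by (simp add: algebra_simps power2_eq_square)
    also have "\<dots> = (v\<^sup>2 - 1) * (2 * v * h + v\<^sup>2)" unfolding h[symmetric] by (simp add: algebra_simps)
    finally show ?thesis using v(2) by simp
  qed
  have s: "1 + x\<^sup>2 > 0" by (rule one_plus_square_pos)
  have "(field c v - field c x) * (1 + x\<^sup>2) = (h + 2 * v - x) * (1 + x\<^sup>2) - 2 * c * x"
  proof -
    have "(A - (x + r)) * S = (A - x) * S - r * S" for A r S :: real by (simp add: algebra_simps)
    moreover have "2 * c * (x / (1 + x\<^sup>2)) * (1 + x\<^sup>2) = 2 * c * x" using s by simp
    ultimately show ?thesis unfolding lam field_nonneg[OF x] by metis
  qed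
  also have "\<dots> = (h + 2 * v) - (1 + 2 * c) * x + (h + 2 * v) * x\<^sup>2 - x ^ 3"
    by (simp add: algebra_simps power2_eq_square power3_eq_cube)
  also have "\<dots> = h * v\<^sup>2 - (2 * v * h + v\<^sup>2) * x + (h + 2 * v) * x\<^sup>2 - x ^ 3" unfolding hv cc ..
  also have "\<dots> = (x - v)\<^sup>2 * (h - x)" by (simp add: algebra_simps power2_eq_square power3_eq_cube)
  finally show ?thesis unfolding h_def[symmetric] using s by (simp add: eq_divide_eq)
qed

end

context
  fixes c :: real
  assumes c: "c > 4"
begin

lemma critical:
  "(1 + (x1 c)\<^sup>2)\<^sup>2 = 2 * c * ((x1 c)\<^sup>2 - 1)" "(1 + (x2 c)\<^sup>2)\<^sup>2 = 2 * c * ((x2 c)\<^sup>2 - 1)"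
proof -
  have "(x1 c)\<^sup>2 * ((x1 c)\<^sup>2 + (x2 c)\<^sup>2) = (x1 c)\<^sup>2 * (x1 c)\<^sup>2 + (x1 c)\<^sup>2 * (x2 c)\<^sup>2"
    by (simp add: distrib_left)
  then show "(1 + (x1 c)\<^sup>2)\<^sup>2 = 2 * c * ((x1 c)\<^sup>2 - 1)"
    unfolding fold_points(3,4)[OF c] by (simp add: power2_eq_square[of "1 + (x1 c)\<^sup>2"] algebra_simps)
  have "(x2 c)\<^sup>2 * ((x1 c)\<^sup>2 + (x2 c)\<^sup>2) = (x1 c)\<^sup>2 * (x2 c)\<^sup>2 + (x2 c)\<^sup>2 * (x2 c)\<^sup>2"
    by (simp add: distrib_left mult.commute)
  then show "(1 + (x2 c)\<^sup>2)\<^sup>2 = 2 * c * ((x2 c)\<^sup>2 - 1)"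
    unfolding fold_points(3,4)[OF c] by (simp add: power2_eq_square[of "1 + (x2 c)\<^sup>2"] algebra_simps)
qed

definition qh where "qh = 2 * x1 c / ((x1 c)\<^sup>2 - 1)"
definition ph where "ph = 2 * x2 c / ((x2 c)\<^sup>2 - 1)"

lemma fold_p_factor: "x \<ge> 0 \<Longrightarrow> field c (x1 c) - field c x = (x - x1 c)\<^sup>2 * (qh - x) / (1 + x\<^sup>2)"
  unfolding qh_def by (rule field_fold[OF c]) (use fold_points[OF c] critical in auto)

lemma fold_q_factor: "x \<ge> 0 \<Longrightarrow> field c x - field c (x2 c) = (x - x2 c)\<^sup>2 * (x - ph) / (1 + x\<^sup>2)"
proof -
  assume x: "x \<ge> 0"
  have "field c (x2 c) - field c x = (x - x2 c)\<^sup>2 * (ph - x) / (1 + x\<^sup>2)"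
    unfolding ph_def by (rule field_fold[OF c]) (use fold_points[OF c] critical x in auto)
  moreover have "(x - x2 c)\<^sup>2 * (ph - x) / (1 + x\<^sup>2) = - ((x - x2 c)\<^sup>2 * (x - ph) / (1 + x\<^sup>2))"
  proof -
    have eq: "ph - x = - (x - ph)" by simp
    show ?thesis unfolding eq by (simp only: mult_minus_right minus_divide_left)
  qed
  ultimately show ?thesis by simp
qed

lemma x2_pos: "x2 c > 0" using fold_points[OF c] by linarith

text \<open>With \<open>s\<close> and \<open>r\<close> the squares of the folds, the root relations
  give \<open>r * (s - 1) = s + 3\<close>. After squaring, the first claim becomes
  \<open>(s + 3) * (s - 1) < 4 * s\<close>, that is \<open>(s - 3) * (s + 1) < 0\<close>, which is
  \<open>s < 3\<close>. The last claim is the same with \<open>r > 3\<close>.\<close>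

lemma landing_points: "x2 c < qh" "0 < ph" "ph < x1 c"
proof -
  let ?s = "(x1 c)\<^sup>2" and ?r = "(x2 c)\<^sup>2"
  note fp = fold_points[OF c]
  have prod: "?r * (?s - 1) = ?s + 3"
    using fp(3,4) by (simp add: algebra_simps)
  have prod': "?s * (?r - 1) = ?r + 3"
    using fp(3,4) by (simp add: algebra_simps)
  have "(x2 c * (?s - 1))\<^sup>2 < (2 * x1 c)\<^sup>2"
  proof -
    have "(x2 c * (?s - 1))\<^sup>2 = ?r * (?s - 1) * (?s - 1)" by (simp add: power2_eq_square)
    also have "\<dots> = (?s + 3) * (?s - 1)" unfolding prod ..
    also have "\<dots> = 4 * ?s + (?s - 3) * (?s + 1)" by (simp add: algebra_simps)
    also have "\<dots> < 4 * ?s"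
      using mult_neg_pos[of "?s - 3" "?s + 1"] fp by simp
    finally show ?thesis by (simp add: power_mult_distrib)
  qed
  then have "x2 c * (?s - 1) < 2 * x1 c" by (rule power2_less_imp_less) (use fp in simp)
  then show "x2 c < qh" unfolding qh_def using fp by (simp add: pos_less_divide_eq)
  show "0 < ph" unfolding ph_def using fp x2_pos by simp
  have "(2 * x2 c)\<^sup>2 < (x1 c * (?r - 1))\<^sup>2"
  proof -
    have "(x1 c * (?r - 1))\<^sup>2 = ?s * (?r - 1) * (?r - 1)" by (simp add: power2_eq_square)
    also have "\<dots> = (?r + 3) * (?r - 1)" unfolding prod' ..
    also have "\<dots> = 4 * ?r + (?r - 3) * (?r + 1)" by (simp add: algebra_simps)
    also have "\<dots> > 4 * ?r"
      using mult_pos_pos[of "?r - 3" "?r + 1"] fp by simp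
    finally show ?thesis by (simp add: power_mult_distrib)
  qed
  then have "2 * x2 c < x1 c * (?r - 1)" by (rule power2_less_imp_less) (use fp in simp)
  then show "ph < x1 c" unfolding ph_def using fp by (simp add: pos_divide_less_eq)
qed

text \<open>For nonnegative \<open>x\<close> both factors of the numerator are at least
  \<open>(x1 c)\<^sup>2 - x\<^sup>2\<close> in absolute value, so the derivative dominates a square
  bounded away from 0; for negative \<open>x\<close> it is constant.\<close>

lemma field_left_branch:
  assumes d: "d > 0"
  shows "\<exists>c0>0. \<forall>x\<le>x1 c - d. c0 \<le> field' c x"
proof -
  let ?p = "x1 c" and ?s = "(x1 c)\<^sup>2" and ?r = "(x2 c)\<^sup>2"
  note fp = fold_points[OF c]
  have sr: "?s < ?r" using fp by simp
  define c0 where "c0 = min (1 + 2 * c) ((d * ?p / (1 + ?s))\<^sup>2)"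
  have dp: "d * ?p / (1 + ?s) > 0" using d fp one_plus_square_pos[of ?p] by simp
  then have "c0 > 0" using c zero_less_power[OF dp, of 2] unfolding c0_def by simp
  moreover have "c0 \<le> field' c x" if x: "x \<le> ?p - d" for x
  proof (cases "x \<ge> 0")
    case False
    then show ?thesis by (simp add: c0_def field'_def max_absorb2)
  next
    case True
    have t: "1 + x\<^sup>2 > 0" by (rule one_plus_square_pos)
    have "x\<^sup>2 \<le> ?s" using x d True by (intro power_mono) auto
    have "d * ?p \<le> (?p - x) * (?p + x)" using x d True fp by (intro mult_mono) auto
    also have "\<dots> = ?s - x\<^sup>2" by (simp add: power2_eq_square algebra_simps)
    finally have num: "d * ?p \<le> ?s - x\<^sup>2" .
    have "d * ?p / (1 + ?s) \<le> (?s - x\<^sup>2) / (1 + ?s)" using num fp by (intro divide_right_mono) auto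
    also have "\<dots> \<le> (?s - x\<^sup>2) / (1 + x\<^sup>2)"
      using num d fp \<open>x\<^sup>2 \<le> ?s\<close> t by (intro divide_left_mono) (auto intro: mult_pos_pos)
    finally have "(d * ?p / (1 + ?s))\<^sup>2 \<le> ((?s - x\<^sup>2) / (1 + x\<^sup>2))\<^sup>2" using dp by (intro power_mono) auto
    also have "\<dots> = (?s - x\<^sup>2) * (?s - x\<^sup>2) / (1 + x\<^sup>2)\<^sup>2" by (simp add: power_divide power2_eq_square)
    also have "\<dots> \<le> (?s - x\<^sup>2) * (?r - x\<^sup>2) / (1 + x\<^sup>2)\<^sup>2"
      using sr \<open>x\<^sup>2 \<le> ?s\<close> by (intro divide_right_mono mult_left_mono) auto
    also have "\<dots> = field' c x" unfolding field'_factor[OF c True] by (simp add: algebra_simps)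
    finally show ?thesis by (simp add: c0_def)
  qed
  ultimately show ?thesis by blast
qed

text \<open>Here the smaller factor is \<open>x\<^sup>2 - (x2 c)\<^sup>2\<close>, and its quotient
  by \<open>1 + x\<^sup>2\<close> increases with \<open>x\<close>, so the value at
  \<open>x2 c + d\<close> is a uniform bound.\<close>

lemma field_right_branch:
  assumes d: "d > 0"
  shows "\<exists>c0>0. \<forall>x\<ge>x2 c + d. c0 \<le> field' c x"
proof -
  let ?q = "x2 c" and ?s = "(x1 c)\<^sup>2" and ?r = "(x2 c)\<^sup>2"
  note fp = fold_points[OF c]
  have sr: "?s < ?r" using fp by simp
  define z where "z = (?q + d)\<^sup>2"
  have z: "z > ?r" unfolding z_def using d x2_pos by (intro power_strict_mono) auto
  have r0: "1 + ?r > 0" by (rule one_plus_square_pos)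
  have z0: "1 + z > 0" using z r0 by linarith
  define c0 where "c0 = ((z - ?r) / (1 + z))\<^sup>2"
  have w: "(z - ?r) / (1 + z) > 0" using z z0 by simp
  then have "c0 > 0" unfolding c0_def by (rule zero_less_power)
  moreover have "c0 \<le> field' c x" if x: "x \<ge> ?q + d" for x
  proof -
    have x0: "x \<ge> 0" using x d x2_pos by linarith
    have t: "1 + x\<^sup>2 > 0" by (rule one_plus_square_pos)
    have zx: "z \<le> x\<^sup>2" unfolding z_def using x d x2_pos by (intro power_mono) auto
    have "(z - ?r) * (1 + x\<^sup>2) \<le> (x\<^sup>2 - ?r) * (1 + z)"
    proof -
      have "(x\<^sup>2 - ?r) * (1 + z) - (z - ?r) * (1 + x\<^sup>2) = (x\<^sup>2 - z) * (1 + ?r)" by (simp add: algebra_simps)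
      moreover have "(x\<^sup>2 - z) * (1 + ?r) \<ge> 0" using zx r0 by (intro mult_nonneg_nonneg) auto
      ultimately show ?thesis by linarith
    qed
    then have "(z - ?r) / (1 + z) \<le> (x\<^sup>2 - ?r) / (1 + x\<^sup>2)"
      using z0 t by (simp add: frac_le_eq divide_le_eq pos_le_divide_eq mult.commute)
    then have "c0 \<le> ((x\<^sup>2 - ?r) / (1 + x\<^sup>2))\<^sup>2" unfolding c0_def using w by (intro power_mono) auto
    also have "\<dots> = (x\<^sup>2 - ?r) * (x\<^sup>2 - ?r) / (1 + x\<^sup>2)\<^sup>2" by (simp add: power_divide power2_eq_square)
    also have "\<dots> \<le> (x\<^sup>2 - ?s) * (x\<^sup>2 - ?r) / (1 + x\<^sup>2)\<^sup>2"
      using sr zx z by (intro divide_right_mono mult_right_mono) auto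
    also have "\<dots> = field' c x" unfolding field'_factor[OF c x0] ..
    finally show ?thesis .
  qed
  ultimately show ?thesis by blast
qed

lemma field_value_pos: "x > 0 \<Longrightarrow> field c x > 0"
  using c one_plus_square_pos[of x] by (simp add: field_nonneg add_pos_pos)

lemma field_fold_p:
  assumes d: "d > 0"
  shows "\<exists>\<kappa>>0. \<forall>x. a \<le> x \<and> x \<le> qh - d \<longrightarrow> field c (x1 c) - field c x \<ge> \<kappa> * (x - x1 c)\<^sup>2"
proof -
  note fp = fold_points[OF c]
  have l: "field c (x1 c) > 0" using field_value_pos fp by simp
  \<comment> \<open>The first entry comes from the factorisation for nonnegative \<open>x\<close>.
    For negative \<open>x\<close> the field is nonpositive, so the drop is at least
    \<open>field c (x1 c)\<close>, compared with the largest possible square.\<close>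
  define \<kappa> where "\<kappa> = min (d / (1 + qh\<^sup>2)) (field c (x1 c) / (\<bar>a\<bar> + x1 c)\<^sup>2)"
  have "\<kappa> > 0" using d l fp one_plus_square_pos[of qh] by (simp add: \<kappa>_def)
  moreover have "\<kappa> * (x - x1 c)\<^sup>2 \<le> field c (x1 c) - field c x" if x: "a \<le> x" "x \<le> qh - d" for x
  proof (cases "x \<ge> 0")
    case True
    have t: "1 + x\<^sup>2 > 0" by (rule one_plus_square_pos)
    have "x\<^sup>2 \<le> qh\<^sup>2" using True x d by (intro power_mono) auto
    have "\<kappa> \<le> d / (1 + qh\<^sup>2)" by (simp add: \<kappa>_def)
    also have "\<dots> \<le> (qh - x) / (1 + x\<^sup>2)" using x d \<open>x\<^sup>2 \<le> qh\<^sup>2\<close> t by (intro frac_le) auto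
    finally have "\<kappa> * (x - x1 c)\<^sup>2 \<le> (qh - x) / (1 + x\<^sup>2) * (x - x1 c)\<^sup>2" by (intro mult_right_mono) auto
    then show ?thesis unfolding fold_p_factor[OF True] by (simp add: mult.commute)
  next
    case False
    have "\<bar>x - x1 c\<bar> \<le> \<bar>a\<bar> + x1 c" using False x fp by linarith
    then have "(x - x1 c)\<^sup>2 \<le> (\<bar>a\<bar> + x1 c)\<^sup>2"
      using fp by (intro power2_le_iff_abs_le[THEN iffD2]) auto
    then have "\<kappa> * (x - x1 c)\<^sup>2 \<le> field c (x1 c) / (\<bar>a\<bar> + x1 c)\<^sup>2 * (\<bar>a\<bar> + x1 c)\<^sup>2"
      using l fp by (intro mult_mono) (auto simp: \<kappa>_def)
    also have "\<dots> = field c (x1 c)" using fp by simp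
    also have "\<dots> \<le> field c (x1 c) - field c x"
      using False c by (simp add: field_nonpos mult_nonneg_nonpos)
    finally show ?thesis .
  qed
  ultimately show ?thesis by blast
qed

lemma field_fold_q:
  assumes d: "d > 0"
  shows "\<exists>\<kappa>>0. \<forall>x. ph + d \<le> x \<and> x \<le> a \<longrightarrow> field c x - field c (x2 c) \<ge> \<kappa> * (x - x2 c)\<^sup>2"
proof -
  have "d / (1 + a\<^sup>2) > 0" using d one_plus_square_pos[of a] by simp
  moreover have "d / (1 + a\<^sup>2) * (x - x2 c)\<^sup>2 \<le> field c x - field c (x2 c)" if x: "ph + d \<le> x" "x \<le> a" for x
  proof -
    have x0: "x \<ge> 0" using x d landing_points by linarith
    have t: "1 + x\<^sup>2 > 0" by (rule one_plus_square_pos)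
    have "x\<^sup>2 \<le> a\<^sup>2" using x0 x by (intro power_mono) auto
    then have "d / (1 + a\<^sup>2) \<le> (x - ph) / (1 + x\<^sup>2)" using x d t by (intro frac_le) auto
    then have "d / (1 + a\<^sup>2) * (x - x2 c)\<^sup>2 \<le> (x - ph) / (1 + x\<^sup>2) * (x - x2 c)\<^sup>2" by (intro mult_right_mono) auto
    then show ?thesis unfolding fold_q_factor[OF x0] by (simp add: mult.commute)
  qed
  ultimately show ?thesis by blast
qed

lemma S_shape_field: "S_shape (field c) (field' c) (x1 c) (x2 c) ph qh (1 + 2 * c) (12 * c)"
proof
  note fp = fold_points[OF c]
  show "(field c has_real_derivative field' c x) (at x)" for x by (rule field_deriv)
  show "\<bar>field' c u - field' c v\<bar> \<le> 12 * c * \<bar>u - v\<bar>" for u v using c by (intro field'_lipschitz) simp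
  show "\<bar>field' c u\<bar> \<le> 1 + 2 * c" for u using c by (intro field'_bound) simp
  show "0 < 12 * c" "0 < 1 + 2 * c" using c by simp_all
  show "x1 c < x2 c" by (rule fp)
  show "field' c x < 0" if x: "x1 c < x" "x < x2 c" for x
  proof -
    have x0: "x \<ge> 0" using x fp by simp
    have "(x1 c)\<^sup>2 < x\<^sup>2" "x\<^sup>2 < (x2 c)\<^sup>2" using x fp by (auto intro!: power_strict_mono)
    then have "(x\<^sup>2 - (x1 c)\<^sup>2) * (x\<^sup>2 - (x2 c)\<^sup>2) < 0" by (intro mult_pos_neg) auto
    then show ?thesis unfolding field'_factor[OF c x0] using one_plus_square_pos[of x] by (simp add: divide_neg_pos)
  qed
  show "x2 c < qh" "ph < x1 c" by (rule landing_points)+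
  show "field c qh = field c (x1 c)" using fold_p_factor[of qh] landing_points x2_pos by simp
  show "field c ph = field c (x2 c)" using fold_q_factor[of ph] landing_points by simp
  show "\<exists>c0>0. \<forall>x\<le>x1 c - d. c0 \<le> field' c x" if "d > 0" for d by (rule field_left_branch[OF that])
  show "\<exists>c0>0. \<forall>x\<ge>x2 c + d. c0 \<le> field' c x" if "d > 0" for d by (rule field_right_branch[OF that])
  show "\<exists>\<kappa>>0. \<forall>x. a \<le> x \<and> x \<le> qh - d \<longrightarrow> field c (x1 c) - field c x \<ge> \<kappa> * (x - x1 c)\<^sup>2" if "d > 0" for a d
    by (rule field_fold_p[OF that])
  show "\<exists>\<kappa>>0. \<forall>x. ph + d \<le> x \<and> x \<le> a \<longrightarrow> field c x - field c (x2 c) \<ge> \<kappa> * (x - x2 c)\<^sup>2" if "d > 0" for a d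
    by (rule field_fold_q[OF that])
qed

lemma lam_eq: "lam1 c = field c (x2 c)" "lam2 c = field c (x1 c)"
  using fold_points[OF c] x2_pos by (simp_all add: lam1_def lam2_def gbar_eq_field)

lemma xhat1_eq: "xhat1 c = ph"
  unfolding xhat1_def
proof (rule the_equality)
  have "field c ph = field c (x2 c)" using fold_q_factor[of ph] landing_points by simp
  then show "ph \<in> {0<..<x1 c} \<and> - gbar c ph = lam1 c"
    using landing_points by (simp add: gbar_eq_field lam_eq)
  fix x assume x: "x \<in> {0<..<x1 c} \<and> - gbar c x = lam1 c"
  then have "field c x = field c (x2 c)" using gbar_eq_field[of x c] by (simp add: lam_eq)
  then have "(x - x2 c)\<^sup>2 * (x - ph) / (1 + x\<^sup>2) = 0" using fold_q_factor[of x] x by simp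
  then show "x = ph" using x fold_points[OF c] one_plus_square_pos[of x] by auto
qed

lemma xhat2_eq: "xhat2 c = qh"
  unfolding xhat2_def
proof (rule the_equality)
  have "field c qh = field c (x1 c)" using fold_p_factor[of qh] landing_points x2_pos by simp
  then show "x2 c < qh \<and> - gbar c qh = lam2 c"
    using landing_points x2_pos by (simp add: gbar_eq_field lam_eq)
  fix x assume x: "x2 c < x \<and> - gbar c x = lam2 c"
  then have x0: "x \<ge> 0" using x2_pos by simp
  then have "field c x = field c (x1 c)" using x gbar_eq_field[OF x0, of c] by (simp add: lam_eq)
  then have "(x - x1 c)\<^sup>2 * (qh - x) / (1 + x\<^sup>2) = 0" using fold_p_factor[of x] x0 by simp
  then show "x = qh" using x fold_points[OF c] one_plus_square_pos[of x] by auto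
qed

lemma forced_forcing:
  assumes "\<epsilon> > 0"
  shows "forced (field c) (field' c) (x1 c) (x2 c) ph qh (1 + 2 * c) (12 * c)
    (forcing c r \<epsilon>) (pi / 2 / \<epsilon>) \<epsilon> (\<epsilon> powr r)"
proof -
  interpret S_shape "field c" "field' c" "x1 c" "x2 c" ph qh "1 + 2 * c" "12 * c" by (rule S_shape_field)
  show ?thesis
  proof
    fix t
    have "\<epsilon> * (t - pi / 2 / \<epsilon>) = \<epsilon> * t - pi / 2" using assms by (simp add: right_diff_distrib)
    then have "cos (\<epsilon> * (t - pi / 2 / \<epsilon>)) = sin (\<epsilon> * t)" by (simp add: cos_diff)
    then show "forcing c r \<epsilon> t = (field c (x1 c) + field c (x2 c)) / 2 +
        ((field c (x1 c) - field c (x2 c)) / 2 + \<epsilon> powr r) * cos (\<epsilon> * (t - pi / 2 / \<epsilon>))"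
      by (simp add: forcing_def alpha_def beta_def lam_eq add.commute)
  qed (use assms in auto)
qed

end

section \<open>Positive solutions\<close>

lemma gbar_deriv: "x > 0 \<Longrightarrow> deriv (gbar c) x = - field' c x"
proof (rule DERIV_imp_deriv)
  assume x: "x > 0"
  have "((\<lambda>x. - field c x) has_real_derivative - field' c x) (at x)" by (intro DERIV_minus field_deriv)
  then show "(gbar c has_real_derivative - field' c x) (at x)"
    by (rule has_field_derivative_transform_within_open[OF _ open_greaterThan[of 0]])
       (use x in \<open>auto simp: gbar_eq_field\<close>)
qed

lemma gbar_nonneg_left: "c > 0 \<Longrightarrow> x \<le> 0 \<Longrightarrow> gbar c x \<ge> 0"
proof -
  assume c: "c > 0" and x: "x \<le> 0"
  have "- (1 + 2 * c) * x \<ge> 0" using c x by (intro mult_nonpos_nonpos) auto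
  moreover have "x ^ 3 \<le> 0" using x by (simp add: power3_eq_cube mult_nonneg_nonpos mult_nonpos_nonpos)
  moreover have "gbar c x = - (1 + 2 * c) * x - x ^ 3" using x by (cases "x = 0") (auto simp: gbar_def)
  ultimately show ?thesis by linarith
qed

lemma solves_nonneg_iff:
  assumes "\<And>t. x t \<ge> 0"
  shows "solves y (gbar c) x UNIV \<longleftrightarrow> entire_solution y (field c) x"
  using assms by (simp add: solves_def entire_solution_def gbar_eq_field is_interval_univ)

text \<open>The forcing is bounded below by \<open>\<mu> > 0\<close>, so solutions cross \<open>0\<close> only upwards.\<close>

locale positive_forcing = lipschitz_equation y "field c" "1 + 2 * c" for y c +
  fixes \<mu> :: real
  assumes c_pos: "c > 0" and \<mu>: "\<mu> > 0" "\<And>t. y t \<ge> \<mu>"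
begin

text \<open>A bounded solution cannot be negative, as it would have been rising from arbitrarily far
  below; at a zero it would have been negative just before. Strictness matters because the
  derivative of \<open>gbar c\<close> is computed only at positive points.\<close>

lemma positive_of_bounded:
  assumes bd: "bounded (range x)" and der: "\<And>t. (x has_real_derivative x' t) (at t)"
    and up: "\<And>t. x t \<le> 0 \<Longrightarrow> x' t \<ge> \<mu>"
  shows "x t > 0"
proof -
  have nonneg: "x t \<ge> 0" for t
    by (rule bounded_ge_of_absorbing[OF bd \<mu>(1) der]) (rule up[OF less_imp_le])
  show ?thesis
  proof (rule ccontr)
    assume "\<not> x t > 0"
    then have "x t = 0" using nonneg[of t] by simp
    then have "x' t > 0" using up[of t] \<mu>(1) by linarith
    from DERIV_pos_inc_left[OF der this] obtain d where d: "d > 0" "\<And>h. 0 < h \<Longrightarrow> h < d \<Longrightarrow> x (t - h) < x t"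
      by blast
    have "x (t - d / 2) < 0" using d(2)[of "d / 2"] d(1) \<open>x t = 0\<close> by simp
    then show False using nonneg[of "t - d / 2"] by simp
  qed
qed

lemma bounded_solution_positive:
  assumes "bounded_solution y (gbar c) x"
  shows "x t > 0"
proof (rule positive_of_bounded[of x "\<lambda>t. y t + gbar c (x t)"])
  show "bounded (range x)" using assms by (simp add: bounded_solution_def)
  show "(x has_real_derivative y t + gbar c (x t)) (at t)" for t
    using assms by (simp add: bounded_solution_def solves_def)
  show "\<mu> \<le> y t + gbar c (x t)" if "x t \<le> 0" for t
    using gbar_nonneg_left[OF c_pos that] \<mu>(2)[of t] by linarith
qed

lemma entire_solution_positive:
  assumes "entire_solution y (field c) x" "bounded (range x)"
  shows "x t > 0"
proof (rule positive_of_bounded[OF assms(2) entire_solutionD[OF assms(1)]])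
  show "\<mu> \<le> y t - field c (x t)" if "x t \<le> 0" for t
  proof -
    have "(1 + 2 * c) * x t \<le> 0" using that c_pos by (intro mult_nonneg_nonpos) auto
    then show ?thesis using \<mu>(2)[of t] field_nonpos[OF that, of c] by linarith
  qed
qed

text \<open>Bounded solutions of either equation are positive, where the fields agree. Uniqueness
  proved for \<open>field c\<close> thus also excludes bounded solutions of the original equation
  that might take negative values.\<close>

lemma bounded_solution_iff:
  "bounded_solution y (gbar c) x \<longleftrightarrow> entire_solution y (field c) x \<and> bounded (range x)"
proof
  assume x: "bounded_solution y (gbar c) x"
  have "x t \<ge> 0" for t using bounded_solution_positive[OF x, of t] by simp
  from solves_nonneg_iff[OF this] x show "entire_solution y (field c) x \<and> bounded (range x)"
    by (simp add: bounded_solution_def)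
next
  assume x: "entire_solution y (field c) x \<and> bounded (range x)"
  have "x t \<ge> 0" for t using entire_solution_positive[of x t] x by simp
  from solves_nonneg_iff[OF this] x show "bounded_solution y (gbar c) x"
    by (simp add: bounded_solution_def)
qed

lemma exponent_antiderivative:
  assumes b: "bounded_solution y (gbar c) b"
  obtains \<Phi> where "\<And>t. (\<Phi> has_real_derivative - field' c (b t)) (at t)"
    "\<And>s t. (LBINT \<tau>=ereal s..ereal t. deriv (gbar c) (b \<tau>)) = \<Phi> t - \<Phi> s"
proof -
  have eq: "deriv (gbar c) (b t) = - field' c (b t)" for t
    by (rule gbar_deriv[OF bounded_solution_positive[OF b]])
  have b_cont: "continuous_on UNIV b"
    using b by (auto simp: bounded_solution_def solves_def intro!: continuous_at_imp_continuous_on DERIV_isCont)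
  have "(12 * c)-lipschitz_on UNIV (field' c)"
    using field'_lipschitz[OF c_pos] c_pos by (auto intro!: lipschitz_onI simp: dist_real_def)
  then have "continuous_on UNIV (field' c)" by (rule lipschitz_on_continuous_on)
  then have "continuous_on UNIV (\<lambda>t. field' c (b t))"
    by (rule continuous_on_compose2[OF _ b_cont]) simp
  then have "continuous_on UNIV (\<lambda>t. - field' c (b t))" by (rule continuous_on_minus)
  then obtain \<Phi> where \<Phi>: "\<And>t. (\<Phi> has_real_derivative - field' c (b t)) (at t)"
    and int: "\<And>s t. (LBINT \<tau>=ereal s..ereal t. - field' c (b \<tau>)) = \<Phi> t - \<Phi> s"
    and "\<Phi> 0 = 0"
    by (rule continuous_antiderivative) (rule that)
  show ?thesis
  proof (rule that[OF \<Phi>])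
    show "(LBINT \<tau>=ereal s..ereal t. deriv (gbar c) (b \<tau>)) = \<Phi> t - \<Phi> s" for s t
      unfolding eq by (rule int)
  qed
qed

text \<open>Along a periodic solution the exponent is linear up to a periodic function.\<close>

lemma periodic_exponent:
  fixes \<Phi> :: "real \<Rightarrow> real"
  assumes b: "\<And>t. b (t + T) = b t" and T: "T > 0"
    and \<Phi>: "\<And>t. (\<Phi> has_real_derivative - field' c (b t)) (at t)"
  obtains C where "C \<ge> 0" "\<And>s t. \<bar>\<Phi> t - \<Phi> s - (\<Phi> (r + T) - \<Phi> r) / T * (t - s)\<bar> \<le> C"
proof -
  define \<Lambda> where "\<Lambda> = \<Phi> (r + T) - \<Phi> r"
  have "((\<lambda>t. \<Phi> (t + T) - \<Phi> t) has_real_derivative 0) (at t)" for t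
  proof -
    have "((\<lambda>t. \<Phi> (t + T)) has_real_derivative - field' c (b (t + T))) (at t)"
      using \<Phi>[of "t + T"] DERIV_shift[of \<Phi> _ t T] by simp
    from DERIV_diff[OF this \<Phi>[of t]] show ?thesis by (simp add: b)
  qed
  then have inc: "\<Phi> (t + T) - \<Phi> t = \<Lambda>" for t
    using DERIV_isconst_all[of "\<lambda>t. \<Phi> (t + T) - \<Phi> t" t r] by (simp add: \<Lambda>_def)
  define \<Psi> where "\<Psi> t = \<Phi> t - \<Lambda> / T * t" for t
  have "\<Psi> (t + T) = \<Psi> t" for t using inc[of t] T by (simp add: \<Psi>_def field_simps)
  moreover have "continuous_on UNIV \<Phi>" by (auto intro!: continuous_at_imp_continuous_on DERIV_isCont \<Phi>)
  then have "continuous_on UNIV \<Psi>" unfolding \<Psi>_def[abs_def] by (intro continuous_intros)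
  ultimately have "bounded (range \<Psi>)" by (rule periodic_bounded[OF _ T])
  then obtain B where B: "\<And>t. \<bar>\<Psi> t\<bar> \<le> B" by (auto simp: bounded_iff)
  have "\<bar>\<Phi> t - \<Phi> s - \<Lambda> / T * (t - s)\<bar> \<le> 2 * B" for s t
  proof -
    have "\<Phi> t - \<Phi> s - \<Lambda> / T * (t - s) = \<Psi> t - \<Psi> s" unfolding \<Psi>_def by (simp add: right_diff_distrib)
    then show ?thesis using B[of t] B[of s] by linarith
  qed
  moreover have "B \<ge> 0" using B[of 0] by linarith
  ultimately show ?thesis unfolding \<Lambda>_def by (intro that[of "2 * B"]) auto
qed

text \<open>The exponent differs by a bounded amount \<open>C\<close> from a linear function whose
  slope is its increment over a period divided by \<open>T\<close>; so \<open>exp C\<close> and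
  \<open>1 / T\<close> serve as the constants of hyperbolicity.\<close>

lemma hyperbolic_of_exponent:
  assumes b: "bounded_solution y (gbar c) b" and per: "\<And>t. b (t + T) = b t" and T: "T > 0"
  shows "(\<And>\<Phi>. (\<And>t. (\<Phi> has_real_derivative - field' c (b t)) (at t)) \<Longrightarrow> \<exists>s. \<Phi> (s + T) - \<Phi> s \<le> - 1) \<Longrightarrow>
      hyperbolic_attractive y (gbar c) b"
    and "(\<And>\<Phi>. (\<And>t. (\<Phi> has_real_derivative - field' c (b t)) (at t)) \<Longrightarrow> \<exists>s. \<Phi> (s + T) - \<Phi> s \<ge> 1) \<Longrightarrow>
      hyperbolic_repulsive y (gbar c) b"
proof -
  obtain \<Phi> where \<Phi>: "\<And>t. (\<Phi> has_real_derivative - field' c (b t)) (at t)"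
    and int: "\<And>s t. (LBINT \<tau>=ereal s..ereal t. deriv (gbar c) (b \<tau>)) = \<Phi> t - \<Phi> s"
    using exponent_antiderivative[OF b] by blast
  {
    assume "\<And>\<Phi>. (\<And>t. (\<Phi> has_real_derivative - field' c (b t)) (at t)) \<Longrightarrow> \<exists>s. \<Phi> (s + T) - \<Phi> s \<le> - 1"
    then obtain r where r: "\<Phi> (r + T) - \<Phi> r \<le> - 1" using \<Phi> by blast
    obtain C where C: "C \<ge> 0" "\<And>s t. \<bar>\<Phi> t - \<Phi> s - (\<Phi> (r + T) - \<Phi> r) / T * (t - s)\<bar> \<le> C"
      using periodic_exponent[of b T \<Phi>, OF per T \<Phi>] by blast
    have "exp (\<Phi> t - \<Phi> s) \<le> exp C * exp (- (1 / T) * (t - s))" if "s \<le> t" for s t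
    proof -
      have "(\<Phi> (r + T) - \<Phi> r) / T \<le> - 1 / T" using r T by (intro divide_right_mono) auto
      then have "(\<Phi> (r + T) - \<Phi> r) / T * (t - s) \<le> - (1 / T) * (t - s)"
        using that by (intro mult_right_mono) auto
      then have "\<Phi> t - \<Phi> s \<le> C + - (1 / T) * (t - s)" using C(2)[of t s] by linarith
      then show ?thesis unfolding exp_add[symmetric] by simp
    qed
    moreover have "exp C \<ge> 1" "1 / T > 0" using C(1) T by simp_all
    ultimately show "hyperbolic_attractive y (gbar c) b"
      unfolding hyperbolic_attractive_def int using b by blast
  next
    assume "\<And>\<Phi>. (\<And>t. (\<Phi> has_real_derivative - field' c (b t)) (at t)) \<Longrightarrow> \<exists>s. \<Phi> (s + T) - \<Phi> s \<ge> 1"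
    then obtain r where r: "\<Phi> (r + T) - \<Phi> r \<ge> 1" using \<Phi> by blast
    obtain C where C: "C \<ge> 0" "\<And>s t. \<bar>\<Phi> t - \<Phi> s - (\<Phi> (r + T) - \<Phi> r) / T * (t - s)\<bar> \<le> C"
      using periodic_exponent[of b T \<Phi>, OF per T \<Phi>] by blast
    have "exp (\<Phi> t - \<Phi> s) \<le> exp C * exp (1 / T * (t - s))" if "t \<le> s" for s t
    proof -
      have "1 / T \<le> (\<Phi> (r + T) - \<Phi> r) / T" using r T by (intro divide_right_mono) auto
      then have "(\<Phi> (r + T) - \<Phi> r) / T * (t - s) \<le> 1 / T * (t - s)"
        using that by (intro mult_right_mono_neg) auto
      then have "\<Phi> t - \<Phi> s \<le> C + 1 / T * (t - s)" using C(2)[of t s] by linarith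
      then show ?thesis unfolding exp_add[symmetric] by simp
    qed
    moreover have "exp C \<ge> 1" "1 / T > 0" using C(1) T by simp_all
    ultimately show "hyperbolic_repulsive y (gbar c) b"
      unfolding hyperbolic_repulsive_def int using b by blast
  }
qed

text \<open>Attractivity bounds every forward increment of \<open>\<Phi>\<close> by the logarithm of
  its constant, whereas the increments ending at \<open>s\<close> are unbounded.\<close>

lemma not_attractive_of_growth:
  assumes T: "T > 0"
    and grow: "\<And>\<Phi>. (\<And>t. (\<Phi> has_real_derivative - field' c (b t)) (at t)) \<Longrightarrow>
      \<exists>s. \<forall>k::nat. \<Phi> s \<ge> \<Phi> (s - real k * T) + real k"
  shows "\<not> hyperbolic_attractive y (gbar c) b"
proof
  assume h: "hyperbolic_attractive y (gbar c) b"
  then have b: "bounded_solution y (gbar c) b" by (simp add: hyperbolic_attractive_def)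
  obtain \<Phi> where \<Phi>: "\<And>t. (\<Phi> has_real_derivative - field' c (b t)) (at t)"
    and int: "\<And>s t. (LBINT \<tau>=ereal s..ereal t. deriv (gbar c) (b \<tau>)) = \<Phi> t - \<Phi> s"
    using exponent_antiderivative[OF b] by blast
  obtain s where s: "\<And>k::nat. \<Phi> s \<ge> \<Phi> (s - real k * T) + real k" using grow[OF \<Phi>] by blast
  obtain k \<gamma> where k: "k \<ge> 1" "\<gamma> > 0" "\<And>s t. s \<le> t \<Longrightarrow> exp (\<Phi> t - \<Phi> s) \<le> k * exp (- \<gamma> * (t - s))"
    using h unfolding hyperbolic_attractive_def int by blast
  obtain n :: nat where n: "real n > ln k" using reals_Archimedean2 by blast
  have "exp (real n) \<le> exp (\<Phi> s - \<Phi> (s - real n * T))" using s[of n] by simp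
  also have "\<dots> \<le> k * exp (- \<gamma> * (s - (s - real n * T)))" using T by (intro k(3)) auto
  also have "\<dots> \<le> k * 1" using k T by (intro mult_left_mono) auto
  finally have "real n \<le> ln k" using k(1) by (simp add: ln_ge_iff)
  with n show False by simp
qed

text \<open>After \<open>s\<close> the solution stays nonnegative, hence follows the entire solution
  \<open>z\<close> of the modified equation. Continuing it by \<open>z\<close> would enlarge its
  domain, so maximality forces the domain to contain all later times.\<close>

lemma maximal_solution_extends:
  assumes max: "maximal_solution y (gbar c) x J" and s: "s \<in> J" "x s \<ge> 0"
    and z: "entire_solution y (field c) z" "z s = x s"
  shows "{s..} \<subseteq> J" and "\<And>t. t \<ge> s \<Longrightarrow> x t = z t"
proof -
  have sol: "solves y (gbar c) x J" using max[unfolded maximal_solution_def] by (rule conjunct1)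
  have J: "open J" "is_interval J" using sol by (simp_all add: solves_def)
  have der: "(x has_real_derivative y t + gbar c (x t)) (at t)" if "t \<in> J" for t
    using sol that by (simp add: solves_def)
  have seg: "{s..t} \<subseteq> J" if "t \<in> J" for t
  proof
    fix r assume r: "r \<in> {s..t}"
    then show "r \<in> J" using mem_is_interval_1_I[OF J(2) s(1) that, of r] by simp
  qed
  have z_nonneg: "z t \<ge> 0" if "t \<ge> s" for t
  proof (rule absorbing_below[where h = z and a = s and \<tau> = 0 and k = 0, OF _ _ _ _ entire_solutionD[OF z(1)]])
    show "0 \<le> y r - field c (z r)" if "z r < 0" for r
    proof -
      have "(1 + 2 * c) * z r \<le> 0" using that c_pos by (intro mult_nonneg_nonpos) auto
      then show ?thesis using \<mu>(2)[of r] \<mu>(1) field_nonpos[of "z r" c] that by linarith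
    qed
  qed (use that z(2) s in auto)
  have x_nonneg: "x t \<ge> 0" if "t \<in> J" "t \<ge> s" for t
  proof (rule absorbing_below[where h = x and a = s and \<tau> = 0 and k = 0 and b = t])
    show "(x has_real_derivative y r + gbar c (x r)) (at r)" if "s \<le> r" "r \<le> t" for r
      using der seg[OF \<open>t \<in> J\<close>] that by auto
    show "0 \<le> y r + gbar c (x r)" if "x r < 0" for r
      using \<mu>(2)[of r] \<mu>(1) gbar_nonneg_left[OF c_pos, of "x r"] that by linarith
  qed (use that s in auto)
  have x_field: "(x has_real_derivative y r - field c (x r)) (at r)" if "r \<in> J" "s \<le> r" for r
    using der[OF that(1)] x_nonneg[OF that] by (simp add: gbar_eq_field)
  have eq: "x t = z t" if t: "t \<in> J" "t \<ge> s" for t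
  proof (rule antisym)
    have d: "(x has_real_derivative y r - field c (x r)) (at r)" if "s \<le> r" "r \<le> t" for r
      using x_field[of r] seg[OF t(1)] that by auto
    show "x t \<le> z t"
      by (rule solution_le[where a = s and b = t]) (use t z(2) d entire_solutionD[OF z(1)] in auto)
    show "z t \<le> x t"
      by (rule solution_le[where a = s and b = t]) (use t z(2) d entire_solutionD[OF z(1)] in auto)
  qed
  \<comment> \<open>Before \<open>s\<close> only \<open>x\<close> is used, since \<open>z\<close>
    may differ from it there; the domain is extended by the open half-line after \<open>s\<close>,
    on which both agree wherever both are defined.\<close>
  define w where "w t = (if t \<in> J then x t else z t)" for t
  have w_z: "w t = z t" if "t \<ge> s" for t using eq[of t] that by (simp add: w_def)
  have "solves y (gbar c) w (J \<union> {s<..})"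
    unfolding solves_def
  proof (intro conjI ballI)
    show "open (J \<union> {s<..})" using J(1) by auto
    have "J \<union> {s<..} = J \<union> {s..}" using s(1) by (auto simp: less_le)
    moreover have "is_interval (J \<union> {s..})"
      using s(1) J(2) unfolding is_interval_connected_1
      by (intro connected_Un) (auto simp: is_interval_connected_1[symmetric])
    ultimately show "is_interval (J \<union> {s<..})" by simp
    fix t assume "t \<in> J \<union> {s<..}"
    then consider "t \<in> J" | "t > s" by blast
    then show "(w has_real_derivative y t + gbar c (w t)) (at t)"
    proof cases
      case 1
      have "(w has_real_derivative y t + gbar c (x t)) (at t)"
        by (rule has_field_derivative_transform_within_open[OF der[OF 1] J(1) 1]) (simp add: w_def)
      then show ?thesis using 1 by (simp add: w_def)
    next
      case 2
      have "(w has_real_derivative y t - field c (z t)) (at t)"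
        by (rule has_field_derivative_transform_within_open[OF entire_solutionD[OF z(1)] open_greaterThan[of s]])
           (use 2 w_z in auto)
      then show ?thesis using 2 w_z[of t] z_nonneg[of t] by (simp add: gbar_eq_field)
    qed
  qed
  moreover have "\<forall>t\<in>J. w t = x t" by (simp add: w_def)
  ultimately have "J \<union> {s<..} = J"
    using max[unfolded maximal_solution_def, THEN conjunct2, THEN spec[of _ w], THEN spec[of _ "J \<union> {s<..}"]]
    by simp
  then have "{s<..} \<subseteq> J" by (simp only: Un_absorb1 subset_Un_eq Un_commute)
  then show sub: "{s..} \<subseteq> J" using s(1) by (auto simp: le_less)
  show "x t = z t" if "t \<ge> s" for t using eq[of t] sub that by auto
qed

lemma attracts_of_entire:
  assumes "\<And>v. P v \<Longrightarrow> v \<ge> 0"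
    and "\<And>z. entire_solution y (field c) z \<Longrightarrow> P (z s) \<Longrightarrow> ((\<lambda>t. b t - z t) \<longlongrightarrow> 0) at_top"
  shows "attracts y (gbar c) b s P"
  unfolding attracts_def
proof (intro allI impI; elim conjE)
  fix x J assume x: "maximal_solution y (gbar c) x J" "s \<in> J" "P (x s)"
  obtain z where z: "entire_solution y (field c) z" "z s = x s" using exists_solution by blast
  note ext = maximal_solution_extends[OF x(1,2) assms(1)[OF x(3)] z]
  have "((\<lambda>t. b t - z t) \<longlongrightarrow> 0) at_top" using assms(2)[OF z(1)] x(3) z(2) by simp
  moreover have "\<forall>\<^sub>F t in at_top. b t - z t = b t - x t"
    using ext(2) by (auto simp: eventually_at_top_linorder intro!: exI[of _ s])
  ultimately have "((\<lambda>t. b t - x t) \<longlongrightarrow> 0) at_top" by (rule Lim_transform_eventually)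
  with ext(1) show "{s..} \<subseteq> J \<and> ((\<lambda>t. b t - x t) \<longlongrightarrow> 0) at_top" ..
qed

end

section \<open>Small parameters\<close>

lemma powr_tendsto_0: "s > 0 \<Longrightarrow> ((\<lambda>\<epsilon>::real. \<epsilon> powr s) \<longlongrightarrow> 0) (at_right 0)"
  by (rule tendsto_zero_powrI[OF tendsto_ident_at tendsto_const])
     (auto intro: eventually_mono[OF eventually_at_right_less])

lemma eventually_powr_le:
  assumes "s > 0" "\<eta> > 0"
  shows "\<forall>\<^sub>F \<epsilon>::real in at_right 0. \<epsilon> powr s \<le> \<eta>"
  using order_tendstoD(2)[OF powr_tendsto_0[OF assms(1)] assms(2)] by (auto elim: eventually_mono)

lemma eventually_small:
  fixes \<eta> r :: real
  assumes \<eta>: "\<eta> > 0" and r: "r > 0"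
  shows "\<forall>\<^sub>F \<epsilon> in at_right 0. 0 < \<epsilon> \<and> \<epsilon> \<le> \<eta> \<and> \<epsilon> powr r \<le> \<eta>"
    and "r > 1 \<Longrightarrow> \<forall>\<^sub>F \<epsilon> in at_right 0. \<epsilon> powr r \<le> \<eta> * \<epsilon>"
    and "r < 1 \<Longrightarrow> \<forall>\<^sub>F \<epsilon> in at_right 0. \<epsilon> \<le> \<eta> * \<epsilon> powr r"
proof -
  have pos: "\<forall>\<^sub>F \<epsilon>::real in at_right 0. 0 < \<epsilon>" by (rule eventually_at_right_less)
  have "\<forall>\<^sub>F \<epsilon>::real in at_right 0. \<epsilon> < \<eta>" using \<eta> by (rule eventually_at_right_real[THEN eventually_mono]) auto
  then show "\<forall>\<^sub>F \<epsilon> in at_right 0. 0 < \<epsilon> \<and> \<epsilon> \<le> \<eta> \<and> \<epsilon> powr r \<le> \<eta>"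
    using pos eventually_powr_le[OF r \<eta>] by eventually_elim auto
  show "\<forall>\<^sub>F \<epsilon> in at_right 0. \<epsilon> powr r \<le> \<eta> * \<epsilon>" if "r > 1"
  proof -
    have "\<forall>\<^sub>F \<epsilon>::real in at_right 0. \<epsilon> powr (r - 1) \<le> \<eta>" using that \<eta> by (intro eventually_powr_le) auto
    with pos show ?thesis
    proof eventually_elim
      case (elim \<epsilon>)
      have "\<epsilon> powr r = \<epsilon> powr (r - 1) * \<epsilon>" using elim by (simp add: powr_diff)
      also have "\<dots> \<le> \<eta> * \<epsilon>" using elim by (intro mult_right_mono) auto
      finally show ?case .
    qed
  qed
  show "\<forall>\<^sub>F \<epsilon> in at_right 0. \<epsilon> \<le> \<eta> * \<epsilon> powr r" if "r < 1"
  proof -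
    have "\<forall>\<^sub>F \<epsilon>::real in at_right 0. \<epsilon> powr (1 - r) \<le> \<eta>" using that \<eta> by (intro eventually_powr_le) auto
    with pos show ?thesis
    proof eventually_elim
      case (elim \<epsilon>)
      have "\<epsilon> = \<epsilon> powr (1 - r) * \<epsilon> powr r" using elim by (simp flip: powr_add)
      also have "\<dots> \<le> \<eta> * \<epsilon> powr r" using elim by (intro mult_right_mono) auto
      finally show ?case .
    qed
  qed
qed

context S_shape
begin

text \<open>Here \<open>\<delta>\<close> equals
  \<open>8 * (e / \<epsilon>) * sqrt (6 * e / Q)\<close>, and the root is at most
  \<open>pi / 4\<close>; so \<open>e \<le> \<eta> * \<epsilon>\<close> makes the overshoot as small
  as desired.\<close>

lemma bistable_small:
  assumes d: "d > 0"
  shows "\<exists>\<eta>>0. \<forall>y c \<epsilon> e. forced f f' p q ph qh L K y c \<epsilon> e \<longrightarrow> \<epsilon> \<le> \<eta> \<longrightarrow> e \<le> \<eta> \<longrightarrow> e \<le> \<eta> * \<epsilon> \<longrightarrow>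
    bistable f f' p q ph qh L K y c \<epsilon> e \<and> narrow_window.\<delta> f p q \<epsilon> e \<le> d"
proof -
  obtain \<delta>0 T0 where B: "\<delta>0 > 0" "T0 > 0" "\<And>y c \<epsilon> e. narrow_window f f' p q ph qh L K y c \<epsilon> e \<Longrightarrow>
     e \<le> (f p - f q) / 4 \<Longrightarrow> narrow_window.\<delta> f p q \<epsilon> e \<le> \<delta>0 \<Longrightarrow> forced.T \<epsilon> \<ge> T0 \<Longrightarrow>
     bistable f f' p q ph qh L K y c \<epsilon> e"
    using bistable_window by blast
  define D where "D = f p - f q"
  have D: "D > 0" using fq_less_fp by (simp add: D_def)
  define \<eta> where "\<eta> = min (min (sqrt (D / 16 / (384 * K))) (D / 16 / 6 * (pi / 4)\<^sup>2))
    (min (D / 4) (min (min \<delta>0 d / 8) (1 / T0)))"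
  have \<eta>: "\<eta> > 0" "\<eta> \<le> sqrt (D / 16 / (384 * K))" "\<eta> \<le> D / 16 / 6 * (pi / 4)\<^sup>2" "\<eta> \<le> D / 4"
      "8 * \<eta> \<le> \<delta>0" "8 * \<eta> \<le> d" "\<eta> \<le> 1 / T0"
    using D K B d by (auto simp: \<eta>_def)
  have "bistable f f' p q ph qh L K y c \<epsilon> e \<and> narrow_window.\<delta> f p q \<epsilon> e \<le> d"
    if fo: "forced f f' p q ph qh L K y c \<epsilon> e" and small: "\<epsilon> \<le> \<eta>" "e \<le> \<eta>" "e \<le> \<eta> * \<epsilon>" for y c \<epsilon> e
  proof -
    interpret w: forced f f' p q ph qh L K y c \<epsilon> e by (rule fo)
    have Q: "w.Q = D / 16" by (simp add: w.Q_def D_def)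
    have "384 * K * e\<^sup>2 \<le> w.Q * \<epsilon>\<^sup>2"
    proof -
      have "e\<^sup>2 \<le> (\<eta> * \<epsilon>)\<^sup>2" using small w.e by (intro power_mono) auto
      also have "\<dots> = \<eta>\<^sup>2 * \<epsilon>\<^sup>2" by (rule power_mult_distrib)
      also have "\<dots> \<le> (sqrt (D / 16 / (384 * K)))\<^sup>2 * \<epsilon>\<^sup>2" using \<eta> by (intro mult_right_mono power_mono) auto
      also have "(sqrt (D / 16 / (384 * K)))\<^sup>2 = D / 16 / (384 * K)" using D K by (intro real_sqrt_pow2) simp
      finally have "384 * K * e\<^sup>2 \<le> 384 * K * (D / 16 / (384 * K) * \<epsilon>\<^sup>2)" using K by (intro mult_left_mono) auto
      also have "\<dots> = w.Q * \<epsilon>\<^sup>2" using K by (simp add: Q)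
      finally show ?thesis .
    qed
    moreover have e6: "6 * e \<le> w.Q * (pi / 4)\<^sup>2" using small(2) \<eta>(3) unfolding Q by linarith
    ultimately interpret n: narrow_window f f' p q ph qh L K y c \<epsilon> e by unfold_locales
    have "n.\<delta> \<le> 8 * \<eta>"
    proof -
      have "6 * e / w.Q \<le> (pi / 4)\<^sup>2" using e6 w.Q_pos by (simp add: pos_divide_le_eq mult.commute)
      then have "sqrt (6 * e / w.Q) \<le> pi / 4" by (intro real_le_lsqrt) auto
      then have s: "sqrt (6 * e / w.Q) \<le> 1" using pi_less_4 by linarith
      have "n.\<delta> = 8 * (e / \<epsilon>) * sqrt (6 * e / w.Q)" by (simp add: n.\<delta>_def n.t1_def)
      also have "\<dots> \<le> 8 * (e / \<epsilon>) * 1" using s w.e w.\<epsilon> by (intro mult_left_mono) auto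
      also have "e / \<epsilon> \<le> \<eta>" using small(3) w.\<epsilon> by (simp add: pos_divide_le_eq)
      finally show ?thesis by simp
    qed
    moreover have "w.T \<ge> T0"
    proof -
      have "\<epsilon> \<le> 1 / T0" using small \<eta> by linarith
      then have "\<epsilon> * T0 \<le> 1" using B(2) by (simp add: pos_le_divide_eq)
      also have "1 \<le> 2 * pi" using pi_ge_two by linarith
      finally show ?thesis using w.\<epsilon> by (simp add: w.T_def pos_le_divide_eq mult.commute)
    qed
    ultimately show ?thesis
      using B(3)[OF n.narrow_window_axioms] small \<eta> by (auto simp: D_def)
  qed
  with \<eta>(1) show ?thesis by blast
qed

end

section \<open>Conclusions in the case of three periodic solutions\<close>

lemma periodic_tendsto_0_imp_0:
  fixes d :: "real \<Rightarrow> real"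
  assumes per: "\<And>t. d (t + S) = d t" and S: "S > 0" and lim: "(d \<longlongrightarrow> 0) at_top"
  shows "d t = 0"
proof -
  have "filterlim (\<lambda>n. real n * S) at_top sequentially"
    by (rule filterlim_at_top_mult_tendsto_pos[OF tendsto_const S filterlim_real_sequentially])
  then have "filterlim (\<lambda>n. t + real n * S) at_top sequentially"
    by (rule filterlim_tendsto_add_at_top[OF tendsto_const])
  from filterlim_compose[OF lim this] have "(\<lambda>n. d (t + real n * S)) \<longlonglongrightarrow> 0" .
  moreover have "d (t + real n * S) = d t" for n
    using periodic_int[of d S t "int n", OF per] by simp
  ultimately have "(\<lambda>n::nat. d t) \<longlonglongrightarrow> 0" by simp
  then show ?thesis by (simp add: LIMSEQ_const_iff)
qed

text \<open>An abbreviation for the existential part of the bistable conclusion, unfolded again in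
  the final theorem.\<close>

definition three_states where
  "three_states y g \<longleftrightarrow> (\<exists>l m u. {x. periodic_solution y g x \<and> positive_function x} = {l, m, u} \<and>
     (\<forall>t. l t < m t \<and> m t < u t) \<and> hyperbolic_attractive y g l \<and> hyperbolic_attractive y g u \<and>
     hyperbolic_repulsive y g m \<and> separates_basins y g l m u)"

context
  fixes c :: real
  assumes c: "c > 4"
begin

lemma positive_forcing_forcing:
  assumes "\<epsilon> > 0" "\<epsilon> powr r \<le> lam1 c / 2"
  shows "positive_forcing (forcing c r \<epsilon>) c (lam1 c / 2)"
proof -
  interpret forced "field c" "field' c" "x1 c" "x2 c" "ph c" "qh c" "1 + 2 * c" "12 * c"
    "forcing c r \<epsilon>" "pi / 2 / \<epsilon>" \<epsilon> "\<epsilon> powr r" by (rule forced_forcing[OF c assms(1)])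
  show ?thesis
  proof
    show "c > 0" using c by simp
    show "lam1 c / 2 > 0" using field_value_pos[OF c x2_pos[OF c]] by (simp add: lam_eq[OF c])
    show "lam1 c / 2 \<le> forcing c r \<epsilon> t" for t
      using y_ge_min[of t] assms(2) by (simp add: lam_eq[OF c])
  qed
qed

text \<open>A period of a solution is a period of the forcing.\<close>

lemma period_multiple:
  assumes \<epsilon>: "\<epsilon> > 0" and x: "entire_solution (forcing c r \<epsilon>) (field c) x" and per: "\<And>t. x (t + S) = x t"
  obtains n :: int where "S = of_int n * (2 * pi / \<epsilon>)"
proof -
  interpret forced "field c" "field' c" "x1 c" "x2 c" "ph c" "qh c" "1 + 2 * c" "12 * c"
    "forcing c r \<epsilon>" "pi / 2 / \<epsilon>" \<epsilon> "\<epsilon> powr r" by (rule forced_forcing[OF c \<epsilon>])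
  have y_per: "forcing c r \<epsilon> (t + S) = forcing c r \<epsilon> t" for t
  proof -
    have "((\<lambda>t. x (t + S)) has_real_derivative forcing c r \<epsilon> (t + S) - field c (x (t + S))) (at t)"
      using entire_solutionD[OF x, of "t + S"] DERIV_shift[of x _ t S] by simp
    then have "(x has_real_derivative forcing c r \<epsilon> (t + S) - field c (x t)) (at t)"
      by (simp add: per)
    from DERIV_unique[OF this entire_solutionD[OF x]] show ?thesis by simp
  qed
  have "forcing c r \<epsilon> (pi / 2 / \<epsilon> + S) = forcing c r \<epsilon> (pi / 2 / \<epsilon>)" by (rule y_per)
  then have "cos (\<epsilon> * S) = 1" using amplitude_pos unfolding y by simp
  then obtain n :: int where "\<epsilon> * S = of_int n * 2 * pi" by (auto simp: cos_one_2pi_int)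
  then have "S = of_int n * (2 * pi / \<epsilon>)" using \<epsilon> by (simp add: field_simps)
  with that show ?thesis by blast
qed

text \<open>The last conclusion is the obstruction to relaxation oscillations: a
  \<open>T\<close>-periodic solution is one of the three orbits, and each of them remains on one
  side of the fold \<open>x2 c\<close> up to \<open>d\<close>.\<close>

lemma bistable_conclusion:
  assumes bi: "bistable (field c) (field' c) (x1 c) (x2 c) (ph c) (qh c) (1 + 2 * c) (12 * c)
      (forcing c r \<epsilon>) (pi / 2 / \<epsilon>) \<epsilon> (\<epsilon> powr r)"
    and small: "\<epsilon> powr r \<le> lam1 c / 2"
    and \<delta>: "narrow_window.\<delta> (field c) (x1 c) (x2 c) \<epsilon> (\<epsilon> powr r) \<le> d"
  shows "three_states (forcing c r \<epsilon>) (gbar c)"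
    and "bistability (forcing c r \<epsilon>) (gbar c)"
    and "\<And>x. solves (forcing c r \<epsilon>) (gbar c) x UNIV \<Longrightarrow> periodic_with (2 * pi / \<epsilon>) x \<Longrightarrow>
      (\<forall>t. x t \<le> x2 c + d) \<or> (\<forall>t. x t \<ge> x2 c - d)"
proof -
  interpret bistable "field c" "field' c" "x1 c" "x2 c" "ph c" "qh c" "1 + 2 * c" "12 * c"
    "forcing c r \<epsilon>" "pi / 2 / \<epsilon>" \<epsilon> "\<epsilon> powr r" by (rule bi)
  interpret pos: positive_forcing "forcing c r \<epsilon>" c "lam1 c / 2"
    by (rule positive_forcing_forcing[OF \<epsilon> small])
  let ?y = "forcing c r \<epsilon>" and ?g = "gbar c"
  obtain l m u where sol: "entire_solution ?y (field c) l" "entire_solution ?y (field c) m" "entire_solution ?y (field c) u"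
    and per: "\<And>t. l (t + T) = l t" "\<And>t. m (t + T) = m t" "\<And>t. u (t + T) = u t"
    and lm: "\<And>t. l t < m t" and mu: "\<And>t. m t < u t"
    and loc: "\<And>t. l t \<le> x1 c + \<delta>" "\<And>t. x1 c - \<delta> \<le> m t \<and> m t \<le> x2 c + \<delta>" "\<And>t. u t \<ge> x2 c - \<delta>"
    and l_avg: "\<And>\<Phi>. (\<And>t. (\<Phi> has_real_derivative - field' c (l t)) (at t)) \<Longrightarrow> \<exists>s. \<Phi> (s + T) - \<Phi> s \<le> - 1"
    and m_avg: "\<And>\<Phi>. (\<And>t. (\<Phi> has_real_derivative - field' c (m t)) (at t)) \<Longrightarrow> \<exists>s. \<Phi> (s + T) - \<Phi> s \<ge> 1"
    and u_avg: "\<And>\<Phi>. (\<And>t. (\<Phi> has_real_derivative - field' c (u t)) (at t)) \<Longrightarrow> \<exists>s. \<Phi> (s + T) - \<Phi> s \<le> - 1"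
    and l_attr: "\<And>x s. entire_solution ?y (field c) x \<Longrightarrow> x s < m s \<Longrightarrow> ((\<lambda>t. l t - x t) \<longlongrightarrow> 0) at_top"
    and u_attr: "\<And>x s. entire_solution ?y (field c) x \<Longrightarrow> m s < x s \<Longrightarrow> ((\<lambda>t. u t - x t) \<longlongrightarrow> 0) at_top"
    and grow: "\<And>b \<Phi>. entire_solution ?y (field c) b \<Longrightarrow> bounded (range b) \<Longrightarrow> b \<noteq> l \<Longrightarrow> b \<noteq> u \<Longrightarrow>
      (\<And>t. (\<Phi> has_real_derivative - field' c (b t)) (at t)) \<Longrightarrow> \<exists>s. \<forall>k::nat. \<Phi> s \<ge> \<Phi> (s - real k * T) + real k"
    using three_solutions by blast
  have bd: "bounded (range l)" "bounded (range m)" "bounded (range u)"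
    using periodic_bounded[OF _ T_pos entire_solution_continuous] sol per by blast+
  have bsol: "bounded_solution ?y ?g l" "bounded_solution ?y ?g m" "bounded_solution ?y ?g u"
    using sol bd by (simp_all add: pos.bounded_solution_iff)
  have posf: "l t > 0" "m t > 0" "u t > 0" for t using pos.bounded_solution_positive bsol by blast+
  \<comment> \<open>Any period \<open>S\<close> is a multiple of \<open>T\<close>, so the difference
    to the attracting orbit is \<open>S\<close>-periodic; tending to 0, it vanishes.\<close>
  have classify: "x = l \<or> x = m \<or> x = u"
    if x: "entire_solution ?y (field c) x" and S: "S > 0" "\<And>t. x (t + S) = x t" for x S
  proof -
    obtain n :: int where n: "S = of_int n * (2 * pi / \<epsilon>)" using period_multiple[OF \<epsilon> x S(2)] by blast
    then have nT: "S = of_int n * T" by (simp add: T_def)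
    have eq: "b = x" if b: "\<And>t. b (t + T) = b t" and lim: "((\<lambda>t. b t - x t) \<longlongrightarrow> 0) at_top" for b
    proof
      fix t
      have "b t - x t = 0"
        by (rule periodic_tendsto_0_imp_0[OF _ S(1) lim])
           (use S(2) periodic_int[of b T _ n, OF b] nT in simp)
      then show "b t = x t" by simp
    qed
    consider "x 0 < m 0" | "x 0 = m 0" | "m 0 < x 0" by linarith
    then show ?thesis
    proof cases
      case 1
      then show ?thesis using eq[OF per(1) l_attr[OF x]] by blast
    next
      case 2
      then show ?thesis using solution_unique[OF x sol(2)] by blast
    next
      case 3
      then show ?thesis using eq[OF per(3) u_attr[OF x]] by blast
    qed
  qed
  have hyp: "hyperbolic_attractive ?y ?g l" "hyperbolic_attractive ?y ?g u" "hyperbolic_repulsive ?y ?g m"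
    using pos.hyperbolic_of_exponent(1)[OF bsol(1) per(1) T_pos l_avg]
      pos.hyperbolic_of_exponent(1)[OF bsol(3) per(3) T_pos u_avg]
      pos.hyperbolic_of_exponent(2)[OF bsol(2) per(2) T_pos m_avg] by blast+
  have set: "{x. periodic_solution ?y ?g x \<and> positive_function x} = {l, m, u}"
  proof (intro set_eqI iffI)
    fix x assume "x \<in> {x. periodic_solution ?y ?g x \<and> positive_function x}"
    then have x: "solves ?y ?g x UNIV" "\<And>t. x t \<ge> 0" and "\<exists>S>0. periodic_with S x"
      by (auto simp: periodic_solution_def positive_function_def)
    then obtain S where S: "S > 0" "\<And>t. x (t + S) = x t" by (auto simp: periodic_with_def)
    show "x \<in> {l, m, u}" using classify[of x S] S x(1) solves_nonneg_iff[OF x(2)] by auto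
  next
    fix x assume "x \<in> {l, m, u}"
    then have "bounded_solution ?y ?g x" "\<And>t. x (t + T) = x t" "\<And>t. x t > 0"
      using bsol per posf by auto
    then show "x \<in> {x. periodic_solution ?y ?g x \<and> positive_function x}"
      using T_pos
      by (auto simp: periodic_solution_def positive_function_def bounded_solution_def periodic_with_def less_imp_le)
  qed
  have sep: "separates_basins ?y ?g l m u"
    unfolding separates_basins_def
  proof (intro allI conjI)
    fix s
    show "attracts ?y ?g u s (\<lambda>v. m s < v)"
      by (rule pos.attracts_of_entire) (use posf(2)[of s] u_attr in auto)
    show "attracts ?y ?g l s (\<lambda>v. 0 \<le> v \<and> v < m s)"
      by (rule pos.attracts_of_entire) (use l_attr in auto)
  qed
  show "three_states ?y ?g"
    unfolding three_states_def
    by (intro exI[of _ l] exI[of _ m] exI[of _ u]) (use set lm mu hyp sep in simp)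
  have "b = l \<or> b = u" if "hyperbolic_attractive ?y ?g b" for b
  proof (rule ccontr)
    assume ne: "\<not> (b = l \<or> b = u)"
    have b: "entire_solution ?y (field c) b" "bounded (range b)"
      using that by (simp_all add: hyperbolic_attractive_def pos.bounded_solution_iff)
    have "\<not> hyperbolic_attractive ?y ?g b"
      by (rule pos.not_attractive_of_growth[OF T_pos grow[OF b]]) (use ne in auto)
    with that show False by simp
  qed
  then have attr: "{x. hyperbolic_attractive ?y ?g x} = {l, u}" using hyp by auto
  have "uniformly_separated l u"
  proof -
    have "continuous_on {0..T} (\<lambda>t. u t - l t)"
      by (intro continuous_intros entire_solution_continuous[OF sol(1)] entire_solution_continuous[OF sol(3)])
    then obtain t0 where t0: "\<And>t. t \<in> {0..T} \<Longrightarrow> u t0 - l t0 \<le> u t - l t"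
      using continuous_attains_inf[of "{0..T}" "\<lambda>t. u t - l t"] T_pos by fastforce
    have "u t0 - l t0 \<le> \<bar>l t - u t\<bar>" for t
    proof -
      obtain k where k: "0 \<le> t + of_int k * T" "t + of_int k * T < 0 + T"
        using periodic_representative[OF T_pos] by blast
      then have "u t0 - l t0 \<le> u (t + of_int k * T) - l (t + of_int k * T)" by (intro t0) auto
      then show ?thesis using periodic_int[of l T t k, OF per(1)] periodic_int[of u T t k, OF per(3)] by simp
    qed
    then have "(INF t. \<bar>l t - u t\<bar>) \<ge> u t0 - l t0" by (intro cINF_greatest) auto
    then show ?thesis using lm[of t0] mu[of t0] by (simp add: uniformly_separated_def)
  qed
  then show "bistability ?y ?g"
    unfolding bistability_def positive_function_def using attr posf lm[of 0] mu[of 0]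
    by (intro exI[of _ l] exI[of _ u]) (auto simp: less_imp_le)
  fix x assume x: "solves ?y ?g x UNIV" "periodic_with (2 * pi / \<epsilon>) x"
  have xT: "x (t + T) = x t" for t using x(2) by (simp add: periodic_with_def T_def)
  have "continuous_on UNIV x"
    using x(1) by (auto simp: solves_def intro!: continuous_at_imp_continuous_on DERIV_isCont)
  then have "bounded (range x)" by (rule periodic_bounded[of x T, OF xT T_pos])
  then have "entire_solution ?y (field c) x"
    using x(1) pos.bounded_solution_iff[of x] by (simp add: bounded_solution_def)
  then have "x = l \<or> x = m \<or> x = u" by (rule classify[of x T, OF _ T_pos xT])
  then show "(\<forall>t. x t \<le> x2 c + d) \<or> (\<forall>t. x t \<ge> x2 c - d)"
  proof (elim disjE)
    assume "x = l"
    then show ?thesis using loc(1) \<delta> p_less_q by (intro disjI1 allI) (meson add_mono less_imp_le order_trans)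
  next
    assume "x = m"
    then show ?thesis using loc(2) \<delta> by (intro disjI1 allI) (meson add_left_mono order_trans)
  next
    assume "x = u"
    then show ?thesis using loc(3) \<delta> by (intro disjI2 allI) (meson diff_left_mono order_trans)
  qed
qed

end

section \<open>Conclusions in the case of a single attractor\<close>

definition single_state where
  "single_state y g \<longleftrightarrow> (\<exists>b. {x. bounded_solution y g x \<and> positive_function x} = {b} \<and>
     periodic_solution y g b \<and> hyperbolic_attractive y g b \<and> (\<forall>s. attracts y g b s (\<lambda>v. 0 \<le> v)))"

context
  fixes c :: real
  assumes c: "c > 4"
begin

lemma relaxing_conclusion:
  assumes re: "relaxing (field c) (field' c) (x1 c) (x2 c) (ph c) (qh c) (1 + 2 * c) (12 * c)
      (forcing c r \<epsilon>) (pi / 2 / \<epsilon>) \<epsilon> (\<epsilon> powr r) a M"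
    and small: "\<epsilon> powr r \<le> lam1 c / 2"
  shows "single_state (forcing c r \<epsilon>) (gbar c)"
    and "uniform_stability (forcing c r \<epsilon>) (gbar c)"
    and "\<exists>b. bounded_solution (forcing c r \<epsilon>) (gbar c) b \<and> periodic_with (2 * pi / \<epsilon>) b" (is ?per)
proof -
  interpret relaxing "field c" "field' c" "x1 c" "x2 c" "ph c" "qh c" "1 + 2 * c" "12 * c"
    "forcing c r \<epsilon>" "pi / 2 / \<epsilon>" \<epsilon> "\<epsilon> powr r" a M by (rule re)
  interpret pos: positive_forcing "forcing c r \<epsilon>" c "lam1 c / 2"
    by (rule positive_forcing_forcing[OF c \<epsilon> small])
  let ?y = "forcing c r \<epsilon>" and ?g = "gbar c"
  obtain b where b: "entire_solution ?y (field c) b" "\<And>t. b (t + T) = b t"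
    and unique: "\<And>x. entire_solution ?y (field c) x \<Longrightarrow> bounded (range x) \<Longrightarrow> x = b"
    and avg: "\<And>\<Phi>. (\<And>t. (\<Phi> has_real_derivative - field' c (b t)) (at t)) \<Longrightarrow> \<exists>s. \<Phi> (s + T) - \<Phi> s \<le> - 1"
    and attr: "\<And>x. entire_solution ?y (field c) x \<Longrightarrow> ((\<lambda>t. b t - x t) \<longlongrightarrow> 0) at_top"
    using unique_attractor by blast
  have "bounded (range b)" by (rule periodic_bounded[of b T, OF b(2) T_pos entire_solution_continuous[OF b(1)]])
  then have bsol: "bounded_solution ?y ?g b" using b(1) by (simp add: pos.bounded_solution_iff)
  have posb: "b t > 0" for t by (rule pos.bounded_solution_positive[OF bsol])
  then have posf: "positive_function b" by (simp add: positive_function_def less_imp_le)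
  have all: "x = b" if "bounded_solution ?y ?g x" for x
    using unique that by (simp add: pos.bounded_solution_iff)
  have hyp: "hyperbolic_attractive ?y ?g b"
    by (rule pos.hyperbolic_of_exponent(1)[OF bsol b(2) T_pos avg])
  have pw: "periodic_with T b" unfolding periodic_with_def using b(2) by blast
  then have per: "periodic_solution ?y ?g b"
    using bsol T_pos unfolding periodic_solution_def bounded_solution_def by blast
  have att: "attracts ?y ?g b s (\<lambda>v. 0 \<le> v)" for s
    by (rule pos.attracts_of_entire) (use attr in auto)
  have "{x. bounded_solution ?y ?g x \<and> positive_function x} = {b}"
    using all bsol posf by blast
  then show "single_state ?y ?g" unfolding single_state_def using per hyp att by blast
  have "{x. bounded_solution ?y ?g x} = {b}" using all bsol by blast
  then show "uniform_stability ?y ?g" unfolding uniform_stability_def using hyp by blast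
  show ?per using bsol pw unfolding T_def by blast
qed

end

section \<open>The limit curve and relaxation oscillations\<close>

lemma hausdorff_distance_ge:
  assumes A: "A \<noteq> {}" and B: "bounded B" and P: "P \<in> B" "\<And>a. a \<in> A \<Longrightarrow> d \<le> dist P a"
  shows "d \<le> hausdorff_distance A B"
proof -
  obtain a0 where a0: "a0 \<in> A" using A by blast
  obtain C where C: "\<And>b. b \<in> B \<Longrightarrow> dist a0 b \<le> C" using B by (auto simp: bounded_any_center[of _ a0])
  have "infdist b A \<le> C" if "b \<in> B" for b
    using infdist_le[OF a0, of b] C[OF that] by (simp add: dist_commute)
  then have bdd: "bdd_above ((\<lambda>b. infdist b A) ` B)" by (rule bdd_aboveI2)
  have "d \<le> infdist P A" unfolding infdist_notempty[OF A] using A P(2) by (intro cINF_greatest) auto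
  also have "\<dots> \<le> (SUP b\<in>B. infdist b A)" using P(1) bdd by (intro cSUP_upper)
  finally show ?thesis by (simp add: hausdorff_distance_def)
qed

context
  fixes c :: real
  assumes c: "c > 4"
begin

lemma limit_curve_eq:
  "limit_curve c = half_curve (field c) (x1 c) (x2 c) (qh c) \<union>
    (\<lambda>P. - P) ` half_curve (\<lambda>x. - field c (- x)) (- x2 c) (- x1 c) (- ph c)"
proof -
  note fp = fold_points[OF c] and lp = landing_points[OF c]
  have g: "- gbar c x = field c x" if "x \<ge> 0" for x using gbar_eq_field[OF that] by simp
  have 1: "{(- gbar c x, x) |x. x \<in> {ph c..x1 c} \<union> {x2 c..qh c}}
      = {(field c x, x) |x. x \<in> {ph c..x1 c}} \<union> {(field c x, x) |x. x \<in> {x2 c..qh c}}"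
    using g fp lp by force
  have 2: "(\<lambda>P. - P) ` half_curve (\<lambda>x. - field c (- x)) (- x2 c) (- x1 c) (- ph c)
      = {(field c x, x) |x. x \<in> {ph c..x1 c}} \<union> {field c (x2 c)} \<times> {ph c..x2 c}"
  proof (intro set_eqI iffI)
    fix P assume "P \<in> (\<lambda>P. - P) ` half_curve (\<lambda>x. - field c (- x)) (- x2 c) (- x1 c) (- ph c)"
    then show "P \<in> {(field c x, x) |x. x \<in> {ph c..x1 c}} \<union> {field c (x2 c)} \<times> {ph c..x2 c}"
      by (auto simp: half_curve_def)
  next
    fix P assume P: "P \<in> {(field c x, x) |x. x \<in> {ph c..x1 c}} \<union> {field c (x2 c)} \<times> {ph c..x2 c}"
    have "- P \<in> half_curve (\<lambda>x. - field c (- x)) (- x2 c) (- x1 c) (- ph c)"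
      using P by (auto simp: half_curve_def)
    then show "P \<in> (\<lambda>P. - P) ` half_curve (\<lambda>x. - field c (- x)) (- x2 c) (- x1 c) (- ph c)"
      by (rule rev_image_eqI) simp
  qed
  show ?thesis
    unfolding limit_curve_def xhat1_eq[OF c] xhat2_eq[OF c] lam_eq[OF c] 1 2 half_curve_def[of "field c" "x1 c" "x2 c" "qh c"]
    by blast
qed

lemma bounded_limit_curve: "bounded (limit_curve c)"
proof -
  have "bounded (half_curve f p q h)" if "continuous_on UNIV f" for f and p q h :: real
  proof (rule bounded_subset)
    have "bounded (f ` {q..h})"
      by (intro compact_imp_bounded compact_continuous_image continuous_on_subset[OF that]) auto
    then show "bounded ((f ` {q..h} \<union> {f p}) \<times> ({p..h} \<union> {q..h}))"
      by (intro bounded_Times) auto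
    show "half_curve f p q h \<subseteq> (f ` {q..h} \<union> {f p}) \<times> ({p..h} \<union> {q..h})"
      by (auto simp: half_curve_def)
  qed
  note bd = this
  interpret S_shape "field c" "field' c" "x1 c" "x2 c" "ph c" "qh c" "1 + 2 * c" "12 * c" by (rule S_shape_field[OF c])
  interpret mir: S_shape "\<lambda>x. - field c (- x)" "\<lambda>x. field' c (- x)" "- x2 c" "- x1 c" "- qh c" "- ph c" "1 + 2 * c" "12 * c"
    by (rule mirror)
  have "bounded ((\<lambda>P. - P) ` half_curve (\<lambda>x. - field c (- x)) (- x2 c) (- x1 c) (- ph c))"
    unfolding bounded_uminus by (rule bd[OF mir.f_cont])
  then show ?thesis unfolding limit_curve_eq using bd[OF f_cont] by simp
qed

text \<open>The limit curve contains both landing points, at heights \<open>qh c\<close> above the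
  fold \<open>x2 c\<close> and \<open>ph c\<close> below it. A periodic solution confined to one
  side of \<open>x2 c\<close> stays at distance at least \<open>d\<close> from one of them.\<close>

lemma no_relaxation_oscillation:
  assumes r: "r > 1"
  shows "\<nexists>x. relaxation_oscillation c r x"
    and "\<forall>\<^sub>F \<epsilon> in at_right 0. three_states (forcing c r \<epsilon>) (gbar c) \<and>
        bistability (forcing c r \<epsilon>) (gbar c)"
proof -
  interpret S_shape "field c" "field' c" "x1 c" "x2 c" "ph c" "qh c" "1 + 2 * c" "12 * c" by (rule S_shape_field[OF c])
  define d where "d = min (qh c - x2 c) (x2 c - ph c) / 3"
  have d: "d > 0" "2 * d \<le> qh c - x2 c" "2 * d \<le> x2 c - ph c" using qh ph p_less_q by (auto simp: d_def min_def)
  obtain \<eta> where \<eta>: "\<eta> > 0" "\<And>y c0 \<epsilon> e.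
      forced (field c) (field' c) (x1 c) (x2 c) (ph c) (qh c) (1 + 2 * c) (12 * c) y c0 \<epsilon> e \<Longrightarrow>
      \<epsilon> \<le> \<eta> \<Longrightarrow> e \<le> \<eta> \<Longrightarrow> e \<le> \<eta> * \<epsilon> \<Longrightarrow>
      bistable (field c) (field' c) (x1 c) (x2 c) (ph c) (qh c) (1 + 2 * c) (12 * c) y c0 \<epsilon> e \<and>
      narrow_window.\<delta> (field c) (x1 c) (x2 c) \<epsilon> e \<le> d"
    using bistable_small[OF d(1)] by blast
  have lam: "lam1 c / 2 > 0" using field_value_pos[OF c x2_pos[OF c]] by (simp add: lam_eq[OF c])
  have r0: "r > 0" using r by simp
  have small: "\<forall>\<^sub>F \<epsilon> in at_right 0. 0 < \<epsilon> \<and> \<epsilon> \<le> \<eta> \<and> \<epsilon> powr r \<le> \<eta> \<and> \<epsilon> powr r \<le> \<eta> * \<epsilon> \<and> \<epsilon> powr r \<le> lam1 c / 2"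
    using eventually_small(1)[OF \<eta>(1) r0] eventually_small(2)[OF \<eta>(1) r0 r] eventually_small(1)[OF lam r0]
    by eventually_elim auto
  have bi: "bistable (field c) (field' c) (x1 c) (x2 c) (ph c) (qh c) (1 + 2 * c) (12 * c)
        (forcing c r \<epsilon>) (pi / 2 / \<epsilon>) \<epsilon> (\<epsilon> powr r)" "narrow_window.\<delta> (field c) (x1 c) (x2 c) \<epsilon> (\<epsilon> powr r) \<le> d"
    if "0 < \<epsilon> \<and> \<epsilon> \<le> \<eta> \<and> \<epsilon> powr r \<le> \<eta> \<and> \<epsilon> powr r \<le> \<eta> * \<epsilon> \<and> \<epsilon> powr r \<le> lam1 c / 2" for \<epsilon>
    using \<eta>(2)[OF forced_forcing[OF c, of \<epsilon> r]] that by blast+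
  show "\<forall>\<^sub>F \<epsilon> in at_right 0. three_states (forcing c r \<epsilon>) (gbar c) \<and>
        bistability (forcing c r \<epsilon>) (gbar c)"
    using small
  proof (rule eventually_mono, intro conjI)
    fix \<epsilon> assume \<epsilon>: "0 < \<epsilon> \<and> \<epsilon> \<le> \<eta> \<and> \<epsilon> powr r \<le> \<eta> \<and> \<epsilon> powr r \<le> \<eta> * \<epsilon> \<and> \<epsilon> powr r \<le> lam1 c / 2"
    show "three_states (forcing c r \<epsilon>) (gbar c)"
      by (rule bistable_conclusion(1)[OF c bi(1)[OF \<epsilon>] _ bi(2)[OF \<epsilon>]]) (use \<epsilon> in simp)
    show "bistability (forcing c r \<epsilon>) (gbar c)"
      by (rule bistable_conclusion(2)[OF c bi(1)[OF \<epsilon>] _ bi(2)[OF \<epsilon>]]) (use \<epsilon> in simp)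
  qed
  show "\<nexists>x. relaxation_oscillation c r x"
  proof
    assume "\<exists>x. relaxation_oscillation c r x"
    then obtain x where sol: "\<forall>\<^sub>F \<epsilon> in at_right 0. solves (forcing c r \<epsilon>) (gbar c) (x \<epsilon>) UNIV \<and> periodic_with (2 * pi / \<epsilon>) (x \<epsilon>)"
      and lim: "((\<lambda>\<epsilon>. hausdorff_distance (range (\<lambda>t. (forcing c r \<epsilon> t, x \<epsilon> t))) (limit_curve c)) \<longlongrightarrow> 0) (at_right 0)"
      unfolding relaxation_oscillation_def by blast
    have "\<forall>\<^sub>F \<epsilon> in at_right 0. hausdorff_distance (range (\<lambda>t. (forcing c r \<epsilon> t, x \<epsilon> t))) (limit_curve c) < d"
      using order_tendstoD(2)[OF lim d(1)] .
    then have "\<forall>\<^sub>F \<epsilon>::real in at_right 0. False"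
      using sol small
    proof eventually_elim
      case (elim \<epsilon>)
      have loc: "(\<forall>t. x \<epsilon> t \<le> x2 c + d) \<or> (\<forall>t. x \<epsilon> t \<ge> x2 c - d)"
        by (rule bistable_conclusion(3)[OF c bi(1)[OF elim(3)] _ bi(2)[OF elim(3)]]) (use elim in auto)
      have top: "(lam2 c, qh c) \<in> limit_curve c" and bot: "(lam1 c, ph c) \<in> limit_curve c"
        using qh ph p_less_q by (auto simp: limit_curve_def xhat1_eq[OF c] xhat2_eq[OF c])
      have far: "d \<le> hausdorff_distance (range (\<lambda>t. (forcing c r \<epsilon> t, x \<epsilon> t))) (limit_curve c)"
        if P: "P \<in> limit_curve c" "\<And>t. d \<le> \<bar>snd P - x \<epsilon> t\<bar>" for P
      proof (rule hausdorff_distance_ge[OF _ bounded_limit_curve P(1)])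
        fix a assume "a \<in> range (\<lambda>t. (forcing c r \<epsilon> t, x \<epsilon> t))"
        then obtain t where "a = (forcing c r \<epsilon> t, x \<epsilon> t)" by blast
        then show "d \<le> dist P a" using P(2)[of t] dist_snd_le[of P a] by (simp add: dist_real_def)
      qed simp
      from loc show False
      proof
        assume "\<forall>t. x \<epsilon> t \<le> x2 c + d"
        then have "d \<le> \<bar>qh c - x \<epsilon> t\<bar>" for t using d(2) by (smt (verit))
        then show False using far[OF top] elim(1) by simp
      next
        assume "\<forall>t. x \<epsilon> t \<ge> x2 c - d"
        then have "d \<le> \<bar>ph c - x \<epsilon> t\<bar>" for t using d(3) by (smt (verit))
        then show False using far[OF bot] elim(1) by simp
      qed
    qed
    then show False by (simp add: trivial_limit_at_right_real)
  qed
qed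

lemma relaxation_oscillation_exists:
  assumes r: "0 < r" "r < 1"
  shows "\<exists>x. relaxation_oscillation c r x"
    and "\<forall>\<^sub>F \<epsilon> in at_right 0. single_state (forcing c r \<epsilon>) (gbar c) \<and>
        uniform_stability (forcing c r \<epsilon>) (gbar c)"
proof -
  interpret S_shape "field c" "field' c" "x1 c" "x2 c" "ph c" "qh c" "1 + 2 * c" "12 * c" by (rule S_shape_field[OF c])
  obtain a M \<eta> where \<eta>: "\<eta> > 0" "\<And>y c0 \<epsilon> e.
      forced (field c) (field' c) (x1 c) (x2 c) (ph c) (qh c) (1 + 2 * c) (12 * c) y c0 \<epsilon> e \<Longrightarrow>
      e \<le> \<eta> \<Longrightarrow> \<epsilon> \<le> \<eta> * e \<Longrightarrow>
      relaxing (field c) (field' c) (x1 c) (x2 c) (ph c) (qh c) (1 + 2 * c) (12 * c) y c0 \<epsilon> e a M"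
    using relaxing_exists by blast
  have lam: "lam1 c / 2 > 0" using field_value_pos[OF c x2_pos[OF c]] by (simp add: lam_eq[OF c])
  have small: "\<forall>\<^sub>F \<epsilon> in at_right 0. 0 < \<epsilon> \<and> \<epsilon> powr r \<le> \<eta> \<and> \<epsilon> \<le> \<eta> * \<epsilon> powr r \<and> \<epsilon> powr r \<le> lam1 c / 2"
    using eventually_small(1)[OF \<eta>(1) r(1)] eventually_small(3)[OF \<eta>(1) r] eventually_small(1)[OF lam r(1)]
    by eventually_elim auto
  have re: "relaxing (field c) (field' c) (x1 c) (x2 c) (ph c) (qh c) (1 + 2 * c) (12 * c)
        (forcing c r \<epsilon>) (pi / 2 / \<epsilon>) \<epsilon> (\<epsilon> powr r) a M"
    if "0 < \<epsilon> \<and> \<epsilon> powr r \<le> \<eta> \<and> \<epsilon> \<le> \<eta> * \<epsilon> powr r \<and> \<epsilon> powr r \<le> lam1 c / 2" for \<epsilon>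
    using \<eta>(2)[OF forced_forcing[OF c, of \<epsilon> r]] that by blast
  show "\<forall>\<^sub>F \<epsilon> in at_right 0. single_state (forcing c r \<epsilon>) (gbar c) \<and>
        uniform_stability (forcing c r \<epsilon>) (gbar c)"
    using small
  proof (rule eventually_mono)
    fix \<epsilon> assume \<epsilon>: "0 < \<epsilon> \<and> \<epsilon> powr r \<le> \<eta> \<and> \<epsilon> \<le> \<eta> * \<epsilon> powr r \<and> \<epsilon> powr r \<le> lam1 c / 2"
    then have s: "\<epsilon> powr r \<le> lam1 c / 2" by simp
    show "single_state (forcing c r \<epsilon>) (gbar c) \<and> uniform_stability (forcing c r \<epsilon>) (gbar c)"
      by (rule conjI[OF relaxing_conclusion(1)[OF c re[OF \<epsilon>] s] relaxing_conclusion(2)[OF c re[OF \<epsilon>] s]])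
  qed
  \<comment> \<open>The family is fixed before the tolerance \<open>\<rho>\<close>; the profile
    estimate applies to every bounded solution, hence to this one for each \<open>\<rho>\<close>.
    Values for large \<open>\<epsilon>\<close> do not affect the limit.\<close>
  define x where "x \<epsilon> = (SOME b. bounded_solution (forcing c r \<epsilon>) (gbar c) b \<and> periodic_with (2 * pi / \<epsilon>) b)" for \<epsilon>
  have x: "bounded_solution (forcing c r \<epsilon>) (gbar c) (x \<epsilon>) \<and> periodic_with (2 * pi / \<epsilon>) (x \<epsilon>)"
    if "0 < \<epsilon> \<and> \<epsilon> powr r \<le> \<eta> \<and> \<epsilon> \<le> \<eta> * \<epsilon> powr r \<and> \<epsilon> powr r \<le> lam1 c / 2" for \<epsilon>
    unfolding x_def using someI_ex[OF relaxing_conclusion(3)[OF c re[OF that]]] that by simp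
  have "((\<lambda>\<epsilon>. hausdorff_distance (range (\<lambda>t. (forcing c r \<epsilon> t, x \<epsilon> t))) (limit_curve c)) \<longlongrightarrow> 0) (at_right 0)"
  proof (rule tendstoI)
    fix \<rho> :: real assume \<rho>: "\<rho> > 0"
    define d where "d = min (\<rho> / (2 * (2 + (1 + 2 * c)))) (min (qh c - x2 c) (x1 c - ph c) / 2)"
    have d: "d > 0" "2 * d \<le> qh c - x2 c" "2 * d \<le> x1 c - ph c" "(2 + (1 + 2 * c)) * d < \<rho>"
    proof -
      show "d > 0" using qh ph \<rho> c by (simp add: d_def)
      have "2 * min A (min B C / 2) \<le> B" "2 * min A (min B C / 2) \<le> C" for A B C :: real by linarith+
      then show "2 * d \<le> qh c - x2 c" "2 * d \<le> x1 c - ph c" unfolding d_def by blast+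
      have "(2 + (1 + 2 * c)) * d \<le> (2 + (1 + 2 * c)) * (\<rho> / (2 * (2 + (1 + 2 * c))))"
        using c by (intro mult_left_mono) (auto simp: d_def)
      also have "\<dots> = \<rho> / 2"
      proof -
        have "s * (\<rho> / (2 * s)) = \<rho> / 2" if "s > 0" for s :: real using that by simp
        moreover have "2 + (1 + 2 * c) > 0" using c by simp
        ultimately show ?thesis .
      qed
      finally show "(2 + (1 + 2 * c)) * d < \<rho>" using \<rho> by linarith
    qed
    have d': "d \<le> qh c - x2 c" "d \<le> x1 c - ph c" using d by auto
    obtain \<eta>' where \<eta>': "\<eta>' > 0" "\<And>y c0 \<epsilon> e b.
        forced (field c) (field' c) (x1 c) (x2 c) (ph c) (qh c) (1 + 2 * c) (12 * c) y c0 \<epsilon> e \<Longrightarrow>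
        e \<le> \<eta>' \<Longrightarrow> \<epsilon> \<le> \<eta>' * e \<Longrightarrow> entire_solution y (field c) b \<Longrightarrow> bounded (range b) \<Longrightarrow>
        (\<exists>\<sigma>. profile (field c) (x1 c) (x2 c) (qh c) d \<sigma> (forced.T \<epsilon>) y c0 b \<and>
          profile (\<lambda>x. - field c (- x)) (- x2 c) (- x1 c) (- ph c) d \<sigma> (forced.T \<epsilon>) (\<lambda>t. - y t)
            (c0 + forced.T \<epsilon> / 2) (\<lambda>t. - b t))"
      using profiles_exist[OF d(1) d'] by blast
    show "\<forall>\<^sub>F \<epsilon> in at_right 0.
        dist (hausdorff_distance (range (\<lambda>t. (forcing c r \<epsilon> t, x \<epsilon> t))) (limit_curve c)) 0 < \<rho>"
      using small eventually_small(1)[OF \<eta>'(1) r(1)] eventually_small(3)[OF \<eta>'(1) r]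
    proof eventually_elim
      case (elim \<epsilon>)
      then have \<epsilon>: "\<epsilon> > 0" and s: "\<epsilon> powr r \<le> lam1 c / 2" by auto
      interpret w: forced "field c" "field' c" "x1 c" "x2 c" "ph c" "qh c" "1 + 2 * c" "12 * c"
        "forcing c r \<epsilon>" "pi / 2 / \<epsilon>" \<epsilon> "\<epsilon> powr r" by (rule forced_forcing[OF c \<epsilon>])
      interpret pos: positive_forcing "forcing c r \<epsilon>" c "lam1 c / 2"
        by (rule positive_forcing_forcing[OF c \<epsilon> s])
      have b: "entire_solution (forcing c r \<epsilon>) (field c) (x \<epsilon>)" "bounded (range (x \<epsilon>))" and per: "x \<epsilon> (t + w.T) = x \<epsilon> t" for t
        using x[OF elim(1)] by (simp_all add: pos.bounded_solution_iff periodic_with_def w.T_def)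
      obtain \<sigma> where pr: "profile (field c) (x1 c) (x2 c) (qh c) d \<sigma> w.T (forcing c r \<epsilon>) (pi / 2 / \<epsilon>) (x \<epsilon>)"
          "profile (\<lambda>x. - field c (- x)) (- x2 c) (- x1 c) (- ph c) d \<sigma> w.T (\<lambda>t. - forcing c r \<epsilon> t)
            (pi / 2 / \<epsilon> + w.T / 2) (\<lambda>t. - x \<epsilon> t)"
        using \<eta>'(2)[OF w.forced_axioms _ _ b] elim by blast
      note h = w.curve_hausdorff[OF pr d(1-3) entire_solution_continuous[OF b(1)] per limit_curve_eq]
      show ?case using h d(4) by simp
    qed
  qed
  moreover have "\<forall>\<^sub>F \<epsilon> in at_right 0. solves (forcing c r \<epsilon>) (gbar c) (x \<epsilon>) UNIV \<and> periodic_with (2 * pi / \<epsilon>) (x \<epsilon>)"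
    using small by eventually_elim (use x in \<open>auto simp: bounded_solution_def\<close>)
  ultimately show "\<exists>x. relaxation_oscillation c r x" unfolding relaxation_oscillation_def by blast
qed

end

theorem mainTheorem5:
  fixes c r :: real
  assumes "c > 4" and "r > 0"
  shows "(r > 1 \<longrightarrow>
      (\<nexists>x. relaxation_oscillation c r x) \<and>
      (\<forall>\<^sub>F \<epsilon> in at_right 0.
        (\<exists>l m u.
          {x. periodic_solution (forcing c r \<epsilon>) (gbar c) x \<and> positive_function x} = {l, m, u} \<and>
          (\<forall>t. l t < m t \<and> m t < u t) \<and>
          hyperbolic_attractive (forcing c r \<epsilon>) (gbar c) l \<and>
          hyperbolic_attractive (forcing c r \<epsilon>) (gbar c) u \<and>
          hyperbolic_repulsive (forcing c r \<epsilon>) (gbar c) m \<and>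
          separates_basins (forcing c r \<epsilon>) (gbar c) l m u) \<and>
        bistability (forcing c r \<epsilon>) (gbar c))) \<and>
    (r < 1 \<longrightarrow>
      (\<exists>x. relaxation_oscillation c r x) \<and>
      (\<forall>\<^sub>F \<epsilon> in at_right 0.
        (\<exists>b.
          {x. bounded_solution (forcing c r \<epsilon>) (gbar c) x \<and> positive_function x} = {b} \<and>
          periodic_solution (forcing c r \<epsilon>) (gbar c) b \<and>
          hyperbolic_attractive (forcing c r \<epsilon>) (gbar c) b \<and>
          (\<forall>s. attracts (forcing c r \<epsilon>) (gbar c) b s (\<lambda>v. 0 \<le> v))) \<and>
        uniform_stability (forcing c r \<epsilon>) (gbar c)))"
  by (intro conjI impI;
      rule no_relaxation_oscillation[unfolded three_states_def, OF assms(1)]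
        relaxation_oscillation_exists[unfolded single_state_def, OF assms];
      assumption)

end
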